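(* Suppose $\chi\in(0,1]$ and $r_2=0$. Let $\boldsymbol{f}_o\in\mathbb{R}^n$ and the component $(\boldsymbol{I}_m-\boldsymbol{G}_e\boldsymbol{G}_e^T)\boldsymbol{f}_e$ of $\boldsymbol{f}_e\in\mathbb{R}^m$ be given. Then there exists a unique $\boldsymbol{G}_e^T\boldsymbol{f}_e$ such that the system $$\boldsymbol{A}\frac{\mathrm{d}\boldsymbol{w}}{\mathrm{d}y}=-\boldsymbol{Q}\boldsymbol{w},\quad y\in[0,+\infty),\qquad \boldsymbol{w}(+\infty)=\boldsymbol{0},$$ with the Maxwell-type boundary conditions $$\boldsymbol{M}^T\boldsymbol{S}^{-1}\boldsymbol{M}(\boldsymbol{w}_o(0)+\boldsymbol{f}_o)=-b(\chi)\boldsymbol{M}^T(\boldsymbol{w}_e(0)+\boldsymbol{f}_e),\qquad \boldsymbol{w}=\begin{bmatrix}\boldsymbol{w}_e\\ \boldsymbol{w}_o\end{bmatrix},\ \boldsymbol{w}_e\in\mathbb{R}^m,\ \boldsymbol{w}_o\in\mathbb{R}^n,$$ has a unique solution $\boldsymbol{w}(y)$.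
   Context: Notation. Let $D\ge2$ (dimension) and $M\ge 3$ (moment order) be integers, $\mathbb{I}_M=\{\boldsymbol{\alpha}\in\mathbb{N}^D:|\boldsymbol{\alpha}|\le M\}$ with $|\boldsymbol{\alpha}|=\sum_i\alpha_i$ (here $0\in\mathbb{N}$), and $\boldsymbol{e}_i$ the $i$-th unit vector. $\langle\cdot\rangle=\int_{\mathbb{R}^D}\cdot\,\mathrm{d}\boldsymbol{\xi}$; $\omega(\boldsymbol{\xi})=(2\pi)^{-D/2}\exp(-|\boldsymbol{\xi}|^2/2)$; $\phi_{\boldsymbol{\alpha}}=\frac{(-1)^{|\boldsymbol{\alpha}|}}{\sqrt{\boldsymbol{\alpha}!}}\omega^{-1}\frac{\partial^{|\boldsymbol{\alpha}|}\omega}{\partial\boldsymbol{\xi}^{\boldsymbol{\alpha}}}$ with $\boldsymbol{\alpha}!=\prod_i\alpha_i!$ are the orthonormal Hermite polynomials, $\langle\omega\phi_{\boldsymbol{\alpha}}\phi_{\boldsymbol{\beta}}\rangle=\delta_{\boldsymbol{\alpha},\boldsymbol{\beta}}$. Vectors and matrices are indexed by multi-indices. Index set. $\mathbb{I}\subset\mathbb{I}_M$ satisfies: if $\boldsymbol{\gamma}=(\gamma_i)\in\mathbb{I}$, then $\boldsymbol{\gamma}-\gamma_2\boldsymbol{e}_2+\alpha_2\boldsymbol{e}_2\in\mathbb{I}$ for all $0\le\alpha_2\le M-|\boldsymbol{\gamma}|+\gamma_2$. Let $\mathbb{I}_e=\{\boldsymbol{\alpha}\in\mathbb{I}:\alpha_2\text{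 even}\}$, $\mathbb{I}_o=\{\boldsymbol{\alpha}\in\mathbb{I}:\alpha_2\text{ odd}\}$, $m=\#\mathbb{I}_e$, $n=\#\mathbb{I}_o$; indices in $\mathbb{I}_e$ are ordered before those in $\mathbb{I}_o$. Collision matrix. $\boldsymbol{J}$ (indexed by $\mathbb{I}_M$) is one of the following. (i) $\boldsymbol{J}[\boldsymbol{\alpha},\boldsymbol{\beta}]=-\langle\mathcal{L}[\omega\phi_{\boldsymbol{\beta}}]\phi_{\boldsymbol{\alpha}}\rangle$, with the linearized Boltzmann operator $$\mathcal{L}[f](\boldsymbol{\xi})=\int_{\mathbb{R}^D}\int_{\mathbb{S}^{D-1}}\mathcal{K}[f/\omega]\,\omega(\boldsymbol{\xi})\omega(\boldsymbol{\xi}_1)B(|\boldsymbol{\xi}-\boldsymbol{\xi}_1|,\Theta)\,\mathrm{d}\Theta\,\mathrm{d}\boldsymbol{\xi}_1,\qquad \mathcal{K}[g](\boldsymbol{\xi},\boldsymbol{\xi}_1,\Theta)=g(\boldsymbol{\xi}')+g(\boldsymbol{\xi}_1')-g(\boldsymbol{\xi})-g(\boldsymbol{\xi}_1),$$ where $B$ is a collision kernel and $\boldsymbol{\xi}',\boldsymbol{\xi}_1'$ are the post-collisional velocities determined by $\boldsymbol{\xi}$, $\boldsymbol{\xi}_1$ and $\Theta$. (ii) $\boldsymbol{J}=\boldsymbol{J}_{Sh}$ (linearized Shakhov model with Prandtl number $\Pr$), whose nonzero entries are $\boldsymbol{J}_{Sh}[2\boldsymbol{e}_i,2\boldsymbol{e}_j]=\delta_{ij}-\frac1D$,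 $i,j=1,\dots,D$; $\boldsymbol{J}_{Sh}[\boldsymbol{e}_i+2\boldsymbol{e}_j,\boldsymbol{e}_i+2\boldsymbol{e}_k]=\delta_{jk}-\frac{1-\Pr}{5}\sqrt{1+2\delta_{ij}}\sqrt{1+2\delta_{ik}}$, $i,j,k=1,\dots,D$; and $\boldsymbol{J}_{Sh}[\boldsymbol{\alpha},\boldsymbol{\alpha}]=1$ for $|\boldsymbol{\alpha}|\ge2$ with $\boldsymbol{\alpha}$ not of the form $2\boldsymbol{e}_i$ or $\boldsymbol{e}_i+2\boldsymbol{e}_j$. System matrices. For $\boldsymbol{\alpha},\boldsymbol{\beta}\in\mathbb{I}$: $\boldsymbol{A}[\boldsymbol{\alpha},\boldsymbol{\beta}]=\langle\xi_2\omega\phi_{\boldsymbol{\alpha}}\phi_{\boldsymbol{\beta}}\rangle$ and $\boldsymbol{Q}[\boldsymbol{\alpha},\boldsymbol{\beta}]=\boldsymbol{J}[\boldsymbol{\alpha},\boldsymbol{\beta}]$. One has $\boldsymbol{A}=\begin{bmatrix}\boldsymbol{0}&\boldsymbol{M}\\ \boldsymbol{M}^T&\boldsymbol{0}\end{bmatrix}$ with $\boldsymbol{M}[\boldsymbol{\alpha},\boldsymbol{\beta}]=\langle\xi_2\omega\phi_{\boldsymbol{\beta}}\phi_{\boldsymbol{\alpha}}\rangle$ for $\boldsymbol{\alpha}\in\mathbb{I}_e,\boldsymbol{\beta}\in\mathbb{I}_o$, and $\boldsymbol{Q}=\begin{bmatrix}\boldsymbol{Q}_e&\boldsymbol{0}\\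 \boldsymbol{0}&\boldsymbol{Q}_o\end{bmatrix}$ with $\boldsymbol{Q}_e\in\mathbb{R}^{m\times m}$, $\boldsymbol{Q}_o\in\mathbb{R}^{n\times n}$. Boundary data. $\boldsymbol{S}\in\mathbb{R}^{m\times m}$ has entries $\boldsymbol{S}[\boldsymbol{\alpha},\boldsymbol{\beta}]=\frac{\sqrt{2\pi}}{2}\langle|\xi_2|\omega\phi_{\boldsymbol{\alpha}}\phi_{\boldsymbol{\beta}}\rangle$, $\boldsymbol{\alpha},\boldsymbol{\beta}\in\mathbb{I}_e$ (it is symmetric positive definite); $\chi$ is the accommodation coefficient, and $b(\chi)=\frac{2\chi}{2-\chi}(\sqrt{2\pi})^{-1}$. The matrix $\boldsymbol{G}_e\in\mathbb{R}^{m\times p_1}$ (resp. $\boldsymbol{G}_o\in\mathbb{R}^{n\times p_2}$) has as columns an orthonormal basis of $\mathrm{Null}(\boldsymbol{Q}_e)$ (resp. $\mathrm{Null}(\boldsymbol{Q}_o)$), and $r_2=p_2-\mathrm{rank}(\boldsymbol{G}_e^T\boldsymbol{M}\boldsymbol{G}_o)$. $\boldsymbol{w}(+\infty)$ denotes the limit as $y\to+\infty$.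
   Formalization: For the Shakhov model, Pr > 0 and (1-Pr)(D+2)/5 < 1 are assumed (automatic for D = 2, 3 given Pr > 0; the claim can fail for D ≥ 4 otherwise). The collision kernel B is isotropic, nonnegative, not a.e. zero, with absolutely convergent integrals defining J. *)

theory Defs
  imports
    "HOL-Analysis.Analysis"
    "Jordan_Normal_Form.DL_Rank"
    "Jordan_Normal_Form.Matrix_Kernel"
    "Jordan_Normal_Form.Gauss_Jordan_Elimination"
begin

text \<open>
  Points of \<open>\<real>\<^sup>D\<close> are elements of \<open>real ^ 'd\<close> with \<open>D = CARD('d)\<close>; multi-indices are elements of
  \<open>nat ^ 'd\<close>, so that \<open>axis i 1\<close> is the \<open>i\<close>-th unit multi-index. The coordinate carrying the index
  2 (the direction normal to the wall) is an arbitrary fixed coordinate \<open>k :: 'd\<close>.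
  The coefficient vectors and matrices, whose sizes depend on the index set, are the
  dimension-explicit ones of Jordan_Normal_Form; \<open>$\<close> is reserved for them, and components in
  \<open>real ^ 'd\<close> and \<open>nat ^ 'd\<close> are written \<open>vec_nth\<close>.
\<close>

unbundle no vec_syntax
no_notation inner (infix "\<bullet>" 70)

section \<open>Multi-indices and Hermite polynomials\<close>

definition mi_abs :: "nat ^ 'd \<Rightarrow> nat" where
  "mi_abs \<alpha> = (\<Sum>i\<in>UNIV. vec_nth \<alpha> i)"

definition mi_fact :: "nat ^ 'd \<Rightarrow> real" where
  "mi_fact \<alpha> = (\<Prod>i\<in>UNIV. fact (vec_nth \<alpha> i))"

definition all_indices :: "nat \<Rightarrow> (nat ^ 'd) set" where
  "all_indices M = {\<alpha>. mi_abs \<alpha> \<le> M}"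

definition gauss :: "real ^ 'd \<Rightarrow> real" where
  "gauss \<xi> = (2 * pi) powr (- real CARD('d) / 2) * exp (- (norm \<xi>)\<^sup>2 / 2)"

definition partial_deriv :: "'d::finite \<Rightarrow> (real ^ 'd \<Rightarrow> real) \<Rightarrow> real ^ 'd \<Rightarrow> real" where
  "partial_deriv i f \<xi> = deriv (\<lambda>t. f (\<xi> + t *\<^sub>R axis i 1)) 0"

text \<open>
  The list chosen below fixes the order in which the partial derivatives are taken; for smooth
  functions, in particular for \<open>gauss\<close>, the result does not depend on it.
\<close>

definition mi_deriv :: "nat ^ 'd \<Rightarrow> (real ^ 'd \<Rightarrow> real) \<Rightarrow> real ^ 'd \<Rightarrow> real" where
  "mi_deriv \<alpha> f = foldr partial_deriv (SOME is. \<forall>i. count_list is i = vec_nth \<alpha> i) f"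

definition hermite :: "nat ^ 'd \<Rightarrow> real ^ 'd \<Rightarrow> real" where
  "hermite \<alpha> \<xi> = (- 1) ^ mi_abs \<alpha> / sqrt (mi_fact \<alpha>) * inverse (gauss \<xi>) * mi_deriv \<alpha> gauss \<xi>"


section \<open>Collision matrices\<close>

text \<open>
  Surface measure on the unit sphere: the measure of \<open>A\<close> is \<open>D\<close> times the volume of the cone
  \<open>{r \<Theta> | 0 < r < 1, \<Theta> \<in> A}\<close>.
\<close>

definition sphere_measure :: "(real ^ 'd) measure" where
  "sphere_measure =
     distr (density lborel (\<lambda>x. of_nat CARD('d) * indicator (ball 0 1) x)) borel sgn"

text \<open>
  \<open>\<Theta>\<close> is the unit vector along the line of the impact, i.e. the direction of the change of velocity.
\<close>

definition post1 :: "real ^ 'd \<Rightarrow> real ^ 'd \<Rightarrow> real ^ 'd \<Rightarrow> real ^ 'd" where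
  "post1 \<xi> \<xi>1 \<Theta> = \<xi> - inner (\<xi> - \<xi>1) \<Theta> *\<^sub>R \<Theta>"

definition post2 :: "real ^ 'd \<Rightarrow> real ^ 'd \<Rightarrow> real ^ 'd \<Rightarrow> real ^ 'd" where
  "post2 \<xi> \<xi>1 \<Theta> = \<xi>1 + inner (\<xi> - \<xi>1) \<Theta> *\<^sub>R \<Theta>"

definition K_op :: "(real ^ 'd \<Rightarrow> real) \<Rightarrow> real ^ 'd \<Rightarrow> real ^ 'd \<Rightarrow> real ^ 'd \<Rightarrow> real" where
  "K_op g \<xi> \<xi>1 \<Theta> = g (post1 \<xi> \<xi>1 \<Theta>) + g (post2 \<xi> \<xi>1 \<Theta>) - g \<xi> - g \<xi>1"

text \<open>
  The kernel is isotropic: it depends on \<open>\<Theta>\<close> through the angle between \<open>\<Theta>\<close> and the relative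
  velocity only. Its second argument is the absolute value of the cosine of that angle, as \<open>\<Theta>\<close> and
  \<open>- \<Theta>\<close> describe the same collision.
\<close>

definition kernel_at ::
    "(real \<Rightarrow> real \<Rightarrow> real) \<Rightarrow> real ^ 'd \<Rightarrow> real ^ 'd \<Rightarrow> real ^ 'd \<Rightarrow> real" where
  "kernel_at B \<xi> \<xi>1 \<Theta> = B (norm (\<xi> - \<xi>1)) (\<bar>inner (\<xi> - \<xi>1) \<Theta>\<bar> / norm (\<xi> - \<xi>1))"

definition linearized_boltzmann ::
    "(real \<Rightarrow> real \<Rightarrow> real) \<Rightarrow> (real ^ 'd \<Rightarrow> real) \<Rightarrow> real ^ 'd \<Rightarrow> real" where
  "linearized_boltzmann B f \<xi> =
     (LINT \<xi>1|lborel. LINT \<Theta>|sphere_measure.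
        K_op (\<lambda>x. f x / gauss x) \<xi> \<xi>1 \<Theta> * gauss \<xi> * gauss \<xi>1 * kernel_at B \<xi> \<xi>1 \<Theta>)"

definition boltzmann_matrix ::
    "(real \<Rightarrow> real \<Rightarrow> real) \<Rightarrow> nat ^ 'd \<Rightarrow> nat ^ 'd \<Rightarrow> real" where
  "boltzmann_matrix B \<alpha> \<beta> =
     - (LINT \<xi>|lborel. linearized_boltzmann B (\<lambda>x. gauss x * hermite \<beta> x) \<xi> * hermite \<alpha> \<xi>)"

text \<open>
  A collision kernel is measurable, non-negative and not almost everywhere zero, and the integrals
  defining the entries of the collision matrix up to order \<open>M\<close> converge absolutely. The product
  measure is that of \<open>(\<xi>, \<xi>1, \<Theta>)\<close>. An angular cutoff is not required.
\<close>

definition collision_kernel :: "'d::finite itself \<Rightarrow> nat \<Rightarrow> (real \<Rightarrow> real \<Rightarrow> real) \<Rightarrow> bool" where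
  "collision_kernel _ M B \<longleftrightarrow>
     (\<lambda>(r, c). B r c) \<in> borel_measurable borel \<and>
     (\<forall>r c. 0 \<le> B r c) \<and>
     \<not> (AE (\<xi> :: real ^ 'd, \<xi>1, \<Theta>) in lborel \<Otimes>\<^sub>M (lborel \<Otimes>\<^sub>M sphere_measure).
          kernel_at B \<xi> \<xi>1 \<Theta> = 0) \<and>
     (\<forall>\<alpha>\<in>all_indices M. \<forall>\<beta>\<in>all_indices M.
        integrable (lborel \<Otimes>\<^sub>M (lborel \<Otimes>\<^sub>M sphere_measure))
          (\<lambda>(\<xi> :: real ^ 'd, \<xi>1, \<Theta>).
             K_op (hermite \<beta>) \<xi> \<xi>1 \<Theta> * gauss \<xi> * gauss \<xi>1 * kernel_at B \<xi> \<xi>1 \<Theta> * hermite \<alpha> \<xi>))"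

text \<open>
  A multi-index has at most one representation as \<open>2 e\<^sub>i\<close> or as \<open>e\<^sub>i + 2 e\<^sub>j\<close>, so at most one summand
  below is nonzero.
\<close>

definition shakhov_matrix :: "real \<Rightarrow> nat ^ 'd \<Rightarrow> nat ^ 'd \<Rightarrow> real" where
  "shakhov_matrix Pr \<alpha> \<beta> =
     (\<Sum>i\<in>UNIV. \<Sum>j\<in>UNIV.
        if \<alpha> = axis i 2 \<and> \<beta> = axis j 2
        then of_bool (i = j) - 1 / real CARD('d) else 0)
   + (\<Sum>i\<in>UNIV. \<Sum>j\<in>UNIV. \<Sum>k\<in>UNIV.
        if \<alpha> = axis i 1 + axis j 2 \<and> \<beta> = axis i 1 + axis k 2
        then of_bool (j = k)
             - (1 - Pr) / 5 * sqrt (1 + 2 * of_bool (i = j)) * sqrt (1 + 2 * of_bool (i = k))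
        else 0)
   + (if \<alpha> = \<beta> \<and> 2 \<le> mi_abs \<alpha> \<and> (\<nexists>i. \<alpha> = axis i 2) \<and> (\<nexists>i j. \<alpha> = axis i 1 + axis j 2)
      then 1 else 0)"

text \<open>
  The heat-flux block of the Shakhov matrix has the smallest eigenvalue
  \<open>min 1 (1 - (1 - Pr) (D + 2) / 5)\<close>. Its positivity is required; for \<open>D \<le> 3\<close> it follows
  from \<open>0 < Pr\<close>.
\<close>

definition collision_matrix :: "nat \<Rightarrow> (nat ^ 'd \<Rightarrow> nat ^ 'd \<Rightarrow> real) \<Rightarrow> bool" where
  "collision_matrix M J \<longleftrightarrow>
     (\<exists>B. collision_kernel TYPE('d::finite) M B \<and> J = boltzmann_matrix B) \<or>
     (\<exists>Pr. 0 < Pr \<and> (1 - Pr) * (real CARD('d) + 2) / 5 < 1 \<and> J = shakhov_matrix Pr)"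


section \<open>The moment system\<close>

definition admissible_indices :: "'d::finite \<Rightarrow> nat \<Rightarrow> (nat ^ 'd) set \<Rightarrow> bool" where
  "admissible_indices k M I \<longleftrightarrow>
     I \<subseteq> all_indices M \<and>
     (\<forall>\<gamma>\<in>I. \<forall>a \<le> M - mi_abs \<gamma> + vec_nth \<gamma> k. \<gamma> - axis k (vec_nth \<gamma> k) + axis k a \<in> I)"

text \<open>\<open>es\<close> and \<open>os\<close> list the members of \<open>I\<close> that are even, respectively odd, in direction \<open>k\<close>.\<close>

definition parity_enumeration ::
    "'d::finite \<Rightarrow> (nat ^ 'd) set \<Rightarrow> (nat ^ 'd) list \<Rightarrow> (nat ^ 'd) list \<Rightarrow> bool" where
  "parity_enumeration k I es os \<longleftrightarrow>
     distinct es \<and> set es = {\<alpha>\<in>I. even (vec_nth \<alpha> k)} \<and>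
     distinct os \<and> set os = {\<alpha>\<in>I. odd (vec_nth \<alpha> k)}"

definition indexed_mat :: "('i \<Rightarrow> 'i \<Rightarrow> real) \<Rightarrow> 'i list \<Rightarrow> 'i list \<Rightarrow> real mat" where
  "indexed_mat f as bs = mat (length as) (length bs) (\<lambda>(i, j). f (as ! i) (bs ! j))"

definition flux :: "'d::finite \<Rightarrow> nat ^ 'd \<Rightarrow> nat ^ 'd \<Rightarrow> real" where
  "flux k \<alpha> \<beta> = (LINT \<xi>|lborel. vec_nth \<xi> k * gauss \<xi> * hermite \<alpha> \<xi> * hermite \<beta> \<xi>)"

definition half_flux :: "'d::finite \<Rightarrow> nat ^ 'd \<Rightarrow> nat ^ 'd \<Rightarrow> real" where
  "half_flux k \<alpha> \<beta> = sqrt (2 * pi) / 2 *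
     (LINT \<xi>|lborel. \<bar>vec_nth \<xi> k\<bar> * gauss \<xi> * hermite \<alpha> \<xi> * hermite \<beta> \<xi>)"

definition orthonormal_kernel_basis :: "real mat \<Rightarrow> real mat \<Rightarrow> bool" where
  "orthonormal_kernel_basis G Q \<longleftrightarrow>
     dim_row G = dim_col Q \<and>
     (\<forall>i<dim_col G. \<forall>j<dim_col G. col G i \<bullet> col G j = of_bool (i = j)) \<and>
     LinearCombinations.module.span class_ring (module_vec TYPE(real) (dim_row G)) (set (cols G))
       = mat_kernel Q"

definition maxwell_coeff :: "real \<Rightarrow> real" where
  "maxwell_coeff \<chi> = 2 * \<chi> / (2 - \<chi>) * inverse (sqrt (2 * pi))"

text \<open>
  \<open>Mm\<close> is the \<open>m \<times> n\<close> block of \<open>A\<close>. Solutions live on \<open>[0, \<infinity>)\<close>; as members of \<open>\<rightarrow>\<^sub>E\<close> they take a fixed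
  dummy value at negative arguments, so that equality of solutions means equality on \<open>[0, \<infinity>)\<close>.
  At \<open>y = 0\<close> the derivative is one-sided. \<open>the (mat_inverse S)\<close> is the inverse of \<open>S\<close>, which is
  positive definite.
\<close>

definition half_space_solution ::
    "real mat \<Rightarrow> real mat \<Rightarrow> real mat \<Rightarrow> real mat \<Rightarrow> real
     \<Rightarrow> real Matrix.vec \<Rightarrow> real Matrix.vec \<Rightarrow> (real \<Rightarrow> real Matrix.vec) \<Rightarrow> bool" where
  "half_space_solution A Q Mm S b fe fo w \<longleftrightarrow>
     (let m = dim_row Mm; n = dim_col Mm in
      w \<in> {0..} \<rightarrow>\<^sub>E carrier_vec (m + n) \<and>
      (\<forall>y\<ge>0. \<exists>dw\<in>carrier_vec (m + n).
         (\<forall>i<m + n. ((\<lambda>t. w t $ i) has_real_derivative dw $ i) (at y within {0..})) \<and>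
         A *\<^sub>v dw = - (Q *\<^sub>v w y)) \<and>
      (\<forall>i<m + n. ((\<lambda>y. w y $ i) \<longlongrightarrow> 0) at_top) \<and>
      (Mm\<^sup>T * the (mat_inverse S) * Mm) *\<^sub>v (vec_last (w 0) n + fo)
        = - (b \<cdot>\<^sub>v (Mm\<^sup>T *\<^sub>v (vec_first (w 0) m + fe))))"

end

theory Submission
  imports Defs "Jordan_Normal_Form.Spectral_Radius" "HOL-Probability.Distributions"
begin

text \<open>
Write \<open>w = (w\<^sub>e, w\<^sub>o)\<close> and, in this explanation only, \<open>M\<close> for the matrix \<open>Mm\<close>. By parity the system reads \<open>M w\<^sub>o' = - Q\<^sub>e w\<^sub>e\<close>, \<open>M\<^sup>T w\<^sub>e' = - Q\<^sub>o w\<^sub>o\<close>, and with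
\<open>T = M\<^sup>T S\<^sup>-\<^sup>1 M\<close> the boundary condition is \<open>T (w\<^sub>o(0) + f\<^sub>o) = - b M\<^sup>T (w\<^sub>e(0) + h + G\<^sub>e z)\<close>, a system of \<open>n\<close>
equations. Four facts on the matrices decide everything: \<open>Q\<^sub>e\<close> and \<open>Q\<^sub>o\<close> are symmetric positive
semidefinite, \<open>M\<close> is injective, \<open>S\<close> is positive definite, and \<open>M\<^sup>T v = 0\<close>, \<open>Q\<^sub>e v = 0\<close> together force
\<open>v = 0\<close>. The last one excludes components of \<open>w\<close> that neither the equations nor the boundary condition
see.

Uniqueness (\<open>energy_uniqueness\<close>). Let \<open>(w, z)\<close> be the difference of two solutions and
\<open>\<phi>(y) = (w\<^sub>e(y) + G\<^sub>e z) \<bullet> M w\<^sub>o(y)\<close>. Then \<open>\<phi>' = - w\<^sub>e \<bullet> Q\<^sub>e w\<^sub>e - w\<^sub>o \<bullet> Q\<^sub>o w\<^sub>o \<le> 0\<close>, because \<open>G\<^sub>e z\<close> lies in the kernel of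
\<open>Q\<^sub>e\<close>, and \<open>\<phi>\<close> tends to \<open>0\<close>, so \<open>\<phi>(0) \<ge> 0\<close>. The boundary condition gives \<open>b \<phi>(0) = - w\<^sub>o(0) \<bullet> T w\<^sub>o(0) \<le> 0\<close>.
Hence \<open>\<phi>\<close> vanishes identically, the dissipation vanishes, the fluxes \<open>M w\<^sub>o\<close> and \<open>M\<^sup>T w\<^sub>e\<close> are constant and
therefore zero, and \<open>w = 0\<close>, \<open>z = 0\<close> follow.

Existence. The unknown \<open>w\<^sub>e\<close> is a linear function \<open>P x\<close> of \<open>x = M\<^sup>T w\<^sub>e\<close> (\<open>elimination\<close>), which leaves
\<open>x' = - L o\<close>, \<open>o' = - K x\<close> with positive semidefinite \<open>L = Q\<^sub>o\<close> and \<open>K = P\<^sup>T Q\<^sub>e P\<close>. Factorizing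
\<open>K = O O\<^sup>T\<close> such that \<open>O\<^sup>T L O\<close> is diagonal with entries \<open>\<lambda>\<^sub>i\<^sup>2\<close> (\<open>simultaneous_factorization\<close>) produces the modes
\<open>e\<^sup>-\<^sup>\<lambda>\<^sup>y (L O\<^sub>i / \<lambda>\<^sub>i, O\<^sub>i)\<close>; the hypothesis \<open>r\<^sub>2 = 0\<close> ensures that \<open>\<lambda>\<^sub>i = 0\<close> only if \<open>O\<^sub>i = 0\<close>. It remains to solve
the boundary condition for the amplitudes and \<open>z\<close>, that is, to show that no \<open>q \<noteq> 0\<close> is orthogonal to all
\<open>T O\<^sub>i + b L O\<^sub>i / \<lambda>\<^sub>i\<close> and to all \<open>M\<^sup>T G\<^sub>e z\<close> (\<open>decaying_modes\<close>). Orthogonality to the latter puts \<open>q\<close> into the range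
of \<open>K\<close>, so \<open>q = \<Sum> a\<^sub>i O\<^sub>i\<close>, and then \<open>0 = q \<bullet> T q + b \<Sum> \<lambda>\<^sub>i a\<^sub>i\<^sup>2\<close> gives \<open>q = 0\<close>. This duality argument replaces a count
of the decaying modes.

The matrices. Hermite functions are products of one-dimensional Hermite polynomials (\<open>hermite_prod\<close>), which
makes the entries of \<open>M\<close> explicit (\<open>flux_eq\<close>) and \<open>S\<close> positive definite (\<open>half_flux_pos_def\<close>). In each
chain of indices that differ only in direction \<open>k\<close>, \<open>M\<close> is triangular, hence injective, and a nonzero
vector in the kernel of \<open>M\<^sup>T\<close> has a nonzero coefficient of the highest degree, which is at least \<open>3\<close>. So the fourth fact follows once
vectors in the kernel of the collision matrix have no coefficients of degree \<open>3\<close> or more. For the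
Shakhov matrix this is a Cauchy-Schwarz estimate (\<open>shakhov_matrix_definite\<close>). For the Boltzmann matrix the
symmetries of collisions turn the quadratic form into an integral of a square, \<open>(K f)\<^sup>2\<close> with a
nonnegative weight (\<open>boltzmann_matrix_symmetrized\<close>); if it vanishes, \<open>K f\<close> vanishes on a set of positive
measure, hence everywhere, as it is a rational function (\<open>K_val_AE_nonzero\<close>), and then \<open>f\<close> has degree at
most \<open>2\<close> (\<open>collision_invariant_degree\<close>).
\<close>

unbundle no vec_syntax
no_notation inner (infix "\<bullet>" 70)

section \<open>Positive semidefinite real matrices\<close>

definition pos_semidef :: "nat \<Rightarrow> real mat \<Rightarrow> bool" where
  "pos_semidef n A \<longleftrightarrow> A \<in> carrier_mat n n \<and> A\<^sup>T = A \<and> (\<forall>x\<in>carrier_vec n. 0 \<le> x \<bullet> (A *\<^sub>v x))"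

definition pos_def :: "nat \<Rightarrow> real mat \<Rightarrow> bool" where
  "pos_def n A \<longleftrightarrow> pos_semidef n A \<and> (\<forall>x\<in>carrier_vec n. x \<bullet> (A *\<^sub>v x) = 0 \<longrightarrow> x = 0\<^sub>v n)"

lemma mult_mat_zero_vec: "A \<in> carrier_mat m n \<Longrightarrow> A *\<^sub>v 0\<^sub>v n = (0\<^sub>v m :: real Matrix.vec)"
  by (intro eq_vecI) auto

lemma scalar_prod_self_ge_0: "0 \<le> (x :: real Matrix.vec) \<bullet> x"
  by (simp add: scalar_prod_def sum_nonneg)

lemma scalar_prod_self_eq_0:
  assumes "(x :: real Matrix.vec) \<in> carrier_vec n"
  shows "x \<bullet> x = 0 \<longleftrightarrow> x = 0\<^sub>v n"
proof
  assume "x \<bullet> x = 0"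
  hence "(\<Sum>i = 0..<dim_vec x. x $ i * x $ i) = 0" by (simp add: scalar_prod_def)
  hence "\<forall>i\<in>{0..<dim_vec x}. x $ i * x $ i = 0"
    by (subst (asm) sum_nonneg_eq_0_iff) auto
  thus "x = 0\<^sub>v n" using assms by (intro eq_vecI) auto
qed (use assms in simp)

lemma scalar_prod_transpose:
  assumes "(A :: real mat) \<in> carrier_mat nr nc" "x \<in> carrier_vec nr" "y \<in> carrier_vec nc"
  shows "x \<bullet> (A *\<^sub>v y) = (A\<^sup>T *\<^sub>v x) \<bullet> y"
  using transpose_vec_mult_scalar[OF assms(1,3,2)] by simp

text \<open>
If \<open>A x\<close> were nonzero, moving from \<open>x\<close> a little in the direction \<open>- A x\<close> would make the quadratic form
negative.
\<close>

lemma pos_semidef_kernel: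
  assumes A: "pos_semidef n A" and x: "x \<in> carrier_vec n" and 0: "x \<bullet> (A *\<^sub>v x) = 0"
  shows "A *\<^sub>v x = 0\<^sub>v n"
proof -
  have Ac: "A \<in> carrier_mat n n" and At: "A\<^sup>T = A" using A by (auto simp: pos_semidef_def)
  define y where "y = A *\<^sub>v x"
  have y: "y \<in> carrier_vec n" using Ac x by (simp add: y_def)
  define d where "d = y \<bullet> (A *\<^sub>v y)"
  have sym: "x \<bullet> (A *\<^sub>v y) = y \<bullet> y"
    using scalar_prod_transpose[OF Ac x y] by (simp add: At y_def)
  have q: "0 \<le> 2 * t * (y \<bullet> y) + t\<^sup>2 * d" for t
  proof -
    have ty: "t \<cdot>\<^sub>v y \<in> carrier_vec n" using y by simp
    have "A *\<^sub>v (x + t \<cdot>\<^sub>v y) = y + t \<cdot>\<^sub>v (A *\<^sub>v y)"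
      unfolding mult_add_distrib_mat_vec[OF Ac x ty] mult_mat_vec[OF Ac y] y_def[symmetric] ..
    hence "(x + t \<cdot>\<^sub>v y) \<bullet> (A *\<^sub>v (x + t \<cdot>\<^sub>v y)) = (x + t \<cdot>\<^sub>v y) \<bullet> (y + t \<cdot>\<^sub>v (A *\<^sub>v y))" by simp
    also have "\<dots> = x \<bullet> y + t * (x \<bullet> (A *\<^sub>v y)) + (t * (y \<bullet> y) + t * (t * d))"
      using x y Ac unfolding d_def
      by (subst add_scalar_prod_distrib[of _ n]; (subst scalar_prod_add_distrib[of _ n])?; simp)
         (subst scalar_prod_add_distrib[of _ n]; simp add: algebra_simps)
    also have "\<dots> = 2 * t * (y \<bullet> y) + t\<^sup>2 * d"
      unfolding sym using 0 by (simp add: y_def[symmetric] power2_eq_square)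
    finally have e: "(x + t \<cdot>\<^sub>v y) \<bullet> (A *\<^sub>v (x + t \<cdot>\<^sub>v y)) = 2 * t * (y \<bullet> y) + t\<^sup>2 * d" .
    have "x + t \<cdot>\<^sub>v y \<in> carrier_vec n" using x ty by simp
    hence "0 \<le> (x + t \<cdot>\<^sub>v y) \<bullet> (A *\<^sub>v (x + t \<cdot>\<^sub>v y))" using A by (auto simp: pos_semidef_def)
    thus ?thesis unfolding e .
  qed
  have "y \<bullet> y = 0"
  proof (rule ccontr)
    assume "y \<bullet> y \<noteq> 0"
    hence c: "y \<bullet> y > 0" using scalar_prod_self_ge_0[of y] by linarith
    have d: "d \<ge> 0" using A y by (simp add: d_def pos_semidef_def)
    \<comment> \<open>The minimizer of the quadratic polynomial in q, up to the summand 1 that guards against d = 0.\<close>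
    define t where "t = - (y \<bullet> y) / (d + 1)"
    have "y \<bullet> y = - (t * (d + 1))" using d by (simp add: t_def)
    moreover have "2 * t * - (t * (d + 1)) + t\<^sup>2 * d = - (t\<^sup>2 * (d + 2))"
      by (simp add: power2_eq_square algebra_simps)
    ultimately have "2 * t * (y \<bullet> y) + t\<^sup>2 * d = - (t\<^sup>2 * (d + 2))" by simp
    also have "\<dots> < 0" using c d by (simp add: t_def)
    finally show False using q[of t] by linarith
  qed
  thus ?thesis using scalar_prod_self_eq_0[OF y] by (simp add: y_def)
qed

lemma mat_inverse_if_injective:
  assumes A: "(A :: real mat) \<in> carrier_mat n n"
    and inj: "\<And>x. x \<in> carrier_vec n \<Longrightarrow> A *\<^sub>v x = 0\<^sub>v n \<Longrightarrow> x = 0\<^sub>v n"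
  obtains B where "mat_inverse A = Some B" "B \<in> carrier_mat n n" "A * B = 1\<^sub>m n" "B * A = 1\<^sub>m n"
proof -
  have "Determinant.det A \<noteq> 0" using det_0_iff_vec_prod_zero_field[OF A] inj by auto
  from det_non_zero_imp_unit[OF A this, of undefined] obtain B where "mat_inverse A = Some B" using mat_inverse(1)[OF A, of undefined] by (cases "mat_inverse A") auto
  with mat_inverse(2)[OF A this] that show ?thesis by blast
qed

lemma pos_def_injective:
  assumes "pos_def n A" "x \<in> carrier_vec n" "A *\<^sub>v x = 0\<^sub>v n"
  shows "x = 0\<^sub>v n"
  using assms by (auto simp: pos_def_def)

lemma pos_def_inverse:
  assumes A: "pos_def n A"
  obtains B where "mat_inverse A = Some B" "pos_def n B" "A * B = 1\<^sub>m n" "B * A = 1\<^sub>m n"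
proof -
  have Ac: "A \<in> carrier_mat n n" and At: "A\<^sup>T = A" using A by (auto simp: pos_def_def pos_semidef_def)
  obtain B where B: "mat_inverse A = Some B" "B \<in> carrier_mat n n" "A * B = 1\<^sub>m n" "B * A = 1\<^sub>m n"
    using mat_inverse_if_injective[OF Ac] pos_def_injective[OF A] by metis
  have BtA: "B\<^sup>T * A = 1\<^sub>m n"
    using transpose_mult[OF Ac B(2)] B(3) At by simp
  have "B\<^sup>T = B\<^sup>T * (A * B)" using B by simp
  also have "\<dots> = B" using BtA B(2) Ac
    by (subst assoc_mult_mat[symmetric, of _ n n _ n _ n]) auto
  finally have Bt: "B\<^sup>T = B" .
  have e: "x \<bullet> (B *\<^sub>v x) = (B *\<^sub>v x) \<bullet> (A *\<^sub>v (B *\<^sub>v x))" if x: "x \<in> carrier_vec n" for x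
  proof -
    have "A *\<^sub>v (B *\<^sub>v x) = x"
      using assoc_mult_mat_vec[OF Ac B(2) x] B(3) x by simp
    thus ?thesis using x B(2) comm_scalar_prod[of x n "B *\<^sub>v x"] by simp
  qed
  have "pos_def n B"
    unfolding pos_def_def pos_semidef_def
  proof (intro conjI ballI impI)
    fix x :: "real Matrix.vec" assume x: "x \<in> carrier_vec n"
    have Bx: "B *\<^sub>v x \<in> carrier_vec n" using B(2) x by simp
    show "0 \<le> x \<bullet> (B *\<^sub>v x)" using e[OF x] A Bx by (auto simp: pos_def_def pos_semidef_def)
    assume "x \<bullet> (B *\<^sub>v x) = 0"
    hence "B *\<^sub>v x = 0\<^sub>v n" using e[OF x] A Bx by (auto simp: pos_def_def)
    hence "A *\<^sub>v (B *\<^sub>v x) = 0\<^sub>v n" using mult_mat_zero_vec[OF Ac] by simp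
    thus "x = 0\<^sub>v n" using assoc_mult_mat_vec[OF Ac B(2) x] B(3) x by simp
  qed (use B Bt in auto)
  with B that show ?thesis by blast
qed

lemma pos_semidef_congruence:
  assumes A: "pos_semidef m A" and P: "P \<in> carrier_mat m n"
  shows "pos_semidef n (P\<^sup>T * A * P)"
    and "x \<in> carrier_vec n \<Longrightarrow> x \<bullet> ((P\<^sup>T * A * P) *\<^sub>v x) = (P *\<^sub>v x) \<bullet> (A *\<^sub>v (P *\<^sub>v x))"
proof -
  have Ac: "A \<in> carrier_mat m m" and At: "A\<^sup>T = A" using A by (auto simp: pos_semidef_def)
  have e: "x \<bullet> ((P\<^sup>T * A * P) *\<^sub>v x) = (P *\<^sub>v x) \<bullet> (A *\<^sub>v (P *\<^sub>v x))" if x: "x \<in> carrier_vec n" for x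
  proof -
    have "(P\<^sup>T * A * P) *\<^sub>v x = P\<^sup>T *\<^sub>v (A *\<^sub>v (P *\<^sub>v x))"
      using Ac P x by (simp add: assoc_mult_mat_vec[of _ n m _ n] assoc_mult_mat_vec[of _ n m _ m])
    thus ?thesis using scalar_prod_transpose[of "P\<^sup>T" n m x "A *\<^sub>v (P *\<^sub>v x)"] Ac P x by simp
  qed
  have "(P\<^sup>T * A * P)\<^sup>T = P\<^sup>T * (P\<^sup>T * A)\<^sup>T"
    using Ac P by (subst transpose_mult[of _ n m _ n]) auto
  also have "(P\<^sup>T * A)\<^sup>T = A * P"
    using Ac P At by (subst transpose_mult[of _ n m _ m]) auto
  also have "P\<^sup>T * (A * P) = P\<^sup>T * A * P"
    using Ac P by (subst assoc_mult_mat[of _ n m _ m _ n]) auto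
  finally show "pos_semidef n (P\<^sup>T * A * P)"
    using A P e Ac unfolding pos_semidef_def by auto
  show "x \<in> carrier_vec n \<Longrightarrow> x \<bullet> ((P\<^sup>T * A * P) *\<^sub>v x) = (P *\<^sub>v x) \<bullet> (A *\<^sub>v (P *\<^sub>v x))" by (rule e)
qed

lemma pos_semidef_add:
  assumes "pos_semidef n A" "pos_semidef n B"
  shows "pos_semidef n (A + B)"
    and "x \<in> carrier_vec n \<Longrightarrow> x \<bullet> ((A + B) *\<^sub>v x) = x \<bullet> (A *\<^sub>v x) + x \<bullet> (B *\<^sub>v x)"
proof -
  have c: "A \<in> carrier_mat n n" "B \<in> carrier_mat n n" "A\<^sup>T = A" "B\<^sup>T = B"
    using assms by (auto simp: pos_semidef_def)
  have e: "x \<bullet> ((A + B) *\<^sub>v x) = x \<bullet> (A *\<^sub>v x) + x \<bullet> (B *\<^sub>v x)" if "x \<in> carrier_vec n" for x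
    using c that by (simp add: add_mult_distrib_mat_vec[of _ n n] scalar_prod_add_distrib[of _ n])
  thus "x \<in> carrier_vec n \<Longrightarrow> x \<bullet> ((A + B) *\<^sub>v x) = x \<bullet> (A *\<^sub>v x) + x \<bullet> (B *\<^sub>v x)" by blast
  have "(A + B)\<^sup>T = A + B" using c by (simp add: transpose_add[of _ n n])
  thus "pos_semidef n (A + B)"
    using assms e c unfolding pos_semidef_def by auto
qed

lemma pos_semidef_gram:
  assumes B: "B \<in> carrier_mat n N"
  shows "pos_semidef n (B * B\<^sup>T)"
    and "x \<in> carrier_vec n \<Longrightarrow> x \<bullet> ((B * B\<^sup>T) *\<^sub>v x) = (B\<^sup>T *\<^sub>v x) \<bullet> (B\<^sup>T *\<^sub>v x)"
proof -
  have 1: "pos_semidef N (1\<^sub>m N)" by (auto simp: pos_semidef_def scalar_prod_self_ge_0)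
  have e: "B * B\<^sup>T = (B\<^sup>T)\<^sup>T * 1\<^sub>m N * B\<^sup>T" using B by simp
  have Bt: "B\<^sup>T \<in> carrier_mat N n" using B by simp
  show "pos_semidef n (B * B\<^sup>T)" unfolding e by (rule pos_semidef_congruence[OF 1 Bt])
  show "x \<bullet> ((B * B\<^sup>T) *\<^sub>v x) = (B\<^sup>T *\<^sub>v x) \<bullet> (B\<^sup>T *\<^sub>v x)" if "x \<in> carrier_vec n"
    unfolding e using pos_semidef_congruence(2)[OF 1 Bt that] B that by simp
qed

text \<open>
The Gram matrix \<open>B B\<^sup>T + C C\<^sup>T\<close> is positive definite as soon as no nonzero vector is orthogonal to all
columns of \<open>B\<close> and \<open>C\<close>; its inverse yields a preimage. The two blocks are kept apart because the
solution is needed in two parts, amplitudes and null-space component.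
\<close>

lemma surjective_if_trivial_cokernel:
  assumes B: "(B :: real mat) \<in> carrier_mat n N" and C: "C \<in> carrier_mat n p"
    and triv: "\<And>q. q \<in> carrier_vec n \<Longrightarrow> B\<^sup>T *\<^sub>v q = 0\<^sub>v N \<Longrightarrow> C\<^sup>T *\<^sub>v q = 0\<^sub>v p \<Longrightarrow> q = 0\<^sub>v n"
    and g: "g \<in> carrier_vec n"
  obtains c z where "c \<in> carrier_vec N" "z \<in> carrier_vec p" "B *\<^sub>v c + C *\<^sub>v z = g"
proof -
  define H where "H = B * B\<^sup>T + C * C\<^sup>T"
  have e: "x \<bullet> (H *\<^sub>v x) = (B\<^sup>T *\<^sub>v x) \<bullet> (B\<^sup>T *\<^sub>v x) + (C\<^sup>T *\<^sub>v x) \<bullet> (C\<^sup>T *\<^sub>v x)"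
    if x: "x \<in> carrier_vec n" for x
    unfolding H_def
    using pos_semidef_add(2)[OF pos_semidef_gram(1)[OF B] pos_semidef_gram(1)[OF C] x]
      pos_semidef_gram(2)[OF B x] pos_semidef_gram(2)[OF C x] by simp
  have "pos_def n H"
    unfolding pos_def_def
  proof (intro conjI ballI impI)
    show "pos_semidef n H" unfolding H_def by (intro pos_semidef_add pos_semidef_gram[OF B] pos_semidef_gram[OF C])
    fix x :: "real Matrix.vec" assume x: "x \<in> carrier_vec n" and 0: "x \<bullet> (H *\<^sub>v x) = 0"
    have "(B\<^sup>T *\<^sub>v x) \<bullet> (B\<^sup>T *\<^sub>v x) = 0" "(C\<^sup>T *\<^sub>v x) \<bullet> (C\<^sup>T *\<^sub>v x) = 0"
      using e[OF x] 0 scalar_prod_self_ge_0[of "B\<^sup>T *\<^sub>v x"] scalar_prod_self_ge_0[of "C\<^sup>T *\<^sub>v x"] by linarith+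
    thus "x = 0\<^sub>v n"
      using triv[OF x] B C x scalar_prod_self_eq_0[of "B\<^sup>T *\<^sub>v x" N] scalar_prod_self_eq_0[of "C\<^sup>T *\<^sub>v x" p]
      by auto
  qed
  then obtain R where R: "pos_def n R" "H * R = 1\<^sub>m n" using pos_def_inverse by blast
  have Rc: "R \<in> carrier_mat n n" using R by (auto simp: pos_def_def pos_semidef_def)
  define y where "y = R *\<^sub>v g"
  have y: "y \<in> carrier_vec n" using Rc g by (simp add: y_def)
  have Hc: "H \<in> carrier_mat n n" using B C by (simp add: H_def)
  have "B *\<^sub>v (B\<^sup>T *\<^sub>v y) + C *\<^sub>v (C\<^sup>T *\<^sub>v y) = H *\<^sub>v y"
    using B C y unfolding H_def
    by (subst add_mult_distrib_mat_vec[of _ n n]) (auto simp: assoc_mult_mat_vec[of _ n N _ n] assoc_mult_mat_vec[of _ n p _ n])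
  also have "\<dots> = g" using assoc_mult_mat_vec[OF Hc Rc g] R(2) g by (simp add: y_def)
  finally show ?thesis using that[of "B\<^sup>T *\<^sub>v y" "C\<^sup>T *\<^sub>v y"] B C y by simp
qed

section \<open>Diagonalization of symmetric matrices\<close>

text \<open>
The real and imaginary parts \<open>a\<close>, \<open>b\<close> of a complex eigenvector satisfy
\<open>a \<bullet> A b = b \<bullet> A a\<close>, which says that the imaginary part of the eigenvalue times \<open>a \<bullet> a + b \<bullet> b\<close> is zero.
\<close>

lemma symmetric_real_eigenvector:
  assumes A: "(A :: real mat) \<in> carrier_mat n n" and At: "A\<^sup>T = A" and n: "n > 0"
  obtains s u where "u \<in> carrier_vec n" "u \<bullet> u = 1" "A *\<^sub>v u = s \<cdot>\<^sub>v u"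
proof -
  define Ac where "Ac = map_mat complex_of_real A"
  have Acc: "Ac \<in> carrier_mat n n" using A by (simp add: Ac_def)
  obtain l where "eigenvalue Ac l" using spectrum_non_empty[OF Acc n] by (auto simp: spectrum_def)
  then obtain v where v: "v \<in> carrier_vec n" "v \<noteq> 0\<^sub>v n" "Ac *\<^sub>v v = l \<cdot>\<^sub>v v"
    using Acc by (auto simp: eigenvalue_def eigenvector_def)
  define a where "a = map_vec Re v"
  define b where "b = map_vec Im v"
  have ab: "a \<in> carrier_vec n" "b \<in> carrier_vec n" using v by (auto simp: a_def b_def)
  have comp: "(\<Sum>j = 0..<n. complex_of_real (A $$ (i,j)) * v $ j) = l * v $ i" if "i < n" for i
    using arg_cong[OF v(3), of "\<lambda>w. w $ i"] that A v(1)
    by (simp add: Ac_def scalar_prod_def mult_mat_vec_def)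
  have Aa: "A *\<^sub>v a = Re l \<cdot>\<^sub>v a - Im l \<cdot>\<^sub>v b"
  proof (rule eq_vecI)
    fix i assume "i < dim_vec (Re l \<cdot>\<^sub>v a - Im l \<cdot>\<^sub>v b)"
    hence i: "i < n" using ab by simp
    show "(A *\<^sub>v a) $ i = (Re l \<cdot>\<^sub>v a - Im l \<cdot>\<^sub>v b) $ i"
      using arg_cong[OF comp[OF i], of Re] i A v(1)
      by (simp add: scalar_prod_def a_def b_def)
  qed (use A ab in auto)
  have Ab: "A *\<^sub>v b = Re l \<cdot>\<^sub>v b + Im l \<cdot>\<^sub>v a"
  proof (rule eq_vecI)
    fix i assume "i < dim_vec (Re l \<cdot>\<^sub>v b + Im l \<cdot>\<^sub>v a)"
    hence i: "i < n" using ab by simp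
    show "(A *\<^sub>v b) $ i = (Re l \<cdot>\<^sub>v b + Im l \<cdot>\<^sub>v a) $ i"
      using arg_cong[OF comp[OF i], of Im] i A v(1)
      by (simp add: scalar_prod_def a_def b_def)
  qed (use A ab in auto)
  have "a \<bullet> (A *\<^sub>v b) = (A *\<^sub>v a) \<bullet> b" using scalar_prod_transpose[OF A ab] At by simp
  hence "Re l * (a \<bullet> b) + Im l * (a \<bullet> a) = Re l * (a \<bullet> b) - Im l * (b \<bullet> b)"
    using ab by (simp add: Aa Ab scalar_prod_add_distrib[of _ n] minus_scalar_prod_distrib[of _ n])
  hence z: "Im l * (a \<bullet> a + b \<bullet> b) = 0" by (simp add: algebra_simps)
  have ex: "\<exists>w. w \<in> carrier_vec n \<and> w \<bullet> w \<noteq> 0 \<and> A *\<^sub>v w = Re l \<cdot>\<^sub>v w"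
  proof -
    have ne: "a \<bullet> a \<noteq> 0 \<or> b \<bullet> b \<noteq> 0"
    proof (rule ccontr)
      assume "\<not> ?thesis"
      hence "a = 0\<^sub>v n" "b = 0\<^sub>v n" using scalar_prod_self_eq_0 ab by auto
      hence "v $ i = 0" if "i < n" for i
      proof -
        have "a $ i = 0" "b $ i = 0" using \<open>a = 0\<^sub>v n\<close> \<open>b = 0\<^sub>v n\<close> that by simp_all
        thus ?thesis using that v(1) by (simp add: a_def b_def complex_eq_iff)
      qed
      hence "v = 0\<^sub>v n" using v(1) by (intro eq_vecI) auto
      thus False using v(2) by simp
    qed
    hence "a \<bullet> a + b \<bullet> b > 0" using scalar_prod_self_ge_0[of a] scalar_prod_self_ge_0[of b] by linarith
    hence "Im l = 0" using z by auto
    hence "A *\<^sub>v a = Re l \<cdot>\<^sub>v a" "A *\<^sub>v b = Re l \<cdot>\<^sub>v b" using Aa Ab ab by auto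
    thus ?thesis using ne ab by blast
  qed
  then obtain w where w: "w \<in> carrier_vec n" "w \<bullet> w \<noteq> 0" "A *\<^sub>v w = Re l \<cdot>\<^sub>v w" by blast
  define c where "c = 1 / sqrt (w \<bullet> w)"
  have "w \<bullet> w > 0" using w(2) scalar_prod_self_ge_0[of w] by linarith
  hence c: "c * c * (w \<bullet> w) = 1" by (simp add: c_def)
  show ?thesis
  proof (rule that[of "c \<cdot>\<^sub>v w" "Re l"])
    show "(c \<cdot>\<^sub>v w) \<bullet> (c \<cdot>\<^sub>v w) = 1" using w c by simp
    show "A *\<^sub>v (c \<cdot>\<^sub>v w) = Re l \<cdot>\<^sub>v (c \<cdot>\<^sub>v w)" using w A
      by (simp add: mult_mat_vec[OF A w(1)] smult_smult_assoc mult.commute)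
  qed (use w in simp)
qed

text \<open>
The reflection that exchanges \<open>u\<close> and the first unit vector. It extends a unit vector to an orthonormal
basis by a closed formula.
\<close>

lemma householder:
  assumes u: "(u :: real Matrix.vec) \<in> carrier_vec n" "u \<bullet> u = 1" and n: "n > 0"
  obtains H where "H \<in> carrier_mat n n" "H\<^sup>T = H" "H * H = 1\<^sub>m n" "col H 0 = u"
proof (cases "u $ 0 = 1")
  case True
  have s: "(\<Sum>i = 0..<n. u $ i * u $ i) = 1" using u by (simp add: scalar_prod_def)
  have "u $ i = 0" if i: "i < n" "i \<noteq> 0" for i
  proof -
    have "(\<Sum>j = 0..<n. u $ j * u $ j) = u $ 0 * u $ 0 + (\<Sum>j \<in> {0..<n}-{0}. u $ j * u $ j)"
      using n by (subst sum.remove[of _ 0]) auto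
    hence "(\<Sum>j \<in> {0..<n}-{0}. u $ j * u $ j) = 0" using s True by simp
    hence "\<forall>j \<in> {0..<n}-{0}. u $ j * u $ j = 0" by (subst (asm) sum_nonneg_eq_0_iff) auto
    thus ?thesis using i by auto
  qed
  hence "col (1\<^sub>m n) 0 = u" using True u n by (intro eq_vecI) auto
  thus ?thesis using that[of "1\<^sub>m n"] by simp
next
  case False
  define v where "v i = u $ i - of_bool (i = 0)" for i
  define H where "H = Matrix.mat n n (\<lambda>(i, j). of_bool (i = j) - v i * v j / (1 - u $ 0))"
  have s: "(\<Sum>i = 0..<n. u $ i * u $ i) = 1" using u by (simp add: scalar_prod_def)
  have d: "(\<Sum>i = 0..<n. of_bool (i = k) * f i) = f k" if "k < n" for k and f :: "nat \<Rightarrow> real"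
  proof -
    have "(\<Sum>i = 0..<n. of_bool (i = k) * f i) = (\<Sum>i = 0..<n. if k = i then f i else 0)"
      by (rule sum.cong) auto
    thus ?thesis using that by simp
  qed
  have d': "(\<Sum>i = 0..<n. of_bool (k = i) * f i) = f k" if "k < n" for k and f :: "nat \<Rightarrow> real"
    using d[OF that, of f] by (simp only: eq_commute[of k])
  have vv: "(\<Sum>i = 0..<n. v i * v i) = 2 * (1 - u $ 0)"
  proof -
    have "(\<Sum>i = 0..<n. v i * v i) = (\<Sum>i = 0..<n. u $ i * u $ i - 2 * (of_bool (i = 0) * u $ i) + of_bool (i = 0) * 1)"
      by (rule sum.cong) (auto simp: v_def algebra_simps)
    also have "\<dots> = 1 - 2 * u $ 0 + 1"
      unfolding sum.distrib sum_subtractf sum_distrib_left[symmetric] s d[OF n] by simp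
    finally show ?thesis by simp
  qed
  have Hc: "H \<in> carrier_mat n n" by (simp add: H_def)
  have Ht: "H\<^sup>T = H" unfolding H_def by (rule eq_matI) (auto simp: mult.commute)
  have HH: "H * H = 1\<^sub>m n"
  proof (rule eq_matI)
    fix i j assume "i < dim_row (1\<^sub>m n)" "j < dim_col (1\<^sub>m n)"
    hence ij: "i < n" "j < n" by auto
    let ?c = "1 / (1 - u $ 0)"
    have "(H * H) $$ (i, j) = (\<Sum>k = 0..<n. (of_bool (i = k) - v i * v k * ?c) * (of_bool (k = j) - v k * v j * ?c))"
      using ij by (simp add: H_def scalar_prod_def)
    also have "\<dots> = (\<Sum>k = 0..<n. of_bool (i = k) * of_bool (k = j) - of_bool (i = k) * (v k * v j * ?c)
         - of_bool (k = j) * (v i * v k * ?c) + v i * v j * ?c * ?c * (v k * v k))"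
      by (rule sum.cong) (simp_all add: algebra_simps)
    also have "\<dots> = of_bool (i = j) - v i * v j * ?c - v i * v j * ?c + v i * v j * ?c * ?c * (2 * (1 - u $ 0))"
      unfolding sum.distrib sum_subtractf sum_distrib_left[symmetric] vv d[OF ij(2)] d'[OF ij(1)] by simp
    also have "v i * v j * ?c * ?c * (2 * (1 - u $ 0)) = 2 * (v i * v j * ?c)"
    proof -
      have "a * (1 / w) * (1 / w) * (2 * w) = 2 * (a * (1 / w))" if "w \<noteq> 0" for a w :: real
        using that by simp
      from this[of "1 - u $ 0" "v i * v j"] show ?thesis using False by linarith
     qed
    finally have "(H * H) $$ (i, j) = of_bool (i = j)" by simp
    thus "(H * H) $$ (i, j) = 1\<^sub>m n $$ (i, j)" using ij by simp
  qed (auto simp: H_def)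
  have "col H 0 = u"
  proof (rule eq_vecI)
    fix i assume "i < dim_vec u"
    hence i: "i < n" using u by simp
    have "v 0 / (1 - u $ 0) = - 1" using False by (simp add: v_def field_simps)
    hence "v i * v 0 / (1 - u $ 0) = - v i" by (metis mult_minus1_right times_divide_eq_right)
    hence "H $$ (i, 0) = of_bool (i = 0) + v i" using i n by (simp add: H_def)
    thus "col H 0 $ i = u $ i" using i n Hc by (auto simp: v_def)
  qed (use Hc u in auto)
  thus ?thesis using that Hc Ht HH by blast
qed


lemma mat_assoc3:
  assumes "A \<in> carrier_mat a b" "B \<in> carrier_mat b c" "C \<in> carrier_mat c d"
  shows "A * (B * C) = A * B * C"
  using assoc_mult_mat[OF assms] by simp

text \<open>
Induction on the dimension: after conjugation with a Householder reflection whose first column is an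
eigenvector, the first row and column split off.
\<close>

theorem symmetric_diagonalization:
  assumes "(A :: real mat) \<in> carrier_mat n n" and "A\<^sup>T = A"
  shows "\<exists>U d. U \<in> carrier_mat n n \<and> U\<^sup>T * U = 1\<^sub>m n \<and> U\<^sup>T * A * U = mat_diag n d"
  using assms
proof (induction n arbitrary: A)
  case 0
  show ?case
    by (rule exI[of _ "1\<^sub>m 0"], rule exI[of _ "\<lambda>_. 0"]) (use 0 in \<open>auto simp: mat_diag_def intro!: eq_matI\<close>)
next
  case (Suc n)
  note A = Suc.prems(1) and At = Suc.prems(2)
  obtain s u where u: "u \<in> carrier_vec (Suc n)" "u \<bullet> u = 1" "A *\<^sub>v u = s \<cdot>\<^sub>v u"
    by (rule symmetric_real_eigenvector[OF A At zero_less_Suc]) (rule that; assumption)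
  obtain H where H: "H \<in> carrier_mat (Suc n) (Suc n)" "H\<^sup>T = H" "H * H = 1\<^sub>m (Suc n)" "col H 0 = u"
    by (rule householder[OF u(1,2) zero_less_Suc]) (rule that; assumption)
  define B where "B = H * A * H"
  have Bc: "B \<in> carrier_mat (Suc n) (Suc n)" using H A by (simp add: B_def)
  have Bt: "B\<^sup>T = B"
  proof -
    have "B\<^sup>T = H\<^sup>T * (H * A)\<^sup>T" unfolding B_def
      using H A by (intro transpose_mult[of _ "Suc n" "Suc n" _ "Suc n"]) auto
    also have "(H * A)\<^sup>T = A\<^sup>T * H\<^sup>T"
      using H A by (intro transpose_mult[of _ "Suc n" "Suc n" _ "Suc n"]) auto
    finally show ?thesis unfolding H(2) At B_def using mat_assoc3[OF H(1) A H(1)] by simp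
  qed
  have HAc: "H * A \<in> carrier_mat (Suc n) (Suc n)" using H(1) A by simp
  have "col B 0 = (H * A) *\<^sub>v u"
    unfolding B_def using col_mult2[OF HAc H(1), of 0] H(4) by simp
  also have "\<dots> = H *\<^sub>v (A *\<^sub>v u)" by (rule assoc_mult_mat_vec[OF H(1) A u(1)])
  also have "\<dots> = s \<cdot>\<^sub>v (H *\<^sub>v col H 0)"
    unfolding u(3) H(4) by (rule mult_mat_vec[OF H(1) u(1)])
  also have "H *\<^sub>v col H 0 = col (H * H) 0" using col_mult2[OF H(1) H(1), of 0] by simp
  finally have col0: "col B 0 = s \<cdot>\<^sub>v unit_vec (Suc n) 0" unfolding H(3) by simp
  have Bi0: "B $$ (i, 0) = (if i = 0 then s else 0)" if "i < Suc n" for i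
    using arg_cong[OF col0, of "\<lambda>v. v $ i"] that Bc by simp
  have B0i: "B $$ (0, i) = (if i = 0 then s else 0)" if "i < Suc n" for i
  proof -
    have "B $$ (0, i) = B\<^sup>T $$ (i, 0)" using that Bc by simp
    thus ?thesis unfolding Bt using Bi0[OF that] by simp
  qed
  define B' where "B' = Matrix.mat n n (\<lambda>(i, j). B $$ (Suc i, Suc j))"
  have B'c: "B' \<in> carrier_mat n n" by (simp add: B'_def)
  have B't: "B'\<^sup>T = B'"
  proof (rule eq_matI)
    fix i j assume "i < dim_row B'" "j < dim_col B'"
    hence ij: "i < n" "j < n" by (auto simp: B'_def)
    have "B $$ (Suc j, Suc i) = B\<^sup>T $$ (Suc i, Suc j)" using Bc ij by simp
    thus "B'\<^sup>T $$ (i, j) = B' $$ (i, j)" unfolding Bt using ij by (simp add: B'_def)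
  qed (auto simp: B'_def)
  have Bblock: "B = four_block_mat (Matrix.mat 1 1 (\<lambda>_. s)) (0\<^sub>m 1 n) (0\<^sub>m n 1) B'"
    by (rule eq_matI) (use Bc in \<open>auto simp: B'_def Bi0 B0i\<close>)
  obtain V d where V: "V \<in> carrier_mat n n" "V\<^sup>T * V = 1\<^sub>m n" "V\<^sup>T * B' * V = mat_diag n d"
    using Suc.IH[OF B'c B't] by blast
  define W where "W = four_block_mat (1\<^sub>m 1) (0\<^sub>m 1 n) (0\<^sub>m n 1) V"
  have Wc: "W \<in> carrier_mat (Suc n) (Suc n)" 
    using four_block_carrier_mat[of "1\<^sub>m 1" 1 1 V n n] V(1) by (simp add: W_def)
  have Wt: "W\<^sup>T = four_block_mat (1\<^sub>m 1) (0\<^sub>m 1 n) (0\<^sub>m n 1) (V\<^sup>T)"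
    unfolding W_def using V by (subst transpose_four_block_mat[of _ 1 1 _ n _ n]) auto
  have Wtc: "W\<^sup>T \<in> carrier_mat (Suc n) (Suc n)" using Wc by simp
  have WW: "W\<^sup>T * W = 1\<^sub>m (Suc n)"
    unfolding Wt unfolding W_def using V
    by (subst mult_four_block_mat[of _ 1 1 _ n _ n _ _ 1 _ n]) (auto intro!: eq_matI)
  have WB: "W\<^sup>T * B = four_block_mat (Matrix.mat 1 1 (\<lambda>_. s)) (0\<^sub>m 1 n) (0\<^sub>m n 1) (V\<^sup>T * B')"
    unfolding Wt Bblock using V B'c
    by (subst mult_four_block_mat[of _ 1 1 _ n _ n _ _ 1 _ n]) (auto intro!: cong_four_block_mat)
  have WBW: "W\<^sup>T * B * W = four_block_mat (Matrix.mat 1 1 (\<lambda>_. s)) (0\<^sub>m 1 n) (0\<^sub>m n 1) (mat_diag n d)"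
    unfolding WB unfolding W_def V(3)[symmetric] using V B'c
    by (subst mult_four_block_mat[of _ 1 1 _ n _ n _ _ 1 _ n]) (auto intro!: cong_four_block_mat)
  define U where "U = H * W"
  have Uc: "U \<in> carrier_mat (Suc n) (Suc n)" using H Wc by (simp add: U_def)
  have Ut: "U\<^sup>T = W\<^sup>T * H" unfolding U_def using transpose_mult[OF H(1) Wc] H(2) by simp
  have "U\<^sup>T * U = W\<^sup>T * (H * (H * W))"
    unfolding Ut unfolding U_def using H(1) Wc Wtc by (intro assoc_mult_mat) auto
  also have "H * (H * W) = W" using mat_assoc3[OF H(1) H(1) Wc] H(3) Wc by simp
  finally have UU: "U\<^sup>T * U = 1\<^sub>m (Suc n)" using WW by simp
  have "U\<^sup>T * A * U = W\<^sup>T * H * A * H * W"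
    unfolding Ut unfolding U_def using H(1) A Wc Wtc by (intro mat_assoc3) auto
  also have "W\<^sup>T * H * A = W\<^sup>T * (H * A)" using H(1) A Wtc by (intro assoc_mult_mat) auto
  also have "\<dots> * H = W\<^sup>T * B" unfolding B_def using H(1) A Wtc by (intro assoc_mult_mat) auto
  finally have UAU: "U\<^sup>T * A * U = W\<^sup>T * B * W" .
  have "W\<^sup>T * B * W = mat_diag (Suc n) (\<lambda>i. if i = 0 then s else d (i - 1))"
    unfolding WBW by (intro eq_matI) (auto simp: mat_diag_def)
  thus ?case using Uc UU UAU by auto
qed

lemma orthogonal_mat_right_inverse:
  assumes "(U :: real mat) \<in> carrier_mat n n" "U\<^sup>T * U = 1\<^sub>m n"
  shows "U * U\<^sup>T = 1\<^sub>m n"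
  using mat_mult_left_right_inverse[OF _ assms(1) assms(2)] assms(1) by auto

lemma mat_diag_transpose: "(mat_diag n f)\<^sup>T = mat_diag n f"
  by (auto simp: mat_diag_def intro!: eq_matI)

lemma pos_semidef_diagonalization:
  assumes A: "pos_semidef n A"
  obtains U d where "U \<in> carrier_mat n n" "U\<^sup>T * U = 1\<^sub>m n" "U * U\<^sup>T = 1\<^sub>m n"
    "U\<^sup>T * A * U = mat_diag n d" "\<And>i. i < n \<Longrightarrow> d i \<ge> 0"
proof -
  have Ac: "A \<in> carrier_mat n n" "A\<^sup>T = A" using A by (auto simp: pos_semidef_def)
  obtain U d where U: "U \<in> carrier_mat n n" "U\<^sup>T * U = 1\<^sub>m n" "U\<^sup>T * A * U = mat_diag n d"
    using symmetric_diagonalization[OF Ac] by blast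
  have "d i \<ge> 0" if i: "i < n" for i
  proof -
    have "pos_semidef n (mat_diag n d)" using pos_semidef_congruence(1)[OF A U(1)] U(3) by simp
    hence "0 \<le> unit_vec n i \<bullet> (mat_diag n d *\<^sub>v unit_vec n i)" by (simp add: pos_semidef_def)
    also have "mat_diag n d *\<^sub>v unit_vec n i = d i \<cdot>\<^sub>v unit_vec n i"
      using i by (intro eq_vecI) (auto simp: mat_diag_def scalar_prod_def if_distrib cong: if_cong)
    finally show ?thesis using i by simp
  qed
  thus ?thesis using that U orthogonal_mat_right_inverse[OF U(1,2)] by blast
qed

text \<open>
Diagonalize \<open>K\<close> to write it as \<open>F F\<^sup>T\<close>, then diagonalize \<open>F\<^sup>T L F\<close> by an orthogonal \<open>V\<close> and take
\<open>O' = F V\<close>. The columns of \<open>O'\<close> are eigenvectors of \<open>K L\<close>; that they lie in the range of \<open>K\<close> is recorded by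
\<open>Y\<close>.
\<close>

theorem simultaneous_factorization:
  assumes K: "pos_semidef n K" and L: "pos_semidef n L"
  obtains O' Y \<mu> where "O' \<in> carrier_mat n n" "Y \<in> carrier_mat n n" "O' * O'\<^sup>T = K" "O' = K * Y"
    "O'\<^sup>T * L * O' = mat_diag n \<mu>" "\<And>i. i < n \<Longrightarrow> \<mu> i \<ge> 0"
proof -
  have Kc: "K \<in> carrier_mat n n" "K\<^sup>T = K" and Lc: "L \<in> carrier_mat n n" "L\<^sup>T = L"
    using K L by (auto simp: pos_semidef_def)
  obtain U d where U: "U \<in> carrier_mat n n" "U\<^sup>T * U = 1\<^sub>m n" "U * U\<^sup>T = 1\<^sub>m n"
    "U\<^sup>T * K * U = mat_diag n d" and d: "\<And>i. i < n \<Longrightarrow> d i \<ge> 0"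
    using pos_semidef_diagonalization[OF K] by blast
  have Ut: "U\<^sup>T \<in> carrier_mat n n" using U by simp
  define D where "D = mat_diag n (\<lambda>i. sqrt (d i))"
  define E where "E = mat_diag n (\<lambda>i. if d i = 0 then 0 else 1 / sqrt (d i))"
  have DE: "D \<in> carrier_mat n n" "E \<in> carrier_mat n n" by (simp_all add: D_def E_def)
  have DD: "D * D = mat_diag n d"
    unfolding D_def mat_diag_diag using d by (auto simp: mat_diag_def intro!: eq_matI)
  have dE: "mat_diag n d * E = D"
    unfolding D_def E_def mat_diag_diag
    by (rule eq_matI) (use d in \<open>auto simp: mat_diag_def real_div_sqrt\<close>)
  define F where "F = U * D"
  have Fc: "F \<in> carrier_mat n n" using U DE by (simp add: F_def)
  have KU: "K * U = U * mat_diag n d"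
  proof -
    have "U * mat_diag n d = U * (U\<^sup>T * (K * U))"
      unfolding U(4)[symmetric] using U Kc Ut by (simp add: assoc_mult_mat[of _ n n _ n _ n])
    also have "\<dots> = K * U" using mat_assoc3[OF U(1) Ut, of "K * U" n] U Kc by simp
    finally show ?thesis by simp
  qed
  have FF: "F * F\<^sup>T = K"
  proof -
    have "F\<^sup>T = D * U\<^sup>T" unfolding F_def using transpose_mult[OF U(1) DE(1)]
      by (simp add: D_def mat_diag_transpose)
    hence "F * F\<^sup>T = U * (D * D) * U\<^sup>T"
      unfolding F_def using U(1) Ut DE by (simp add: assoc_mult_mat[of _ n n _ n _ n])
    also have "\<dots> = K * (U * U\<^sup>T)" unfolding DD KU[symmetric] using U(1) Ut Kc
      by (simp add: assoc_mult_mat[of _ n n _ n _ n])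
    finally show ?thesis using U Kc by simp
  qed
  have FK: "F = K * (U * E)"
  proof -
    have "K * (U * E) = U * (mat_diag n d * E)"
      using mat_assoc3[OF Kc(1) U(1) DE(2)] KU U(1) DE by (simp add: assoc_mult_mat[of _ n n _ n _ n])
    thus ?thesis by (simp add: dE F_def)
  qed
  have P: "pos_semidef n (F\<^sup>T * L * F)" by (rule pos_semidef_congruence(1)[OF L Fc])
  obtain V \<mu> where V: "V \<in> carrier_mat n n" "V\<^sup>T * V = 1\<^sub>m n" "V * V\<^sup>T = 1\<^sub>m n"
    "V\<^sup>T * (F\<^sup>T * L * F) * V = mat_diag n \<mu>" and \<mu>: "\<And>i. i < n \<Longrightarrow> \<mu> i \<ge> 0"
    using pos_semidef_diagonalization[OF P] by blast
  have Vt: "V\<^sup>T \<in> carrier_mat n n" "F\<^sup>T \<in> carrier_mat n n" using V Fc by simp_all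
  have FVt: "(F * V)\<^sup>T = V\<^sup>T * F\<^sup>T" using transpose_mult[OF Fc V(1)] .
  show ?thesis
  proof (rule that[of "F * V" "U * E * V" \<mu>])
    show "F * V * (F * V)\<^sup>T = K"
    proof -
      have "F * V * (F * V)\<^sup>T = F * (V * V\<^sup>T) * F\<^sup>T"
        unfolding FVt using Fc V(1) Vt by (simp add: assoc_mult_mat[of _ n n _ n _ n])
      thus ?thesis using V(3) Fc FF by simp
    qed
    show "F * V = K * (U * E * V)"
      using FK mat_assoc3[of K n n "U * E" n V n] Kc U DE V by simp
    show "(F * V)\<^sup>T * L * (F * V) = mat_diag n \<mu>"
      unfolding FVt V(4)[symmetric] using Fc V(1) Vt Lc by (simp add: assoc_mult_mat[of _ n n _ n _ n])
  qed (use Fc V U DE \<mu> in auto)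
qed

section \<open>Calculus of vector-valued functions\<close>

lemma vec_eq_if_minus_eq_0:
  assumes "v \<in> carrier_vec n" "w \<in> carrier_vec n" "v - w = (0\<^sub>v n :: real Matrix.vec)"
  shows "v = w"
proof (rule eq_vecI)
  fix i assume "i < dim_vec w"
  thus "v $ i = w $ i" using arg_cong[OF assms(3), of "\<lambda>u. u $ i"] assms(1,2) by simp
qed (use assms in simp)

lemma mult_mat_uminus_vec:
  assumes "(B :: real mat) \<in> carrier_mat r k" "u \<in> carrier_vec k"
  shows "B *\<^sub>v (- u) = - (B *\<^sub>v u)"
  using assms by (intro eq_vecI) (auto simp: scalar_prod_uminus_right)

lemma smult_mat_mult_vec:
  assumes "(B :: real mat) \<in> carrier_mat r k" "u \<in> carrier_vec k"
  shows "(c \<cdot>\<^sub>m B) *\<^sub>v u = c \<cdot>\<^sub>v (B *\<^sub>v u)"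
  using assms by (intro eq_vecI) (auto simp: scalar_prod_def sum_distrib_left mult.assoc)

lemma has_real_derivative_transform:
  assumes "y \<in> D" "\<And>t. t \<in> D \<Longrightarrow> g t = f t" "(f has_real_derivative d) (at y within D)"
  shows "(g has_real_derivative d) (at y within D)"
  using has_derivative_transform[OF assms(1,2)] assms(3) by (auto simp: has_field_derivative_def)

lemma has_derivative_scalar_prod:
  assumes "\<And>t. t \<in> D \<Longrightarrow> a t \<in> carrier_vec k" "\<And>t. t \<in> D \<Longrightarrow> c t \<in> carrier_vec k" "y \<in> D"
    and "da \<in> carrier_vec k" "dc \<in> carrier_vec k"
    and da: "\<And>i. i < k \<Longrightarrow> ((\<lambda>t. a t $ i) has_real_derivative da $ i) (at y within D)"
    and dc: "\<And>i. i < k \<Longrightarrow> ((\<lambda>t. c t $ i) has_real_derivative dc $ i) (at y within D)"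
  shows "((\<lambda>t. a t \<bullet> c t) has_real_derivative (da \<bullet> c y + a y \<bullet> dc)) (at y within D)"
proof -
  have "((\<lambda>t. \<Sum>i = 0..<k. a t $ i * c t $ i) has_real_derivative
      (\<Sum>i = 0..<k. da $ i * c y $ i + a y $ i * dc $ i)) (at y within D)"
    by (intro DERIV_sum) (auto intro!: derivative_eq_intros da dc)
  also have "(\<Sum>i = 0..<k. da $ i * c y $ i + a y $ i * dc $ i) = da \<bullet> c y + a y \<bullet> dc"
    using carrier_vecD[OF assms(2)[OF assms(3)]] carrier_vecD[OF assms(5)]
    by (simp add: scalar_prod_def sum.distrib)
  finally show ?thesis
    by (rule has_real_derivative_transform[rotated 2]) (use assms(3) carrier_vecD[OF assms(2)] in \<open>auto simp: scalar_prod_def\<close>)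
qed

lemma has_derivative_mult_mat_vec:
  assumes "B \<in> carrier_mat r k" "\<And>t. t \<in> D \<Longrightarrow> c t \<in> carrier_vec k" "y \<in> D" "dc \<in> carrier_vec k"
    and dc: "\<And>i. i < k \<Longrightarrow> ((\<lambda>t. c t $ i) has_real_derivative dc $ i) (at y within D)"
    and j: "j < r"
  shows "((\<lambda>t. (B *\<^sub>v c t) $ j) has_real_derivative (B *\<^sub>v dc) $ j) (at y within D)"
proof -
  have e: "(B *\<^sub>v u) $ j = row B j \<bullet> u" for u using j assms(1) by simp
  have "((\<lambda>t. row B j \<bullet> c t) has_real_derivative (0\<^sub>v k \<bullet> c y + row B j \<bullet> dc)) (at y within D)"
    using assms(1-5) j by (intro has_derivative_scalar_prod[of D _ k]) (auto intro!: derivative_eq_intros)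
  thus ?thesis using assms(2,3) by (simp add: e)
qed

lemma tendsto_scalar_prod_0:
  assumes "\<And>t. t \<ge> (0::real) \<Longrightarrow> a t \<in> carrier_vec k" "\<And>t. t \<ge> 0 \<Longrightarrow> c t \<in> carrier_vec k"
    and "\<And>i. i < k \<Longrightarrow> ((\<lambda>t. a t $ i) \<longlongrightarrow> a0 i) at_top"
    and "\<And>i. i < k \<Longrightarrow> ((\<lambda>t. c t $ i) \<longlongrightarrow> (0::real)) at_top"
  shows "((\<lambda>t. a t \<bullet> c t) \<longlongrightarrow> 0) at_top"
proof -
  have "((\<lambda>t. \<Sum>i = 0..<k. a t $ i * c t $ i) \<longlongrightarrow> (\<Sum>i = 0..<k. a0 i * 0)) at_top"
    by (intro tendsto_intros) (use assms in auto)
  moreover have "eventually (\<lambda>t. (\<Sum>i = 0..<k. a t $ i * c t $ i) = a t \<bullet> c t) at_top"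
    using eventually_ge_at_top[of "0::real"]
    by eventually_elim (use carrier_vecD[OF assms(2)] in \<open>auto simp: scalar_prod_def\<close>)
  ultimately show ?thesis by (simp add: filterlim_cong)
qed

lemma tendsto_mult_mat_vec_0:
  assumes "B \<in> carrier_mat r k" "\<And>t. t \<ge> (0::real) \<Longrightarrow> c t \<in> carrier_vec k"
    and "\<And>i. i < k \<Longrightarrow> ((\<lambda>t. c t $ i) \<longlongrightarrow> (0::real)) at_top" and j: "j < r"
  shows "((\<lambda>t. (B *\<^sub>v c t) $ j) \<longlongrightarrow> 0) at_top"
proof -
  have "((\<lambda>t. row B j \<bullet> c t) \<longlongrightarrow> 0) at_top"
    using assms by (intro tendsto_scalar_prod_0[of _ k _ "\<lambda>i. row B j $ i"]) auto
  thus ?thesis using j assms(1) by simp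
qed

lemma eq_0_if_derivative_0:
  assumes "\<And>y. y \<ge> 0 \<Longrightarrow> (f has_real_derivative 0) (at y within {0..})"
    and "(f \<longlongrightarrow> 0) at_top" and "y \<ge> (0::real)"
  shows "f y = (0::real)"
proof -
  obtain c where c: "\<And>x. x \<in> {0..} \<Longrightarrow> f x = c"
    using has_field_derivative_zero_constant[of "{0::real..}" f] assms(1) by auto
  have "(f \<longlongrightarrow> c) at_top"
    by (rule tendsto_eventually, rule eventually_mono[OF eventually_ge_at_top[of "0::real"]]) (use c in auto)
  thus ?thesis using tendsto_unique[OF _ assms(2)] c assms(3) by fastforce
qed

section \<open>The abstract half-space problem\<close>

text \<open>
The properties of the matrices on which the solvability of the half-space problem rests. \<open>T\<close> is
\<open>M\<^sup>T S\<^sup>-\<^sup>1 M\<close>. By \<open>index_1\<close> the differential-algebraic system has index one, that is, its algebraic part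
determines the components that are not differentiated. \<open>odd_rank\<close> is the condition \<open>r\<^sub>2 = 0\<close>: no nonzero
element of the kernel of \<open>Q\<^sub>o\<close> is mapped by \<open>M\<close> into the orthogonal complement of the kernel of \<open>Q\<^sub>e\<close>.
\<close>

locale half_space_data =
  fixes m n p :: nat and Mm Qe Qo T Ge :: "real mat" and b :: real
  assumes Mm: "Mm \<in> carrier_mat m n"
    and Mm_inj: "\<And>x. x \<in> carrier_vec n \<Longrightarrow> Mm *\<^sub>v x = 0\<^sub>v m \<Longrightarrow> x = 0\<^sub>v n"
    and Qe: "pos_semidef m Qe" and Qo: "pos_semidef n Qo"
    and index_1: "\<And>v. v \<in> carrier_vec m \<Longrightarrow> Mm\<^sup>T *\<^sub>v v = 0\<^sub>v n \<Longrightarrow> Qe *\<^sub>v v = 0\<^sub>v m \<Longrightarrow> v = 0\<^sub>v m"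
    and Ge: "Ge \<in> carrier_mat m p"
    and Ge_inj: "\<And>z. z \<in> carrier_vec p \<Longrightarrow> Ge *\<^sub>v z = 0\<^sub>v m \<Longrightarrow> z = 0\<^sub>v p"
    and Qe_Ge: "\<And>z. z \<in> carrier_vec p \<Longrightarrow> Qe *\<^sub>v (Ge *\<^sub>v z) = 0\<^sub>v m"
    and Qe_kernel: "\<And>v. v \<in> carrier_vec m \<Longrightarrow> Qe *\<^sub>v v = 0\<^sub>v m \<Longrightarrow> \<exists>z\<in>carrier_vec p. v = Ge *\<^sub>v z"
    and odd_rank: "\<And>v. v \<in> carrier_vec n \<Longrightarrow> Qo *\<^sub>v v = 0\<^sub>v n \<Longrightarrow>
        (\<And>z. z \<in> carrier_vec p \<Longrightarrow> (Ge *\<^sub>v z) \<bullet> (Mm *\<^sub>v v) = 0) \<Longrightarrow> v = 0\<^sub>v n"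
    and T: "pos_def n T" and b: "b > 0"
begin

lemma Qe_c: "Qe \<in> carrier_mat m m" "Qe\<^sup>T = Qe" and Qo_c: "Qo \<in> carrier_mat n n" "Qo\<^sup>T = Qo"
  and T_c: "T \<in> carrier_mat n n" "T\<^sup>T = T" and MmT: "Mm\<^sup>T \<in> carrier_mat n m"
  using Qe Qo T Mm by (auto simp: pos_semidef_def pos_def_def)

text \<open>
The even equations force \<open>Q\<^sub>e w\<^sub>e\<close> into the range of \<open>M\<close>, and the columns of \<open>P\<close> are a basis of the space of
such \<open>w\<^sub>e\<close>, dual to \<open>M\<close>. With the positive definite \<open>S' = Q\<^sub>e + M M\<^sup>T\<close>, \<open>P = S'\<^sup>-\<^sup>1 M (M\<^sup>T S'\<^sup>-\<^sup>1 M)\<^sup>-\<^sup>1\<close> does it: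
\<open>S' P\<close> and \<open>M M\<^sup>T P\<close> both have range in that of \<open>M\<close>.
\<close>

lemma elimination:
  obtains P K where "P \<in> carrier_mat m n" "pos_semidef n K" "Mm\<^sup>T * P = 1\<^sub>m n" "Qe * P = Mm * K"
proof -
  \<comment> \<open>Adding the Gram matrix of M makes the form definite without changing it on the kernel of the transpose.\<close>
  define S' where "S' = Qe + Mm * Mm\<^sup>T"
  have "pos_def m S'"
    unfolding pos_def_def
  proof (intro conjI ballI impI)
    show "pos_semidef m S'" unfolding S'_def by (rule pos_semidef_add(1)[OF Qe pos_semidef_gram(1)[OF Mm]])
    fix x :: "real Matrix.vec" assume x: "x \<in> carrier_vec m" and 0: "x \<bullet> (S' *\<^sub>v x) = 0"
    have "x \<bullet> (S' *\<^sub>v x) = x \<bullet> (Qe *\<^sub>v x) + (Mm\<^sup>T *\<^sub>v x) \<bullet> (Mm\<^sup>T *\<^sub>v x)"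
      unfolding S'_def using pos_semidef_add(2)[OF Qe pos_semidef_gram(1)[OF Mm] x]
        pos_semidef_gram(2)[OF Mm x] by simp
    moreover have "0 \<le> x \<bullet> (Qe *\<^sub>v x)" using Qe x by (auto simp: pos_semidef_def)
    ultimately have z: "x \<bullet> (Qe *\<^sub>v x) = 0" "(Mm\<^sup>T *\<^sub>v x) \<bullet> (Mm\<^sup>T *\<^sub>v x) = 0"
      using 0 scalar_prod_self_ge_0[of "Mm\<^sup>T *\<^sub>v x"] by linarith+
    have "Mm\<^sup>T *\<^sub>v x \<in> carrier_vec n" using MmT x by simp
    thus "x = 0\<^sub>v m"
      using index_1[OF x] pos_semidef_kernel[OF Qe x z(1)] z(2) scalar_prod_self_eq_0 by blast
  qed
  then obtain R where R: "pos_def m R" "S' * R = 1\<^sub>m m" using pos_def_inverse by blast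
  have Rc: "R \<in> carrier_mat m m" "pos_semidef m R" using R by (auto simp: pos_def_def pos_semidef_def)
  define N where "N = Mm\<^sup>T * R * Mm"
  have "pos_def n N"
    unfolding pos_def_def
  proof (intro conjI ballI impI)
    show "pos_semidef n N" unfolding N_def by (rule pos_semidef_congruence(1)[OF Rc(2) Mm])
    fix x :: "real Matrix.vec" assume x: "x \<in> carrier_vec n" and 0: "x \<bullet> (N *\<^sub>v x) = 0"
    have "(Mm *\<^sub>v x) \<bullet> (R *\<^sub>v (Mm *\<^sub>v x)) = 0"
      using 0 pos_semidef_congruence(2)[OF Rc(2) Mm x] by (simp add: N_def)
    moreover have "Mm *\<^sub>v x \<in> carrier_vec m" using Mm x by simp
    ultimately have "Mm *\<^sub>v x = 0\<^sub>v m" using R(1) by (auto simp: pos_def_def)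
    thus "x = 0\<^sub>v n" by (rule Mm_inj[OF x])
  qed
  then obtain N' where N': "pos_def n N'" "N * N' = 1\<^sub>m n" using pos_def_inverse by blast
  have N'c: "N' \<in> carrier_mat n n" using N' by (auto simp: pos_def_def pos_semidef_def)
  define P where "P = R * Mm * N'"
  have Pc: "P \<in> carrier_mat m n" using Rc Mm N'c by (simp add: P_def)
  have MP: "Mm\<^sup>T * P = 1\<^sub>m n"
  proof -
    have "Mm\<^sup>T * P = Mm\<^sup>T * (R * Mm) * N'"
      unfolding P_def using MmT Rc Mm N'c by (intro mat_assoc3) auto
    also have "Mm\<^sup>T * (R * Mm) = N" unfolding N_def using MmT Rc Mm by (intro mat_assoc3) auto
    finally show ?thesis using N'(2) by simp
  qed
  have S'c: "S' \<in> carrier_mat m m" using Qe_c Mm by (simp add: S'_def)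
  have SP: "S' * P = Mm * N'"
  proof -
    have "S' * P = S' * (R * Mm) * N'"
      unfolding P_def using S'c Rc Mm N'c by (intro mat_assoc3) auto
    also have "S' * (R * Mm) = S' * R * Mm" using S'c Rc Mm by (intro mat_assoc3) auto
    finally show ?thesis using R(2) Mm by simp
  qed
  define K where "K = P\<^sup>T * Qe * P"
  have Kp: "pos_semidef n K" unfolding K_def by (rule pos_semidef_congruence(1)[OF Qe Pc])
  have QP: "Qe * P = Mm * (N' - 1\<^sub>m n)"
  proof -
    have "S' * P = Qe * P + Mm * Mm\<^sup>T * P"
      unfolding S'_def using Qe_c Mm Pc by (intro add_mult_distrib_mat[of _ m m]) auto
    also have "Mm * Mm\<^sup>T * P = Mm * (Mm\<^sup>T * P)" using Mm Pc by (intro assoc_mult_mat) auto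
    finally have "Mm * N' = Qe * P + Mm" using MP SP Mm by simp
    moreover have "Qe * P + Mm - Mm = Qe * P"
      by (rule eq_matI) (use Qe_c Pc Mm in auto)
    ultimately have "Mm * N' - Mm = Qe * P" by simp
    moreover have "Mm * (N' - 1\<^sub>m n) = Mm * N' - Mm"
      using mult_minus_distrib_mat[OF Mm N'c, of "1\<^sub>m n"] Mm by simp
    ultimately show ?thesis by simp
  qed
  have PM: "P\<^sup>T * Mm = 1\<^sub>m n"
    using transpose_mult[OF MmT Pc] MP by simp
  have "K = P\<^sup>T * (Qe * P)" unfolding K_def using Pc Qe_c by (intro assoc_mult_mat) auto
  also have "\<dots> = P\<^sup>T * Mm * (N' - 1\<^sub>m n)" unfolding QP using Pc Mm N'c by (intro mat_assoc3) auto
  also have "\<dots> = N' - 1\<^sub>m n" unfolding PM using N'c by simp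
  finally have "Qe * P = Mm * K" using QP by simp
  thus ?thesis using that Pc Kp MP by blast
qed

text \<open>
The columns of \<open>E\<close> and \<open>O'\<close> are the even and odd parts of modes that decay at the rates \<open>l\<close>. The last
conclusion is the dual form of the statement that the boundary condition can be satisfied: no
nonzero vector is orthogonal to the boundary values of all modes and of all constant solutions
\<open>(G\<^sub>e z, 0)\<close>. Such a vector is a combination \<open>\<Sum> a\<^sub>i O\<^sub>i\<close> of the odd parts; pairing it with the mode that has
the amplitudes \<open>a\<^sub>i\<close> gives a sum of two nonnegative terms, one of which is positive definite.
\<close>

lemma decaying_modes:
  obtains E O' l where "E \<in> carrier_mat m n" "O' \<in> carrier_mat n n" "\<And>i. i < n \<Longrightarrow> l i > 0"
    "Mm * O' * mat_diag n l = Qe * E" "Mm\<^sup>T * E * mat_diag n l = Qo * O'"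
    "\<And>q. q \<in> carrier_vec n \<Longrightarrow> (T * O' + b \<cdot>\<^sub>m (Mm\<^sup>T * E))\<^sup>T *\<^sub>v q = 0\<^sub>v n \<Longrightarrow>
      (b \<cdot>\<^sub>m (Mm\<^sup>T * Ge))\<^sup>T *\<^sub>v q = 0\<^sub>v p \<Longrightarrow> q = 0\<^sub>v n"
proof -
  obtain P K where P: "P \<in> carrier_mat m n" and K: "pos_semidef n K" and MP: "Mm\<^sup>T * P = 1\<^sub>m n"
    and QP: "Qe * P = Mm * K" using elimination by blast
  have Kc: "K \<in> carrier_mat n n" "K\<^sup>T = K" using K by (auto simp: pos_semidef_def)
  have MPv: "Mm\<^sup>T *\<^sub>v (P *\<^sub>v x) = x" if "x \<in> carrier_vec n" for x
    using assoc_mult_mat_vec[OF MmT P that] MP that by simp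
  have QPv: "Qe *\<^sub>v (P *\<^sub>v x) = Mm *\<^sub>v (K *\<^sub>v x)" if "x \<in> carrier_vec n" for x
    using assoc_mult_mat_vec[OF Qe_c(1) P that] assoc_mult_mat_vec[OF Mm Kc(1) that] QP by simp
  define G where "G = Mm\<^sup>T * Ge"
  have Gc: "G \<in> carrier_mat n p" using Mm Ge by (simp add: G_def)
  have Gv: "G *\<^sub>v z = Mm\<^sup>T *\<^sub>v (Ge *\<^sub>v z)" if "z \<in> carrier_vec p" for z
    unfolding G_def by (rule assoc_mult_mat_vec[OF MmT Ge that])
  have K_ker: "\<exists>z\<in>carrier_vec p. x = G *\<^sub>v z" if x: "x \<in> carrier_vec n" and 0: "K *\<^sub>v x = 0\<^sub>v n" for x
  proof -
    have "Qe *\<^sub>v (P *\<^sub>v x) = 0\<^sub>v m" using QPv[OF x] 0 mult_mat_zero_vec[OF Mm] by simp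
    moreover have "P *\<^sub>v x \<in> carrier_vec m" using P x by simp
    ultimately obtain z where z: "z \<in> carrier_vec p" "P *\<^sub>v x = Ge *\<^sub>v z" using Qe_kernel by blast
    hence "x = G *\<^sub>v z" using MPv[OF x] Gv[OF z(1)] by simp
    thus ?thesis using z by blast
  qed
  have KG: "K *\<^sub>v (G *\<^sub>v z) = 0\<^sub>v n" if z: "z \<in> carrier_vec p" for z
  proof -
    define v where "v = Ge *\<^sub>v z"
    have v: "v \<in> carrier_vec m" using Ge z by (simp add: v_def)
    define x where "x = Mm\<^sup>T *\<^sub>v v"
    have x: "x \<in> carrier_vec n" using MmT v by (simp add: x_def)
    have Px: "P *\<^sub>v x \<in> carrier_vec m" using P x by simp
    define u where "u = v - P *\<^sub>v x"
    have u: "u \<in> carrier_vec m" using v Px by (simp add: u_def)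
    have Mu: "Mm\<^sup>T *\<^sub>v u = 0\<^sub>v n"
      unfolding u_def mult_minus_distrib_mat_vec[OF MmT v Px] MPv[OF x] x_def[symmetric] using x by simp
    have Qu: "Qe *\<^sub>v u = - (Mm *\<^sub>v (K *\<^sub>v x))"
      unfolding u_def mult_minus_distrib_mat_vec[OF Qe_c(1) v Px] QPv[OF x]
      using Qe_Ge[OF z] Mm Kc x by (auto simp: v_def[symmetric] intro!: eq_vecI)
    have "K *\<^sub>v x \<in> carrier_vec n" using Kc x by simp
    hence "u \<bullet> (Mm *\<^sub>v (K *\<^sub>v x)) = 0"
      using scalar_prod_transpose[OF Mm u] Mu by simp
    hence "u \<bullet> (Qe *\<^sub>v u) = 0" unfolding Qu using u Mm Kc x by (simp add: scalar_prod_uminus_right)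
    hence "Qe *\<^sub>v u = 0\<^sub>v m" by (rule pos_semidef_kernel[OF Qe u])
    hence "u = 0\<^sub>v m" using index_1[OF u Mu] by blast
    hence "v = P *\<^sub>v x" using vec_eq_if_minus_eq_0[OF v Px] by (simp add: u_def)
    hence "Mm *\<^sub>v (K *\<^sub>v x) = 0\<^sub>v m" using QPv[OF x] Qe_Ge[OF z] by (simp add: v_def)
    hence "K *\<^sub>v x = 0\<^sub>v n" using Mm_inj[of "K *\<^sub>v x"] Kc x by simp
    thus ?thesis using Gv[OF z] by (simp add: x_def v_def)
  qed
  obtain O' Y \<mu> where O': "O' \<in> carrier_mat n n" and Y: "Y \<in> carrier_mat n n" and OO: "O' * O'\<^sup>T = K"
    and OK: "O' = K * Y" and OLO: "O'\<^sup>T * Qo * O' = mat_diag n \<mu>" and \<mu>: "\<And>i. i < n \<Longrightarrow> \<mu> i \<ge> 0"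
    using simultaneous_factorization[OF K Qo] by blast
  have OT: "O'\<^sup>T \<in> carrier_mat n n" using O' by simp
  \<comment> \<open>An odd part with vanishing rate lies in the kernel of Qo and in the range of K; this is where
    the rank condition is used.\<close>
  have col0: "col O' i = 0\<^sub>v n" if i: "i < n" and 0: "\<mu> i = 0" for i
  proof -
    have o: "col O' i \<in> carrier_vec n" using O' by (simp add: carrier_vecI)
    have "O'\<^sup>T * Qo * O' = O'\<^sup>T * (Qo * O')" using O' Qo_c by (intro assoc_mult_mat) auto
    hence "(O'\<^sup>T * (Qo * O')) $$ (i, i) = mat_diag n \<mu> $$ (i, i)" using OLO by simp
    hence "(O'\<^sup>T * (Qo * O')) $$ (i, i) = 0" using 0 i by (simp add: mat_diag_def)
    moreover have "(O'\<^sup>T * (Qo * O')) $$ (i, i) = col O' i \<bullet> col (Qo * O') i"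
      using i O' Qo_c by (subst index_mult_mat(1)) auto
    ultimately have "col O' i \<bullet> (Qo *\<^sub>v col O' i) = 0" using col_mult2[OF Qo_c(1) O' i] by simp
    hence Q0: "Qo *\<^sub>v col O' i = 0\<^sub>v n" by (rule pos_semidef_kernel[OF Qo o])
    have ok: "col O' i = K *\<^sub>v col Y i" unfolding OK by (rule col_mult2[OF Kc(1) Y i])
    have y: "col Y i \<in> carrier_vec n" using Y by (simp add: carrier_vecI)
    show ?thesis
    proof (rule odd_rank[OF o Q0])
      fix z :: "real Matrix.vec" assume z: "z \<in> carrier_vec p"
      have Gz: "G *\<^sub>v z \<in> carrier_vec n" using Gc z by simp
      have "(Ge *\<^sub>v z) \<bullet> (Mm *\<^sub>v col O' i) = (G *\<^sub>v z) \<bullet> (K *\<^sub>v col Y i)"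
        using scalar_prod_transpose[OF Mm _ o, of "Ge *\<^sub>v z"] Ge z by (simp add: Gv[OF z] ok)
      also have "\<dots> = 0" using scalar_prod_transpose[OF Kc(1) Gz y] KG[OF z] Kc(2) y by simp
      finally show "(Ge *\<^sub>v z) \<bullet> (Mm *\<^sub>v col O' i) = 0" .
    qed
  qed
  \<comment> \<open>For a vanishing eigenvalue the column of O' vanishes, so the mode is zero and any rate will do.\<close>
  define l where "l i = (if \<mu> i = 0 then 1 else sqrt (\<mu> i))" for i
  have l: "l i > 0" if "i < n" for i using \<mu>[OF that] by (auto simp: l_def)
  define \<Lambda> where "\<Lambda> = mat_diag n (\<lambda>i. 1 / l i)"
  define X where "X = Qo * O' * \<Lambda>"
  have \<Lambda>c: "\<Lambda> \<in> carrier_mat n n" by (simp add: \<Lambda>_def)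
  have Xc: "X \<in> carrier_mat n n" using Qo_c O' \<Lambda>c by (simp add: X_def)
  have OX: "O'\<^sup>T * X = mat_diag n (\<lambda>i. \<mu> i / l i)"
  proof -
    have "O'\<^sup>T * X = O'\<^sup>T * (Qo * O') * \<Lambda>" unfolding X_def
      using OT Qo_c O' \<Lambda>c by (intro mat_assoc3) auto
    also have "O'\<^sup>T * (Qo * O') = mat_diag n \<mu>" unfolding OLO[symmetric] using OT Qo_c O' by (intro mat_assoc3) auto
    finally show ?thesis by (simp add: \<Lambda>_def)
  qed
  have KX: "K * X = O' * mat_diag n l"
  proof -
    have "K * X = O' * (O'\<^sup>T * X)" unfolding OO[symmetric] using O' OT Xc by (intro assoc_mult_mat) auto
    also have "\<dots> = O' * mat_diag n l"
      unfolding OX mat_diag_mult_right[OF O']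
    proof (rule eq_matI)
      fix i j assume "i < dim_row (Matrix.mat n n (\<lambda>(i, j). O' $$ (i, j) * l j))"
        "j < dim_col (Matrix.mat n n (\<lambda>(i, j). O' $$ (i, j) * l j))"
      hence ij: "i < n" "j < n" by auto
      have "O' $$ (i, j) * (\<mu> j / l j) = O' $$ (i, j) * l j"
      proof (cases "\<mu> j = 0")
        case True
        have "O' $$ (i, j) = col O' j $ i" using ij O' by simp
        thus ?thesis using col0[OF ij(2) True] ij by simp
      next
        case False
        thus ?thesis using \<mu>[OF ij(2)] by (simp add: l_def real_div_sqrt)
      qed
      thus "Matrix.mat n n (\<lambda>(i, j). O' $$ (i, j) * (\<mu> j / l j)) $$ (i, j)
        = Matrix.mat n n (\<lambda>(i, j). O' $$ (i, j) * l j) $$ (i, j)" using ij by simp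
    qed auto
    finally show ?thesis .
  qed
  define E where "E = P * X"
  have Ec: "E \<in> carrier_mat m n" using P Xc by (simp add: E_def)
  have ME: "Mm\<^sup>T * E = X" unfolding E_def using mat_assoc3[OF MmT P Xc] MP Xc by simp
  show ?thesis
  proof (rule that[of E O' l])
    show "Mm * O' * mat_diag n l = Qe * E"
    proof -
      have "Mm * O' * mat_diag n l = Mm * (K * X)" unfolding KX by (rule assoc_mult_mat[OF Mm O' mat_diag_dim])
      also have "\<dots> = Qe * P * X" unfolding QP using Mm Kc Xc by (intro mat_assoc3) auto
      also have "\<dots> = Qe * E" unfolding E_def using Qe_c P Xc by (intro assoc_mult_mat) auto
      finally show ?thesis .
    qed
    show "Mm\<^sup>T * E * mat_diag n l = Qo * O'"
    proof -
      have "X * mat_diag n l = Qo * O' * (\<Lambda> * mat_diag n l)"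
        unfolding X_def by (rule assoc_mult_mat[OF _ \<Lambda>c mat_diag_dim]) (use Qo_c O' in auto)
      also have "\<Lambda> * mat_diag n l = mat_diag n (\<lambda>i. 1)"
        unfolding \<Lambda>_def mat_diag_diag by (rule eq_matI) (use l in \<open>auto simp: mat_diag_def less_imp_neq[symmetric]\<close>)
      finally show ?thesis unfolding ME using Qo_c O' by simp
    qed
    fix q :: "real Matrix.vec" assume q: "q \<in> carrier_vec n"
      and 1: "(T * O' + b \<cdot>\<^sub>m (Mm\<^sup>T * E))\<^sup>T *\<^sub>v q = 0\<^sub>v n"
      and 2: "(b \<cdot>\<^sub>m (Mm\<^sup>T * Ge))\<^sup>T *\<^sub>v q = 0\<^sub>v p"
    have GT: "G\<^sup>T \<in> carrier_mat p n" using Gc by simp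
    have Gq: "G\<^sup>T *\<^sub>v q = 0\<^sub>v p"
    proof -
      have "(b \<cdot>\<^sub>m G)\<^sup>T *\<^sub>v q = b \<cdot>\<^sub>v (G\<^sup>T *\<^sub>v q)"
        using Gc q by (intro eq_vecI) (auto simp: scalar_prod_def sum_distrib_left mult.assoc)
      hence "b \<cdot>\<^sub>v (G\<^sup>T *\<^sub>v q) = 0\<^sub>v p" using 2 by (simp add: G_def)
      hence "b * (G\<^sup>T *\<^sub>v q) $ i = 0" if "i < p" for i
        using that GT by (metis carrier_matD(1) dim_mult_mat_vec index_smult_vec(1) index_zero_vec(1))
      thus ?thesis using b GT by (intro eq_vecI) auto
    qed
    \<comment> \<open>H is positive definite because the range of G is the kernel of K; solving H y = q and using that
      q is orthogonal to the range of G shows that q lies in the range of K.\<close>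
    define H where "H = K + G * G\<^sup>T"
    have He: "x \<bullet> (H *\<^sub>v x) = x \<bullet> (K *\<^sub>v x) + (G\<^sup>T *\<^sub>v x) \<bullet> (G\<^sup>T *\<^sub>v x)" if x: "x \<in> carrier_vec n" for x
      unfolding H_def using pos_semidef_add(2)[OF K pos_semidef_gram(1)[OF Gc] x]
        pos_semidef_gram(2)[OF Gc x] by simp
    have "pos_def n H"
      unfolding pos_def_def
    proof (intro conjI ballI impI)
      show "pos_semidef n H" unfolding H_def by (rule pos_semidef_add(1)[OF K pos_semidef_gram(1)[OF Gc]])
      fix x :: "real Matrix.vec" assume x: "x \<in> carrier_vec n" and 0: "x \<bullet> (H *\<^sub>v x) = 0"
      have "0 \<le> x \<bullet> (K *\<^sub>v x)" using K x by (auto simp: pos_semidef_def)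
      hence z: "x \<bullet> (K *\<^sub>v x) = 0" "(G\<^sup>T *\<^sub>v x) \<bullet> (G\<^sup>T *\<^sub>v x) = 0"
        using 0 He[OF x] scalar_prod_self_ge_0[of "G\<^sup>T *\<^sub>v x"] by linarith+
      obtain y where y: "y \<in> carrier_vec p" "x = G *\<^sub>v y"
        using K_ker[OF x pos_semidef_kernel[OF K x z(1)]] by blast
      have G0: "G\<^sup>T *\<^sub>v x = 0\<^sub>v p" using z(2) scalar_prod_self_eq_0[of "G\<^sup>T *\<^sub>v x" p] GT x by auto
      have "x \<bullet> x = (G\<^sup>T *\<^sub>v x) \<bullet> y" using scalar_prod_transpose[OF Gc x y(1)] y(2) by simp
      hence "x \<bullet> x = 0" using G0 y by simp
      thus "x = 0\<^sub>v n" using scalar_prod_self_eq_0[OF x] by blast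
    qed
    then obtain R where R: "pos_def n R" "H * R = 1\<^sub>m n" using pos_def_inverse by blast
    have Rc: "R \<in> carrier_mat n n" using R by (auto simp: pos_def_def pos_semidef_def)
    define y where "y = R *\<^sub>v q"
    have y: "y \<in> carrier_vec n" using Rc q by (simp add: y_def)
    have Hc: "H \<in> carrier_mat n n" using Kc Gc by (simp add: H_def)
    have GTy: "G\<^sup>T *\<^sub>v y \<in> carrier_vec p" using GT y by simp
    have "q = H *\<^sub>v y" using assoc_mult_mat_vec[OF Hc Rc q] R(2) q by (simp add: y_def)
    also have "\<dots> = K *\<^sub>v y + G *\<^sub>v (G\<^sup>T *\<^sub>v y)"
      unfolding H_def using Kc Gc GT y
      by (subst add_mult_distrib_mat_vec[of _ n n]) (auto simp: assoc_mult_mat_vec[of _ n p _ n])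
    finally have qKG: "q = K *\<^sub>v y + G *\<^sub>v (G\<^sup>T *\<^sub>v y)" .
    define g where "g = G *\<^sub>v (G\<^sup>T *\<^sub>v y)"
    have g: "g \<in> carrier_vec n" using Gc GTy by (simp add: g_def)
    have Ky: "K *\<^sub>v y \<in> carrier_vec n" using Kc y by simp
    have "g \<bullet> q = (G\<^sup>T *\<^sub>v y) \<bullet> (G\<^sup>T *\<^sub>v q)"
      using scalar_prod_transpose[OF GT GTy q] by (simp add: g_def)
    hence "g \<bullet> q = 0" using Gq GTy by simp
    moreover have "g \<bullet> (K *\<^sub>v y) = 0"
      using scalar_prod_transpose[OF Kc(1) g y] Kc(2) KG[OF GTy] y by (simp add: g_def)
    ultimately have "g \<bullet> g = 0"
      using qKG g Ky by (simp add: g_def[symmetric] scalar_prod_add_distrib[OF g Ky g])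
    hence "g = 0\<^sub>v n" using scalar_prod_self_eq_0[OF g] by blast
    hence qK: "q = K *\<^sub>v y" using qKG Ky by (simp add: g_def[symmetric])
    define a where "a = O'\<^sup>T *\<^sub>v y"
    have a: "a \<in> carrier_vec n" using OT y by (simp add: a_def)
    have qO: "q = O' *\<^sub>v a" unfolding qK OO[symmetric] a_def by (rule assoc_mult_mat_vec[OF O' OT y])
    define B where "B = T * O' + b \<cdot>\<^sub>m X"
    have Bc: "B \<in> carrier_mat n n" using T_c O' Xc by (simp add: B_def)
    have Xa: "X *\<^sub>v a \<in> carrier_vec n" and Tq: "T *\<^sub>v q \<in> carrier_vec n" using Xc a T_c q by simp_all
    have "q \<bullet> (B *\<^sub>v a) = (B\<^sup>T *\<^sub>v q) \<bullet> a" by (rule scalar_prod_transpose[OF Bc q a])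
    also have "\<dots> = 0" using 1 a by (simp add: B_def ME)
    also have "B *\<^sub>v a = T *\<^sub>v q + b \<cdot>\<^sub>v (X *\<^sub>v a)"
    proof -
      have "B *\<^sub>v a = (T * O') *\<^sub>v a + (b \<cdot>\<^sub>m X) *\<^sub>v a"
        unfolding B_def using T_c O' Xc a by (intro add_mult_distrib_mat_vec[of _ n n]) auto
      also have "(b \<cdot>\<^sub>m X) *\<^sub>v a = b \<cdot>\<^sub>v (X *\<^sub>v a)"
        using Xc a by (intro eq_vecI) (auto simp: scalar_prod_def sum_distrib_left mult.assoc)
      also have "(T * O') *\<^sub>v a = T *\<^sub>v q" unfolding qO by (rule assoc_mult_mat_vec[OF T_c(1) O' a])
      finally show ?thesis .
    qed
    finally have e: "q \<bullet> (T *\<^sub>v q) + b * (q \<bullet> (X *\<^sub>v a)) = 0"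
      using q Xa Tq by (simp add: scalar_prod_add_distrib[of _ n])
    have "q \<bullet> (X *\<^sub>v a) = a \<bullet> (O'\<^sup>T *\<^sub>v (X *\<^sub>v a))"
      using scalar_prod_transpose[OF OT a Xa] by (simp add: qO)
    also have "\<dots> = a \<bullet> (mat_diag n (\<lambda>i. \<mu> i / l i) *\<^sub>v a)"
      using assoc_mult_mat_vec[OF OT Xc a] by (simp add: OX)
    also have "mat_diag n (\<lambda>i. \<mu> i / l i) *\<^sub>v a = Matrix.vec n (\<lambda>i. \<mu> i / l i * a $ i)"
      by (rule eq_vecI) (use a in \<open>auto simp: mat_diag_def scalar_prod_def if_distrib[of "\<lambda>x. x * _"] cong: if_cong\<close>)
    also have "a \<bullet> Matrix.vec n (\<lambda>i. \<mu> i / l i * a $ i) = (\<Sum>i = 0..<n. \<mu> i / l i * (a $ i * a $ i))"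
      by (auto simp: scalar_prod_def intro!: sum.cong)
    also have "\<dots> \<ge> 0" using \<mu> l by (intro sum_nonneg mult_nonneg_nonneg[OF divide_nonneg_nonneg zero_le_square]) (auto simp: less_imp_le)
    finally have "b * (q \<bullet> (X *\<^sub>v a)) \<ge> 0" using b by simp
    moreover have "0 \<le> q \<bullet> (T *\<^sub>v q)" using T q by (auto simp: pos_def_def pos_semidef_def)
    ultimately have "q \<bullet> (T *\<^sub>v q) = 0" using e by linarith
    thus "q = 0\<^sub>v n" using T q by (auto simp: pos_def_def)
  qed (use Ec O' l in auto)
qed

text \<open>
\<open>z\<close> enters as the amplitude of the constant solution \<open>(G\<^sub>e z, 0)\<close>, which carries no energy flux, so that
\<open>w + (G\<^sub>e z, 0)\<close> obeys the same energy balance as \<open>w\<close> although it does not decay.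
\<close>

lemma energy_uniqueness:
  fixes we wo dwe dwo :: "real \<Rightarrow> real Matrix.vec"
  assumes c: "\<And>y. y \<ge> 0 \<Longrightarrow> we y \<in> carrier_vec m" "\<And>y. y \<ge> 0 \<Longrightarrow> wo y \<in> carrier_vec n"
      "\<And>y. y \<ge> 0 \<Longrightarrow> dwe y \<in> carrier_vec m" "\<And>y. y \<ge> 0 \<Longrightarrow> dwo y \<in> carrier_vec n"
    and dwe: "\<And>y i. y \<ge> 0 \<Longrightarrow> i < m \<Longrightarrow> ((\<lambda>t. we t $ i) has_real_derivative dwe y $ i) (at y within {0..})"
    and dwo: "\<And>y i. y \<ge> 0 \<Longrightarrow> i < n \<Longrightarrow> ((\<lambda>t. wo t $ i) has_real_derivative dwo y $ i) (at y within {0..})"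
    and eqe: "\<And>y. y \<ge> 0 \<Longrightarrow> Mm *\<^sub>v dwo y = - (Qe *\<^sub>v we y)"
    and eqo: "\<And>y. y \<ge> 0 \<Longrightarrow> Mm\<^sup>T *\<^sub>v dwe y = - (Qo *\<^sub>v wo y)"
    and lime: "\<And>i. i < m \<Longrightarrow> ((\<lambda>y. we y $ i) \<longlongrightarrow> 0) at_top"
    and limo: "\<And>i. i < n \<Longrightarrow> ((\<lambda>y. wo y $ i) \<longlongrightarrow> 0) at_top"
    and z: "z \<in> carrier_vec p"
    and bc: "T *\<^sub>v wo 0 = - (b \<cdot>\<^sub>v (Mm\<^sup>T *\<^sub>v (we 0 + Ge *\<^sub>v z)))"
  shows "z = 0\<^sub>v p \<and> (\<forall>y\<ge>0. we y = 0\<^sub>v m \<and> wo y = 0\<^sub>v n)"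
proof -
  define g where "g = Ge *\<^sub>v z"
  have g: "g \<in> carrier_vec m" using Ge z by (simp add: g_def)
  have Qg: "Qe *\<^sub>v g = 0\<^sub>v m" using Qe_Ge[OF z] by (simp add: g_def)
  define \<phi> where "\<phi> y = (we y + g) \<bullet> (Mm *\<^sub>v wo y)" for y
  define \<phi>' where "\<phi>' y = - (wo y \<bullet> (Qo *\<^sub>v wo y)) - (we y \<bullet> (Qe *\<^sub>v we y))" for y
  have Qnn: "0 \<le> wo y \<bullet> (Qo *\<^sub>v wo y)" "0 \<le> we y \<bullet> (Qe *\<^sub>v we y)" if "y \<ge> 0" for y
    using Qe Qo c that by (auto simp: pos_semidef_def)
  have d\<phi>: "(\<phi> has_real_derivative \<phi>' y) (at y within {0..})" if y: "y \<ge> 0" for y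
  proof -
    note cy = c[OF y]
    have "(\<phi> has_real_derivative (dwe y \<bullet> (Mm *\<^sub>v wo y) + (we y + g) \<bullet> (Mm *\<^sub>v dwo y))) (at y within {0..})"
      unfolding \<phi>_def
    proof (rule has_derivative_scalar_prod[of _ _ m])
      fix i assume i: "i < m"
      show "((\<lambda>t. (we t + g) $ i) has_real_derivative dwe y $ i) (at y within {0..})"
      proof -
        have "((\<lambda>t. we t $ i + g $ i) has_real_derivative dwe y $ i) (at y within {0..})"
          using DERIV_add[OF dwe[OF y i] DERIV_const[of "g $ i"]] by simp
        thus ?thesis using i g by simp
      qed
      show "((\<lambda>t. (Mm *\<^sub>v wo t) $ i) has_real_derivative (Mm *\<^sub>v dwo y) $ i) (at y within {0..})"
        by (rule has_derivative_mult_mat_vec[OF Mm]) (use c y dwo i in auto)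
    qed (use c y g Mm in auto)
    also have "dwe y \<bullet> (Mm *\<^sub>v wo y) = (Mm\<^sup>T *\<^sub>v dwe y) \<bullet> wo y"
      by (rule scalar_prod_transpose[OF Mm cy(3,2)])
    also have "\<dots> = - (wo y \<bullet> (Qo *\<^sub>v wo y))"
      unfolding eqo[OF y] using cy Qo_c
      by (simp add: scalar_prod_uminus_left comm_scalar_prod[of "wo y" n])
    also have "(we y + g) \<bullet> (Mm *\<^sub>v dwo y) = - ((we y + g) \<bullet> (Qe *\<^sub>v we y))"
      unfolding eqe[OF y] using cy Qe_c g by (simp add: scalar_prod_uminus_right)
    also have "(we y + g) \<bullet> (Qe *\<^sub>v we y) = we y \<bullet> (Qe *\<^sub>v we y) + g \<bullet> (Qe *\<^sub>v we y)"
      using cy g Qe_c by (intro add_scalar_prod_distrib[of _ m]) auto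
    also have "g \<bullet> (Qe *\<^sub>v we y) = 0"
      using scalar_prod_transpose[OF Qe_c(1) g cy(1)] Qe_c(2) Qg cy by simp
    finally show ?thesis by (simp add: \<phi>'_def)
  qed
  have lim\<phi>: "(\<phi> \<longlongrightarrow> 0) at_top"
    unfolding \<phi>_def
  proof (rule tendsto_scalar_prod_0[of _ m _ "\<lambda>i. g $ i"])
    fix i assume i: "i < m"
    have "((\<lambda>t. we t $ i + g $ i) \<longlongrightarrow> 0 + g $ i) at_top" by (intro tendsto_intros lime i)
    thus "((\<lambda>t. (we t + g) $ i) \<longlongrightarrow> g $ i) at_top" using i g by simp
    show "((\<lambda>t. (Mm *\<^sub>v wo t) $ i) \<longlongrightarrow> 0) at_top"
      by (rule tendsto_mult_mat_vec_0[OF Mm]) (use c limo i in auto)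
  qed (use c g Mm in auto)
  have mono: "\<phi> y \<le> \<phi> x" if xy: "0 \<le> x" "x \<le> y" for x y
  proof (rule DERIV_nonpos_imp_decreasing_open[OF xy(2)])
    show "continuous_on {x..y} \<phi>"
      by (rule DERIV_continuous_on[OF DERIV_subset[OF d\<phi>]]) (use xy in auto)
    fix t assume t: "x < t" "t < y"
    have "at t within {0..} = at t" using t xy by (intro at_within_interior) auto
    thus "\<exists>d. (\<phi> has_real_derivative d) (at t) \<and> d \<le> 0"
      using d\<phi>[of t] Qnn[of t] t xy unfolding \<phi>'_def by (intro exI[of _ "\<phi>' t"]) (auto simp: \<phi>'_def)
  qed
  have \<phi>0: "0 \<le> \<phi> y" if y: "y \<ge> 0" for y
    by (rule tendsto_upperbound[OF lim\<phi>])
       (auto intro!: eventually_mono[OF eventually_ge_at_top[of y]] mono[OF y])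
  have c0: "we 0 + g \<in> carrier_vec m" "wo 0 \<in> carrier_vec n" using c[of 0] g by auto
  have "b * \<phi> 0 = (b \<cdot>\<^sub>v (Mm\<^sup>T *\<^sub>v (we 0 + g))) \<bullet> wo 0"
    unfolding \<phi>_def using scalar_prod_transpose[OF Mm c0] MmT c0 by simp
  also have "\<dots> = - (wo 0 \<bullet> (T *\<^sub>v wo 0))"
    unfolding bc g_def[symmetric] using MmT c0
    by (subst comm_scalar_prod[of _ n]) (auto simp: scalar_prod_uminus_right)
  finally have e0: "b * \<phi> 0 = - (wo 0 \<bullet> (T *\<^sub>v wo 0))" .
  have T0: "0 \<le> wo 0 \<bullet> (T *\<^sub>v wo 0)" using T c0 by (auto simp: pos_def_def pos_semidef_def)
  have "b * \<phi> 0 \<ge> 0" using b \<phi>0[of 0] by simp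
  hence TT: "wo 0 \<bullet> (T *\<^sub>v wo 0) = 0" and "b * \<phi> 0 = 0" using e0 T0 by linarith+
  hence p0: "\<phi> 0 = 0" using b by simp
  have wo0: "wo 0 = 0\<^sub>v n" using T c0 TT by (auto simp: pos_def_def)
  have zero: "\<phi> y = 0" if "y \<ge> 0" for y using \<phi>0[OF that] mono[of 0 y] that p0 by simp
  have "\<phi>' y = 0" if y: "y \<ge> 0" for y
  proof (rule vector_derivative_unique_within[of y "{0..}" \<phi>])
    show "(\<phi> has_vector_derivative \<phi>' y) (at y within {0..})"
      using d\<phi>[OF y] by (simp add: has_real_derivative_iff_has_vector_derivative)
    show "(\<phi> has_vector_derivative 0) (at y within {0..})"
      using has_real_derivative_transform[of y "{0..}" \<phi> "\<lambda>_. 0" 0] y zero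
      by (simp add: has_real_derivative_iff_has_vector_derivative[symmetric])
    show "at y within {0..} \<noteq> bot"
    proof (cases "y = 0")
      case True
      thus ?thesis by (simp add: at_within_Ici_at_right)
    next
      case False
      hence "at y within {0..} = at y" using y by (intro at_within_interior) auto
      thus ?thesis by simp
    qed
  qed
  hence QQ: "wo y \<bullet> (Qo *\<^sub>v wo y) = 0" "we y \<bullet> (Qe *\<^sub>v we y) = 0" if "y \<ge> 0" for y
    using Qnn[OF that] that unfolding \<phi>'_def by (smt (verit))+
  have Qwe: "Qe *\<^sub>v we y = 0\<^sub>v m" and Qwo: "Qo *\<^sub>v wo y = 0\<^sub>v n" if "y \<ge> 0" for y
    using pos_semidef_kernel[OF Qe c(1)[OF that] QQ(2)[OF that]]
      pos_semidef_kernel[OF Qo c(2)[OF that] QQ(1)[OF that]] by auto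
  have Mwo: "Mm *\<^sub>v wo y = 0\<^sub>v m" if y: "y \<ge> 0" for y
  proof (rule eq_vecI)
    fix i assume "i < dim_vec (0\<^sub>v m)"
    hence i: "i < m" by simp
    have "(Mm *\<^sub>v wo y) $ i = 0"
    proof (rule eq_0_if_derivative_0[OF _ _ y])
      fix t :: real assume t: "t \<ge> 0"
      have "((\<lambda>t. (Mm *\<^sub>v wo t) $ i) has_real_derivative (Mm *\<^sub>v dwo t) $ i) (at t within {0..})"
        by (rule has_derivative_mult_mat_vec[OF Mm]) (use c t dwo i in auto)
      thus "((\<lambda>t. (Mm *\<^sub>v wo t) $ i) has_real_derivative 0) (at t within {0..})"
        using eqe[OF t] Qwe[OF t] i by simp
    qed (rule tendsto_mult_mat_vec_0[OF Mm], use c limo i in auto)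
    thus "(Mm *\<^sub>v wo y) $ i = 0\<^sub>v m $ i" using i by simp
  qed (use Mm in simp)
  have Mwe: "Mm\<^sup>T *\<^sub>v we y = 0\<^sub>v n" if y: "y \<ge> 0" for y
  proof (rule eq_vecI)
    fix i assume "i < dim_vec (0\<^sub>v n)"
    hence i: "i < n" by simp
    have "(Mm\<^sup>T *\<^sub>v we y) $ i = 0"
    proof (rule eq_0_if_derivative_0[OF _ _ y])
      fix t :: real assume t: "t \<ge> 0"
      have "((\<lambda>t. (Mm\<^sup>T *\<^sub>v we t) $ i) has_real_derivative (Mm\<^sup>T *\<^sub>v dwe t) $ i) (at t within {0..})"
        by (rule has_derivative_mult_mat_vec[OF MmT]) (use c t dwe i in auto)
      thus "((\<lambda>t. (Mm\<^sup>T *\<^sub>v we t) $ i) has_real_derivative 0) (at t within {0..})"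
        using eqo[OF t] Qwo[OF t] i by simp
    qed (rule tendsto_mult_mat_vec_0[OF MmT], use c lime i in auto)
    thus "(Mm\<^sup>T *\<^sub>v we y) $ i = 0\<^sub>v n $ i" using i by simp
  qed (use Mm in simp)
  have w: "we y = 0\<^sub>v m" "wo y = 0\<^sub>v n" if "y \<ge> 0" for y
    using index_1[OF c(1)[OF that] Mwe[OF that] Qwe[OF that]] Mm_inj[OF c(2)[OF that] Mwo[OF that]] by auto
  have "b \<cdot>\<^sub>v (Mm\<^sup>T *\<^sub>v g) = - (- (b \<cdot>\<^sub>v (Mm\<^sup>T *\<^sub>v (we 0 + g))))" using w(1)[of 0] g by simp
  also have "\<dots> = 0\<^sub>v n"
    using wo0 T_c mult_mat_zero_vec[OF T_c(1)] unfolding bc[unfolded g_def[symmetric], symmetric] by simp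
  finally have bM: "b \<cdot>\<^sub>v (Mm\<^sup>T *\<^sub>v g) = 0\<^sub>v n" .
  have "Mm\<^sup>T *\<^sub>v g = 0\<^sub>v n"
  proof (rule eq_vecI)
    fix i assume "i < dim_vec (0\<^sub>v n)"
    thus "(Mm\<^sup>T *\<^sub>v g) $ i = 0\<^sub>v n $ i"
      using arg_cong[OF bM, of "\<lambda>v. v $ i"] b Mm by simp
  qed (use Mm in simp)
  hence "g = 0\<^sub>v m" using index_1[OF g _ Qg] by blast
  hence "z = 0\<^sub>v p" using Ge_inj[OF z] by (simp add: g_def)
  thus ?thesis using w by blast
qed

lemma solution_split:
  assumes A: "A = four_block_mat (0\<^sub>m m m) Mm (Mm\<^sup>T) (0\<^sub>m n n)"
    and Q: "Q = four_block_mat Qe (0\<^sub>m m n) (0\<^sub>m n m) Qo"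
    and TS: "T = Mm\<^sup>T * the (mat_inverse S) * Mm"
    and w: "half_space_solution A Q Mm S b fe fo w"
  obtains dw where
    "\<And>y. y \<ge> 0 \<Longrightarrow> w y \<in> carrier_vec (m + n)"
    "\<And>y. y < 0 \<Longrightarrow> w y = undefined"
    "\<And>y. y \<ge> 0 \<Longrightarrow> dw y \<in> carrier_vec (m + n)"
    "\<And>y i. y \<ge> 0 \<Longrightarrow> i < m + n \<Longrightarrow> ((\<lambda>t. w t $ i) has_real_derivative dw y $ i) (at y within {0..})"
    "\<And>y. y \<ge> 0 \<Longrightarrow> Mm *\<^sub>v vec_last (dw y) n = - (Qe *\<^sub>v vec_first (w y) m)"
    "\<And>y. y \<ge> 0 \<Longrightarrow> Mm\<^sup>T *\<^sub>v vec_first (dw y) m = - (Qo *\<^sub>v vec_last (w y) n)"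
    "\<And>i. i < m + n \<Longrightarrow> ((\<lambda>y. w y $ i) \<longlongrightarrow> 0) at_top"
    "T *\<^sub>v (vec_last (w 0) n + fo) = - (b \<cdot>\<^sub>v (Mm\<^sup>T *\<^sub>v (vec_first (w 0) m + fe)))"
proof -
  have dims: "dim_row Mm = m" "dim_col Mm = n" using Mm by auto
  note H = w[unfolded half_space_solution_def Let_def dims]
  have wc: "w y \<in> carrier_vec (m + n)" if "y \<ge> 0" for y using H that by auto
  have wu: "w y = undefined" if "y < 0" for y using H that by (auto simp: PiE_def extensional_def)
  have "\<forall>y. y \<ge> 0 \<longrightarrow> (\<exists>dw\<in>carrier_vec (m + n).
         (\<forall>i<m + n. ((\<lambda>t. w t $ i) has_real_derivative dw $ i) (at y within {0..})) \<and>
         A *\<^sub>v dw = - (Q *\<^sub>v w y))" using H by blast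
  then obtain dw where dw: "\<And>y. y \<ge> 0 \<Longrightarrow> dw y \<in> carrier_vec (m + n)"
    "\<And>y i. y \<ge> 0 \<Longrightarrow> i < m + n \<Longrightarrow> ((\<lambda>t. w t $ i) has_real_derivative dw y $ i) (at y within {0..})"
    "\<And>y. y \<ge> 0 \<Longrightarrow> A *\<^sub>v dw y = - (Q *\<^sub>v w y)"
    by metis
  have split: "Mm *\<^sub>v vec_last (dw y) n = - (Qe *\<^sub>v vec_first (w y) m) \<and>
      Mm\<^sup>T *\<^sub>v vec_first (dw y) m = - (Qo *\<^sub>v vec_last (w y) n)" if y: "y \<ge> 0" for y
  proof -
    have "A *\<^sub>v dw y = A *\<^sub>v (vec_first (dw y) m @\<^sub>v vec_last (dw y) n)"
      using vec_first_last_append[OF dw(1)[OF y]] by simp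
    also have "\<dots> = (0\<^sub>m m m *\<^sub>v vec_first (dw y) m + Mm *\<^sub>v vec_last (dw y) n)
        @\<^sub>v (Mm\<^sup>T *\<^sub>v vec_first (dw y) m + 0\<^sub>m n n *\<^sub>v vec_last (dw y) n)"
      unfolding A by (rule four_block_mat_mult_vec) (use Mm in auto)
    also have "0\<^sub>m m m *\<^sub>v vec_first (dw y) m + Mm *\<^sub>v vec_last (dw y) n = Mm *\<^sub>v vec_last (dw y) n"
      by (rule eq_vecI) (use Mm in auto)
    also have "Mm\<^sup>T *\<^sub>v vec_first (dw y) m + 0\<^sub>m n n *\<^sub>v vec_last (dw y) n = Mm\<^sup>T *\<^sub>v vec_first (dw y) m"
      by (rule eq_vecI) (use Mm in auto)
    finally have 1: "A *\<^sub>v dw y = (Mm *\<^sub>v vec_last (dw y) n) @\<^sub>v (Mm\<^sup>T *\<^sub>v vec_first (dw y) m)" .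
    have "Q *\<^sub>v w y = Q *\<^sub>v (vec_first (w y) m @\<^sub>v vec_last (w y) n)"
      using vec_first_last_append[OF wc[OF y]] by simp
    also have "\<dots> = (Qe *\<^sub>v vec_first (w y) m + 0\<^sub>m m n *\<^sub>v vec_last (w y) n)
        @\<^sub>v (0\<^sub>m n m *\<^sub>v vec_first (w y) m + Qo *\<^sub>v vec_last (w y) n)"
      unfolding Q by (rule four_block_mat_mult_vec) (use Qe_c Qo_c in auto)
    finally have "- (Q *\<^sub>v w y) = (- (Qe *\<^sub>v vec_first (w y) m)) @\<^sub>v (- (Qo *\<^sub>v vec_last (w y) n))"
      by (intro eq_vecI) (use Qe_c Qo_c in auto)
    hence "(Mm *\<^sub>v vec_last (dw y) n) @\<^sub>v (Mm\<^sup>T *\<^sub>v vec_first (dw y) m)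
      = (- (Qe *\<^sub>v vec_first (w y) m)) @\<^sub>v (- (Qo *\<^sub>v vec_last (w y) n))"
      using 1 dw(3)[OF y] by simp
    thus ?thesis
      by (subst (asm) append_vec_eq[of _ m]) (use Mm Qe_c in auto)
  qed
  show ?thesis
    by (rule that[of dw]) (use H wc wu dw split TS in auto)
qed

lemma solution_unique:
  assumes A: "A = four_block_mat (0\<^sub>m m m) Mm (Mm\<^sup>T) (0\<^sub>m n n)"
    and Q: "Q = four_block_mat Qe (0\<^sub>m m n) (0\<^sub>m n m) Qo"
    and TS: "T = Mm\<^sup>T * the (mat_inverse S) * Mm"
    and fo: "fo \<in> carrier_vec n" and h: "h \<in> carrier_vec m"
    and z1: "z1 \<in> carrier_vec p" and z2: "z2 \<in> carrier_vec p"
    and w1: "half_space_solution A Q Mm S b (h + Ge *\<^sub>v z1) fo w1"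
    and w2: "half_space_solution A Q Mm S b (h + Ge *\<^sub>v z2) fo w2"
  shows "z1 = z2 \<and> w1 = w2"
proof -
  obtain d1 where 1: "\<And>y. y \<ge> 0 \<Longrightarrow> w1 y \<in> carrier_vec (m + n)"
    "\<And>y. y < 0 \<Longrightarrow> w1 y = undefined"
    "\<And>y. y \<ge> 0 \<Longrightarrow> d1 y \<in> carrier_vec (m + n)"
    "\<And>y i. y \<ge> 0 \<Longrightarrow> i < m + n \<Longrightarrow> ((\<lambda>t. w1 t $ i) has_real_derivative d1 y $ i) (at y within {0..})"
    "\<And>y. y \<ge> 0 \<Longrightarrow> Mm *\<^sub>v vec_last (d1 y) n = - (Qe *\<^sub>v vec_first (w1 y) m)"
    "\<And>y. y \<ge> 0 \<Longrightarrow> Mm\<^sup>T *\<^sub>v vec_first (d1 y) m = - (Qo *\<^sub>v vec_last (w1 y) n)"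
    "\<And>i. i < m + n \<Longrightarrow> ((\<lambda>y. w1 y $ i) \<longlongrightarrow> 0) at_top"
    "T *\<^sub>v (vec_last (w1 0) n + fo) = - (b \<cdot>\<^sub>v (Mm\<^sup>T *\<^sub>v (vec_first (w1 0) m + (h + Ge *\<^sub>v z1))))"
    by (rule solution_split[OF A Q TS w1]) (rule that; assumption)
  obtain d2 where 2: "\<And>y. y \<ge> 0 \<Longrightarrow> w2 y \<in> carrier_vec (m + n)"
    "\<And>y. y < 0 \<Longrightarrow> w2 y = undefined"
    "\<And>y. y \<ge> 0 \<Longrightarrow> d2 y \<in> carrier_vec (m + n)"
    "\<And>y i. y \<ge> 0 \<Longrightarrow> i < m + n \<Longrightarrow> ((\<lambda>t. w2 t $ i) has_real_derivative d2 y $ i) (at y within {0..})"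
    "\<And>y. y \<ge> 0 \<Longrightarrow> Mm *\<^sub>v vec_last (d2 y) n = - (Qe *\<^sub>v vec_first (w2 y) m)"
    "\<And>y. y \<ge> 0 \<Longrightarrow> Mm\<^sup>T *\<^sub>v vec_first (d2 y) m = - (Qo *\<^sub>v vec_last (w2 y) n)"
    "\<And>i. i < m + n \<Longrightarrow> ((\<lambda>y. w2 y $ i) \<longlongrightarrow> 0) at_top"
    "T *\<^sub>v (vec_last (w2 0) n + fo) = - (b \<cdot>\<^sub>v (Mm\<^sup>T *\<^sub>v (vec_first (w2 0) m + (h + Ge *\<^sub>v z2))))"
    by (rule solution_split[OF A Q TS w2]) (rule that; assumption)
  have first_c: "vec_first v m \<in> carrier_vec m" and last_c: "vec_last v n \<in> carrier_vec n" for v :: "real Matrix.vec" by auto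
  have first_i: "i < m \<Longrightarrow> vec_first v m $ i = v $ i" for v :: "real Matrix.vec" and i
    by (simp add: vec_first_def)
  have last_i: "i < n \<Longrightarrow> v \<in> carrier_vec (m + n) \<Longrightarrow> vec_last v n $ i = v $ (m + i)" for v :: "real Matrix.vec" and i
    by (simp add: vec_last_def)
  define we where "we y = vec_first (w1 y) m - vec_first (w2 y) m" for y
  define wo where "wo y = vec_last (w1 y) n - vec_last (w2 y) n" for y
  define de where "de y = vec_first (d1 y) m - vec_first (d2 y) m" for y
  define do' where "do' y = vec_last (d1 y) n - vec_last (d2 y) n" for y
  have zc: "z1 - z2 \<in> carrier_vec p" using z1 z2 by simp
  have "z1 - z2 = 0\<^sub>v p \<and> (\<forall>y\<ge>0. we y = 0\<^sub>v m \<and> wo y = 0\<^sub>v n)"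
  proof (rule energy_uniqueness[of we wo de do', OF _ _ _ _ _ _ _ _ _ _ zc])
    fix y :: real assume y: "y \<ge> 0"
    show "Mm *\<^sub>v do' y = - (Qe *\<^sub>v we y)"
      unfolding do'_def we_def mult_minus_distrib_mat_vec[OF Mm last_c last_c]
        mult_minus_distrib_mat_vec[OF Qe_c(1) first_c first_c] 1(5)[OF y] 2(5)[OF y]
      by (rule eq_vecI) auto
    show "Mm\<^sup>T *\<^sub>v de y = - (Qo *\<^sub>v wo y)"
      unfolding de_def wo_def mult_minus_distrib_mat_vec[OF MmT first_c first_c]
        mult_minus_distrib_mat_vec[OF Qo_c(1) last_c last_c] 1(6)[OF y] 2(6)[OF y]
      by (rule eq_vecI) auto
    show "((\<lambda>t. we t $ i) has_real_derivative de y $ i) (at y within {0..})" if i: "i < m" for i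
    proof -
      have im: "i < m + n" using i by simp
      show ?thesis using DERIV_diff[OF 1(4)[OF y im] 2(4)[OF y im]] i
        by (simp add: we_def de_def first_i)
    qed
    show "((\<lambda>t. wo t $ i) has_real_derivative do' y $ i) (at y within {0..})" if i: "i < n" for i
    proof -
      have im: "m + i < m + n" using i by simp
      have "((\<lambda>t. w1 t $ (m + i) - w2 t $ (m + i)) has_real_derivative do' y $ i) (at y within {0..})"
        using DERIV_diff[OF 1(4)[OF y im] 2(4)[OF y im]] i 1(3)[OF y] 2(3)[OF y]
        by (simp add: do'_def last_i)
      thus ?thesis
        by (rule has_real_derivative_transform[rotated 2]) (use y i 1(1) 2(1) in \<open>auto simp: wo_def last_i\<close>)
    qed
  next
    fix i assume i: "i < m"
    hence im: "i < m + n" by simp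
    show "((\<lambda>y. we y $ i) \<longlongrightarrow> 0) at_top"
      using tendsto_diff[OF 1(7)[OF im] 2(7)[OF im]] i by (simp add: we_def first_i)
  next
    fix i assume i: "i < n"
    hence im: "m + i < m + n" by simp
    have "((\<lambda>y. w1 y $ (m + i) - w2 y $ (m + i)) \<longlongrightarrow> 0) at_top"
      using tendsto_diff[OF 1(7)[OF im] 2(7)[OF im]] by simp
    moreover have "eventually (\<lambda>y. w1 y $ (m + i) - w2 y $ (m + i) = wo y $ i) at_top"
      using eventually_ge_at_top[of "0::real"]
      by eventually_elim (use i 1(1) 2(1) in \<open>simp add: wo_def last_i\<close>)
    ultimately show "((\<lambda>y. wo y $ i) \<longlongrightarrow> 0) at_top" by (simp add: filterlim_cong)
  next
    have Gz: "Ge *\<^sub>v z1 \<in> carrier_vec m" "Ge *\<^sub>v z2 \<in> carrier_vec m" using Ge z1 z2 by auto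
    have "T *\<^sub>v wo 0 = T *\<^sub>v ((vec_last (w1 0) n + fo) - (vec_last (w2 0) n + fo))"
      by (rule arg_cong[of _ _ "\<lambda>u. T *\<^sub>v u"], rule eq_vecI) (use fo in \<open>auto simp: wo_def\<close>)
    also have "\<dots> = T *\<^sub>v (vec_last (w1 0) n + fo) - T *\<^sub>v (vec_last (w2 0) n + fo)"
      by (rule mult_minus_distrib_mat_vec[OF T_c(1)]) (use fo in auto)
    also have "\<dots> = - (b \<cdot>\<^sub>v (Mm\<^sup>T *\<^sub>v (vec_first (w1 0) m + (h + Ge *\<^sub>v z1)) - Mm\<^sup>T *\<^sub>v (vec_first (w2 0) m + (h + Ge *\<^sub>v z2))))"
      unfolding 1(8) 2(8) by (rule eq_vecI) (use Mm in \<open>auto simp: algebra_simps\<close>)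
    also have "Mm\<^sup>T *\<^sub>v (vec_first (w1 0) m + (h + Ge *\<^sub>v z1)) - Mm\<^sup>T *\<^sub>v (vec_first (w2 0) m + (h + Ge *\<^sub>v z2))
       = Mm\<^sup>T *\<^sub>v ((vec_first (w1 0) m + (h + Ge *\<^sub>v z1)) - (vec_first (w2 0) m + (h + Ge *\<^sub>v z2)))"
      by (rule mult_minus_distrib_mat_vec[OF MmT, symmetric]) (use h Gz in auto)
    also have "(vec_first (w1 0) m + (h + Ge *\<^sub>v z1)) - (vec_first (w2 0) m + (h + Ge *\<^sub>v z2)) = we 0 + Ge *\<^sub>v (z1 - z2)"
      unfolding mult_minus_distrib_mat_vec[OF Ge z1 z2]
      by (rule eq_vecI) (use h Gz carrier_matD[OF Ge] in \<open>auto simp: we_def simp del: index_mult_mat_vec\<close>)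
    finally show "T *\<^sub>v wo 0 = - (b \<cdot>\<^sub>v (Mm\<^sup>T *\<^sub>v (we 0 + Ge *\<^sub>v (z1 - z2))))" .
  qed (auto simp: we_def wo_def de_def do'_def)
  hence z: "z1 - z2 = 0\<^sub>v p" and w: "\<And>y. y \<ge> 0 \<Longrightarrow> we y = 0\<^sub>v m" "\<And>y. y \<ge> 0 \<Longrightarrow> wo y = 0\<^sub>v n" by auto
  have "w1 y = w2 y" for y
  proof (cases "y \<ge> 0")
    case True
    have "vec_first (w1 y) m = vec_first (w2 y) m"
      using vec_eq_if_minus_eq_0[OF first_c first_c] w(1)[OF True] by (simp add: we_def)
    moreover have "vec_last (w1 y) n = vec_last (w2 y) n"
      using vec_eq_if_minus_eq_0[OF last_c last_c] w(2)[OF True] by (simp add: wo_def)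
    ultimately show ?thesis
      using vec_first_last_append[OF 1(1)[OF True]] vec_first_last_append[OF 2(1)[OF True]] by metis
  next
    case False
    thus ?thesis using 1(2) 2(2) by simp
  qed
  thus ?thesis using vec_eq_if_minus_eq_0[OF z1 z2 z] by auto
qed

lemma solution_exists:
  assumes A: "A = four_block_mat (0\<^sub>m m m) Mm (Mm\<^sup>T) (0\<^sub>m n n)"
    and Q: "Q = four_block_mat Qe (0\<^sub>m m n) (0\<^sub>m n m) Qo"
    and TS: "T = Mm\<^sup>T * the (mat_inverse S) * Mm"
    and fo: "fo \<in> carrier_vec n" and h: "h \<in> carrier_vec m"
  obtains z w where "z \<in> carrier_vec p" "half_space_solution A Q Mm S b (h + Ge *\<^sub>v z) fo w"
proof -
  obtain E O' l where E: "E \<in> carrier_mat m n" and O': "O' \<in> carrier_mat n n" and l: "\<And>i. i < n \<Longrightarrow> l i > 0"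
    and m1: "Mm * O' * mat_diag n l = Qe * E" and m2: "Mm\<^sup>T * E * mat_diag n l = Qo * O'"
    and cok: "\<And>q. q \<in> carrier_vec n \<Longrightarrow> (T * O' + b \<cdot>\<^sub>m (Mm\<^sup>T * E))\<^sup>T *\<^sub>v q = 0\<^sub>v n \<Longrightarrow>
      (b \<cdot>\<^sub>m (Mm\<^sup>T * Ge))\<^sup>T *\<^sub>v q = 0\<^sub>v p \<Longrightarrow> q = 0\<^sub>v n"
    by (rule decaying_modes) (rule that; assumption)
  define g where "g = - (T *\<^sub>v fo) - b \<cdot>\<^sub>v (Mm\<^sup>T *\<^sub>v h)"
  have g: "g \<in> carrier_vec n" using T_c MmT fo h by (simp add: g_def)
  have Bc: "T * O' + b \<cdot>\<^sub>m (Mm\<^sup>T * E) \<in> carrier_mat n n" and Cc: "b \<cdot>\<^sub>m (Mm\<^sup>T * Ge) \<in> carrier_mat n p"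
    using T_c O' MmT E Ge by auto
  obtain c z where c: "c \<in> carrier_vec n" and z: "z \<in> carrier_vec p"
    and cz: "(T * O' + b \<cdot>\<^sub>m (Mm\<^sup>T * E)) *\<^sub>v c + (b \<cdot>\<^sub>m (Mm\<^sup>T * Ge)) *\<^sub>v z = g"
    by (rule surjective_if_trivial_cokernel[OF Bc Cc cok g]) (use that in auto)
  define a where "a y = Matrix.vec n (\<lambda>i. c $ i * exp (- l i * y))" for y
  define a' where "a' y = Matrix.vec n (\<lambda>i. - (l i * a y $ i))" for y
  have ac: "a y \<in> carrier_vec n" "a' y \<in> carrier_vec n" for y by (auto simp: a_def a'_def)
  have a'a: "a' y = - (mat_diag n l *\<^sub>v a y)" for y
    by (rule eq_vecI) (auto simp: a'_def mat_diag_def a_def scalar_prod_def if_distrib[of "\<lambda>x. x * _"] cong: if_cong)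
  have a0: "a 0 = c" by (rule eq_vecI) (use c in \<open>auto simp: a_def\<close>)
  have da: "((\<lambda>t. a t $ i) has_real_derivative a' y $ i) (at y within {0..})" if "i < n" for i y
    using that by (auto simp: a_def a'_def intro!: derivative_eq_intros)
  have lima: "((\<lambda>t. a t $ i) \<longlongrightarrow> 0) at_top" if i: "i < n" for i
  proof -
    have "((\<lambda>t. exp (- (l i * t))) \<longlongrightarrow> 0) at_top"
      by (rule filterlim_compose[OF exp_at_bot], rule filterlim_compose[OF filterlim_uminus_at_bot_at_top],
          rule filterlim_tendsto_pos_mult_at_top[OF tendsto_const l[OF i] filterlim_ident])
    thus ?thesis using i tendsto_mult_right_zero[of "\<lambda>t. exp (- (l i * t))" at_top "c $ i"] by (simp add: a_def)
  qed
  define w where "w = (\<lambda>y\<in>{0..}. (E *\<^sub>v a y) @\<^sub>v (O' *\<^sub>v a y))"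
  have wy: "w y = (E *\<^sub>v a y) @\<^sub>v (O' *\<^sub>v a y)" if "y \<ge> 0" for y using that by (simp add: w_def)
  have Ea: "E *\<^sub>v u \<in> carrier_vec m" and Oa: "O' *\<^sub>v u \<in> carrier_vec n" if "u \<in> carrier_vec n" for u
    using E O' that by auto
  have dims: "dim_row Mm = m" "dim_col Mm = n" using Mm by auto
  have comp1: "((E *\<^sub>v u) @\<^sub>v (O' *\<^sub>v u)) $ i = (if i < m then (E *\<^sub>v u) $ i else (O' *\<^sub>v u) $ (i - m))"
    if "i < m + n" for i u using that E O' by auto
  have "half_space_solution A Q Mm S b (h + Ge *\<^sub>v z) fo w"
    unfolding half_space_solution_def Let_def dims
  proof (intro conjI allI impI)
    show "w \<in> {0..} \<rightarrow>\<^sub>E carrier_vec (m + n)"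
      unfolding w_def using Ea[OF ac(1)] Oa[OF ac(1)] by (intro restrict_PiE_iff[THEN iffD2] ballI append_carrier_vec) auto
  next
    fix y :: real assume y: "0 \<le> y"
    show "\<exists>dw\<in>carrier_vec (m + n).
           (\<forall>i<m + n. ((\<lambda>t. w t $ i) has_real_derivative dw $ i) (at y within {0..})) \<and>
           A *\<^sub>v dw = - (Q *\<^sub>v w y)"
    proof (intro bexI conjI allI impI)
      show "(E *\<^sub>v a' y) @\<^sub>v (O' *\<^sub>v a' y) \<in> carrier_vec (m + n)"
        using Ea[OF ac(2)] Oa[OF ac(2)] by (intro append_carrier_vec)
      fix i assume i: "i < m + n"
      have "((\<lambda>t. ((E *\<^sub>v a t) @\<^sub>v (O' *\<^sub>v a t)) $ i) has_real_derivative ((E *\<^sub>v a' y) @\<^sub>v (O' *\<^sub>v a' y)) $ i)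
          (at y within {0..})"
      proof (cases "i < m")
        case True
        thus ?thesis unfolding comp1[OF i]
          using has_derivative_mult_mat_vec[OF E, of "{0..}" a y "a' y" i] ac da y by simp
      next
        case False
        thus ?thesis unfolding comp1[OF i]
          using has_derivative_mult_mat_vec[OF O', of "{0..}" a y "a' y" "i - m"] ac da y i by simp
      qed
      thus "((\<lambda>t. w t $ i) has_real_derivative ((E *\<^sub>v a' y) @\<^sub>v (O' *\<^sub>v a' y)) $ i) (at y within {0..})"
        by (rule has_real_derivative_transform[rotated 2]) (use y wy in auto)
    next
      have Da: "mat_diag n l *\<^sub>v a y \<in> carrier_vec n" using ac by (auto intro!: mult_mat_vec_carrier)
      have 1: "Mm *\<^sub>v (O' *\<^sub>v a' y) = - (Qe *\<^sub>v (E *\<^sub>v a y))"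
      proof -
        have "Mm *\<^sub>v (O' *\<^sub>v a' y) = - ((Mm * O') *\<^sub>v (mat_diag n l *\<^sub>v a y))"
          unfolding assoc_mult_mat_vec[OF Mm O' ac(2), symmetric] unfolding a'a
          by (rule mult_mat_uminus_vec[OF _ Da]) (use Mm O' in auto)
        also have "(Mm * O') *\<^sub>v (mat_diag n l *\<^sub>v a y) = (Qe * E) *\<^sub>v a y"
          unfolding m1[symmetric] using Mm O' ac by (intro assoc_mult_mat_vec[symmetric, of _ m n _ n]) auto
        also have "\<dots> = Qe *\<^sub>v (E *\<^sub>v a y)" by (rule assoc_mult_mat_vec[OF Qe_c(1) E ac(1)])
        finally show ?thesis .
      qed
      have 2: "Mm\<^sup>T *\<^sub>v (E *\<^sub>v a' y) = - (Qo *\<^sub>v (O' *\<^sub>v a y))"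
      proof -
        have "Mm\<^sup>T *\<^sub>v (E *\<^sub>v a' y) = - ((Mm\<^sup>T * E) *\<^sub>v (mat_diag n l *\<^sub>v a y))"
          unfolding assoc_mult_mat_vec[OF MmT E ac(2), symmetric] unfolding a'a
          by (rule mult_mat_uminus_vec[OF _ Da]) (use Mm E in auto)
        also have "(Mm\<^sup>T * E) *\<^sub>v (mat_diag n l *\<^sub>v a y) = (Qo * O') *\<^sub>v a y"
          unfolding m2[symmetric] using MmT E ac by (intro assoc_mult_mat_vec[symmetric, of _ n n _ n]) auto
        also have "\<dots> = Qo *\<^sub>v (O' *\<^sub>v a y)" by (rule assoc_mult_mat_vec[OF Qo_c(1) O' ac(1)])
        finally show ?thesis .
      qed
      have "A *\<^sub>v ((E *\<^sub>v a' y) @\<^sub>v (O' *\<^sub>v a' y)) = (0\<^sub>m m m *\<^sub>v (E *\<^sub>v a' y) + Mm *\<^sub>v (O' *\<^sub>v a' y))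
          @\<^sub>v (Mm\<^sup>T *\<^sub>v (E *\<^sub>v a' y) + 0\<^sub>m n n *\<^sub>v (O' *\<^sub>v a' y))"
        unfolding A by (rule four_block_mat_mult_vec) (use Mm Ea[OF ac(2)] Oa[OF ac(2)] in auto)
      also have "\<dots> = - ((Qe *\<^sub>v (E *\<^sub>v a y) + 0\<^sub>m m n *\<^sub>v (O' *\<^sub>v a y))
          @\<^sub>v (0\<^sub>m n m *\<^sub>v (E *\<^sub>v a y) + Qo *\<^sub>v (O' *\<^sub>v a y)))"
        unfolding 1 2 by (rule eq_vecI)
          (use Qe_c Qo_c E O' in \<open>auto simp: carrier_vecD[OF Ea[OF ac(1)]] carrier_vecD[OF Oa[OF ac(1)]]
              carrier_vecD[OF Ea[OF ac(2)]] carrier_vecD[OF Oa[OF ac(2)]] Ea ac Oa\<close>)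
      also have "\<dots> = - (Q *\<^sub>v w y)"
        unfolding Q wy[OF y] by (subst four_block_mat_mult_vec) (use Qe_c Qo_c Ea[OF ac(1)] Oa[OF ac(1)] in auto)
      finally show "A *\<^sub>v ((E *\<^sub>v a' y) @\<^sub>v (O' *\<^sub>v a' y)) = - (Q *\<^sub>v w y)" .
    qed
  next
    fix i assume i: "i < m + n"
    have "((\<lambda>t. ((E *\<^sub>v a t) @\<^sub>v (O' *\<^sub>v a t)) $ i) \<longlongrightarrow> 0) at_top"
    proof (cases "i < m")
      case True
      thus ?thesis unfolding comp1[OF i] using tendsto_mult_mat_vec_0[OF E, of a i] ac lima by simp
    next
      case False
      thus ?thesis unfolding comp1[OF i] using tendsto_mult_mat_vec_0[OF O', of a "i - m"] ac lima i by simp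
    qed
    moreover have "eventually (\<lambda>t. ((E *\<^sub>v a t) @\<^sub>v (O' *\<^sub>v a t)) $ i = w t $ i) at_top"
      using eventually_ge_at_top[of "0::real"] by eventually_elim (simp add: wy)
    ultimately show "((\<lambda>y. w y $ i) \<longlongrightarrow> 0) at_top" by (simp add: filterlim_cong)
  next
    have f: "vec_first (w 0) m = E *\<^sub>v c" "vec_last (w 0) n = O' *\<^sub>v c"
      using wy[of 0] a0 Ea[OF c] Oa[OF c]
        E O' by (auto simp: vec_first_def vec_last_def intro!: eq_vecI)
    have Gz: "Ge *\<^sub>v z \<in> carrier_vec m" using Ge z by simp
    have TOc: "T *\<^sub>v (O' *\<^sub>v c) \<in> carrier_vec n" "T *\<^sub>v fo \<in> carrier_vec n" "Mm\<^sup>T *\<^sub>v (E *\<^sub>v c) \<in> carrier_vec n"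
      "Mm\<^sup>T *\<^sub>v h \<in> carrier_vec n" "Mm\<^sup>T *\<^sub>v (Ge *\<^sub>v z) \<in> carrier_vec n"
      using T_c MmT Ea[OF c] Oa[OF c] fo h Gz by (auto intro!: mult_mat_vec_carrier)
    have smult: "(b \<cdot>\<^sub>m (B * C)) *\<^sub>v u = b \<cdot>\<^sub>v (B *\<^sub>v (C *\<^sub>v u))"
      if "B \<in> carrier_mat n r" "C \<in> carrier_mat r s" "u \<in> carrier_vec s" for B C :: "real mat" and u r s
      unfolding assoc_mult_mat_vec[OF that, symmetric] using that
      by (intro smult_mat_mult_vec) auto
    have "(T * O' + b \<cdot>\<^sub>m (Mm\<^sup>T * E)) *\<^sub>v c = (T * O') *\<^sub>v c + (b \<cdot>\<^sub>m (Mm\<^sup>T * E)) *\<^sub>v c"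
      using T_c O' MmT E c by (intro add_mult_distrib_mat_vec[of _ n n]) auto
    hence "T *\<^sub>v (O' *\<^sub>v c) + b \<cdot>\<^sub>v (Mm\<^sup>T *\<^sub>v (E *\<^sub>v c)) + b \<cdot>\<^sub>v (Mm\<^sup>T *\<^sub>v (Ge *\<^sub>v z)) = g"
      using cz assoc_mult_mat_vec[OF T_c(1) O' c] smult[OF MmT E c] smult[OF MmT Ge z] by simp
    hence key: "(T *\<^sub>v (O' *\<^sub>v c)) $ i + b * (Mm\<^sup>T *\<^sub>v (E *\<^sub>v c)) $ i + b * (Mm\<^sup>T *\<^sub>v (Ge *\<^sub>v z)) $ i
        = - (T *\<^sub>v fo) $ i - b * (Mm\<^sup>T *\<^sub>v h) $ i" if "i < n" for i
      using that TOc carrier_matD[OF Mm] carrier_matD[OF T_c(1)] unfolding g_def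
      by (auto simp: carrier_vecD vec_eq_iff simp del: index_mult_mat_vec)
    have "T *\<^sub>v (O' *\<^sub>v c + fo) = T *\<^sub>v (O' *\<^sub>v c) + T *\<^sub>v fo"
      by (rule mult_add_distrib_mat_vec[OF T_c(1) Oa[OF c] fo])
    also have "\<dots> = - (b \<cdot>\<^sub>v (Mm\<^sup>T *\<^sub>v (E *\<^sub>v c) + (Mm\<^sup>T *\<^sub>v h + Mm\<^sup>T *\<^sub>v (Ge *\<^sub>v z))))"
    proof (rule eq_vecI)
      fix i assume "i < dim_vec (- (b \<cdot>\<^sub>v (Mm\<^sup>T *\<^sub>v (E *\<^sub>v c) + (Mm\<^sup>T *\<^sub>v h + Mm\<^sup>T *\<^sub>v (Ge *\<^sub>v z)))))"
      hence i: "i < n" using carrier_matD[OF Mm] by simp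
      show "(T *\<^sub>v (O' *\<^sub>v c) + T *\<^sub>v fo) $ i = (- (b \<cdot>\<^sub>v (Mm\<^sup>T *\<^sub>v (E *\<^sub>v c) + (Mm\<^sup>T *\<^sub>v h + Mm\<^sup>T *\<^sub>v (Ge *\<^sub>v z))))) $ i"
        using key[OF i] i
        by (simp add: carrier_vecD[OF TOc(1)] carrier_vecD[OF TOc(2)] carrier_vecD[OF TOc(3)] carrier_vecD[OF TOc(4)]
            carrier_vecD[OF TOc(5)] algebra_simps del: index_mult_mat_vec dim_mult_mat_vec)
    qed (use carrier_matD[OF T_c(1)] carrier_matD[OF Mm] in simp)
    also have "Mm\<^sup>T *\<^sub>v h + Mm\<^sup>T *\<^sub>v (Ge *\<^sub>v z) = Mm\<^sup>T *\<^sub>v (h + Ge *\<^sub>v z)"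
      by (rule mult_add_distrib_mat_vec[OF MmT h Gz, symmetric])
    also have "Mm\<^sup>T *\<^sub>v (E *\<^sub>v c) + Mm\<^sup>T *\<^sub>v (h + Ge *\<^sub>v z) = Mm\<^sup>T *\<^sub>v (E *\<^sub>v c + (h + Ge *\<^sub>v z))"
      by (rule mult_add_distrib_mat_vec[OF MmT Ea[OF c], symmetric]) (use h Gz in simp)
    finally show "(Mm\<^sup>T * the (mat_inverse S) * Mm) *\<^sub>v (vec_last (w 0) n + fo)
        = - (b \<cdot>\<^sub>v (Mm\<^sup>T *\<^sub>v (vec_first (w 0) m + (h + Ge *\<^sub>v z))))"
      unfolding f TS[symmetric] .
  qed
  thus ?thesis using that z by blast
qed

theorem unique_solvability:
  assumes A: "A = four_block_mat (0\<^sub>m m m) Mm (Mm\<^sup>T) (0\<^sub>m n n)"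
    and Q: "Q = four_block_mat Qe (0\<^sub>m m n) (0\<^sub>m n m) Qo"
    and TS: "T = Mm\<^sup>T * the (mat_inverse S) * Mm"
    and fo: "fo \<in> carrier_vec n" and h: "h \<in> carrier_vec m"
  shows "\<exists>!z. z \<in> carrier_vec p \<and> (\<exists>!w. half_space_solution A Q Mm S b (h + Ge *\<^sub>v z) fo w)"
proof -
  obtain z w where zw: "z \<in> carrier_vec p" "half_space_solution A Q Mm S b (h + Ge *\<^sub>v z) fo w"
    using solution_exists[OF assms] by blast
  note u = solution_unique[OF assms]
  show ?thesis
  proof (rule ex1I[of _ z], intro conjI zw(1) ex1I[of _ w] zw(2))
    show "w' = w" if "half_space_solution A Q Mm S b (h + Ge *\<^sub>v z) fo w'" for w'
      using u[OF zw(1) zw(1) that zw(2)] by blast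
    show "z' = z" if "z' \<in> carrier_vec p \<and> (\<exists>!w. half_space_solution A Q Mm S b (h + Ge *\<^sub>v z') fo w)" for z'
      using that u[OF _ zw(1) _ zw(2)] by blast
  qed
qed

end

section \<open>Hermite polynomials in one variable\<close>

text \<open>
The orthonormal (probabilists') Hermite polynomials.
\<close>

fun hpoly :: "nat \<Rightarrow> real poly" where
  "hpoly 0 = 1"
| "hpoly (Suc n) = Polynomial.smult (1 / sqrt (real (Suc n))) ([:0, 1:] * hpoly n - pderiv (hpoly n))"

lemma pderiv_hpoly: "pderiv (hpoly n) = Polynomial.smult (sqrt (real n)) (hpoly (n - 1))"
proof (induction n)
  case (Suc n)
  have "[:0, 1:] * pderiv (hpoly n) - pderiv (pderiv (hpoly n)) = Polynomial.smult (real n) (hpoly n)"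
  proof (cases n)
    case (Suc m)
    have "[:0, 1:] * pderiv (hpoly n) - pderiv (pderiv (hpoly n))
        = Polynomial.smult (sqrt (real n)) ([:0, 1:] * hpoly m - pderiv (hpoly m))"
      using Suc.IH by (simp add: Suc pderiv_smult smult_diff_right del: hpoly.simps)
    also have "\<dots> = Polynomial.smult (real n) (hpoly n)"
      by (simp add: Suc real_div_sqrt del: of_nat_Suc)
    finally show ?thesis .
  qed simp
  hence "hpoly n + [:0, 1:] * pderiv (hpoly n) - pderiv (pderiv (hpoly n)) = Polynomial.smult (real (Suc n)) (hpoly n)"
    by (simp add: smult_add_left algebra_simps)
  moreover have "pderiv (hpoly (Suc n)) = Polynomial.smult (1 / sqrt (real (Suc n)))
      (hpoly n + [:0, 1:] * pderiv (hpoly n) - pderiv (pderiv (hpoly n)))"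
    by (simp add: pderiv_smult pderiv_diff pderiv_mult pderiv_pCons algebra_simps)
  ultimately have "pderiv (hpoly (Suc n)) = Polynomial.smult (1 / sqrt (real (Suc n)) * real (Suc n)) (hpoly n)"
    by (simp del: hpoly.simps)
  also have "1 / sqrt (real (Suc n)) * real (Suc n) = sqrt (real (Suc n))"
    by (simp add: real_div_sqrt)
  finally show ?case by simp
qed simp

lemma x_mult_hpoly:
  "[:0, 1:] * hpoly n = Polynomial.smult (sqrt (real (Suc n))) (hpoly (Suc n)) + Polynomial.smult (sqrt (real n)) (hpoly (n - 1))"
  using pderiv_hpoly[of n] by simp

lemma poly_hpoly_Suc:
  "t * poly (hpoly n) t = sqrt (real (Suc n)) * poly (hpoly (Suc n)) t + sqrt (real n) * poly (hpoly (n - 1)) t"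
  using arg_cong[OF x_mult_hpoly[of n], of "\<lambda>p. poly p t"] by (simp del: hpoly.simps)

lemma hpoly_minus: "poly (hpoly n) (- t) = (- 1) ^ n * poly (hpoly n) t"
proof (induction n rule: less_induct)
  case (less n)
  show ?case
  proof (cases n)
    case (Suc m)
    have 1: "poly (hpoly m) (- t) = (- 1) ^ m * poly (hpoly m) t" using less[of m] Suc by simp
    have 2: "sqrt (real m) * poly (hpoly (m - 1)) (- t) = - ((- 1) ^ m * (sqrt (real m) * poly (hpoly (m - 1)) t))"
      using less[of "m - 1"] Suc by (cases m) (simp_all del: hpoly.simps(2))
    have s: "sqrt (real n) * poly (hpoly n) u = u * poly (hpoly m) u - sqrt (real m) * poly (hpoly (m - 1)) u" for u
      using poly_hpoly_Suc[of u m] by (simp add: Suc del: hpoly.simps)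
    have "sqrt (real n) * poly (hpoly n) (- t) = sqrt (real n) * ((- 1) ^ n * poly (hpoly n) t)"
      unfolding s 1 2 mult.left_commute[of "sqrt (real n)"] unfolding s by (simp add: Suc algebra_simps del: hpoly.simps)
    moreover have "sqrt (real n) \<noteq> 0" using Suc by simp
    ultimately show ?thesis by (metis mult_left_cancel)
  qed simp
qed

abbreviation gauss1 :: "real \<Rightarrow> real" where "gauss1 \<equiv> std_normal_density"

lemma gauss1_pos: "gauss1 t > 0" by (rule normal_density_pos) simp

lemma deriv_gauss1_hpoly:
  "((\<lambda>t. gauss1 t * poly (hpoly n) t) has_real_derivative
     - (sqrt (real (Suc n)) * (gauss1 t * poly (hpoly (Suc n)) t))) (at t)"
proof -
  have "(gauss1 has_real_derivative - t * gauss1 t) (at t)"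
    unfolding std_normal_density_def
    by (auto intro!: derivative_eq_intros simp: field_simps power2_eq_square)
  hence "((\<lambda>t. gauss1 t * poly (hpoly n) t) has_real_derivative
     - t * gauss1 t * poly (hpoly n) t + poly (pderiv (hpoly n)) t * gauss1 t) (at t)"
    by (intro DERIV_mult poly_DERIV)
  also have "- t * gauss1 t * poly (hpoly n) t + poly (pderiv (hpoly n)) t * gauss1 t
     = - (sqrt (real (Suc n)) * (gauss1 t * poly (hpoly (Suc n)) t))"
  proof -
    have "t * gauss1 t * poly (hpoly n) t = gauss1 t * (t * poly (hpoly n) t)" by (simp add: mult_ac)
    also have "\<dots> = sqrt (real (Suc n)) * (gauss1 t * poly (hpoly (Suc n)) t)
        + sqrt (real n) * poly (hpoly (n - 1)) t * gauss1 t"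
      by (subst poly_hpoly_Suc) (simp only: distrib_left mult_ac)
    finally show ?thesis by (simp add: pderiv_hpoly del: hpoly.simps)
  qed
  finally show ?thesis .
qed

lemma deriv_power_gauss1:
  "(deriv ^^ n) gauss1 = (\<lambda>t. (- 1) ^ n * sqrt (fact n) * (gauss1 t * poly (hpoly n) t))"
proof (induction n)
  case (Suc n)
  show ?case
  proof
    fix t
    have "(deriv ^^ Suc n) gauss1 t = deriv (\<lambda>t. (- 1) ^ n * sqrt (fact n) * (gauss1 t * poly (hpoly n) t)) t"
      by (simp add: Suc)
    also have "\<dots> = (- 1) ^ n * sqrt (fact n) * - (sqrt (real (Suc n)) * (gauss1 t * poly (hpoly (Suc n)) t))"
      by (intro DERIV_imp_deriv DERIV_cmult deriv_gauss1_hpoly)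
    also have "\<dots> = (- 1) ^ Suc n * sqrt (fact (Suc n)) * (gauss1 t * poly (hpoly (Suc n)) t)"
      by (simp add: real_sqrt_mult fact_Suc del: hpoly.simps of_nat_Suc)
    finally show "(deriv ^^ Suc n) gauss1 t = (- 1) ^ Suc n * sqrt (fact (Suc n)) * (gauss1 t * poly (hpoly (Suc n)) t)" .
  qed
qed simp

lemma integrable_gauss1_poly: "integrable lborel (\<lambda>t. gauss1 t * poly p t)"
proof -
  have "integrable lborel (\<lambda>t. \<Sum>i\<le>Polynomial.degree p. Polynomial.coeff p i * (gauss1 t * t ^ i))"
    by (intro Bochner_Integration.integrable_sum integrable_mult_right integrable_std_normal_moment)
  thus ?thesis by (simp add: poly_altdef sum_distrib_left algebra_simps)
qed

lemma integral_gauss1_moment: "(LINT t|lborel. gauss1 t * t ^ Suc (Suc k)) = real (Suc k) * (LINT t|lborel. gauss1 t * t ^ k)"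
proof (cases "even k")
  case True
  then obtain j where k: "k = 2 * j" by blast
  have "(LINT t|lborel. gauss1 t * t ^ (2 * Suc j)) = real (Suc k) * (LINT t|lborel. gauss1 t * t ^ (2 * j))"
  proof -
    have 1: "fact (2 * Suc j) = 2 * real (Suc j) * real (Suc (2 * j)) * fact (2 * j)"
      by (simp add: algebra_simps)
    have 2: "(2::real) ^ Suc j * fact (Suc j) = 2 * real (Suc j) * (2 ^ j * fact j)"
      by (simp add: fact_Suc)
    show ?thesis
      unfolding integral_std_normal_moment_even k 1 2 by (simp del: of_nat_Suc)
  qed
  thus ?thesis by (simp add: k)
next
  case False
  then obtain j where k: "k = 2 * j + 1" using oddE by blast
  show ?thesis
    using integral_std_normal_moment_odd[of j] integral_std_normal_moment_odd[of "Suc j"] by (simp add: k)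
qed

lemma pderiv_sum: "pderiv (sum f A) = (\<Sum>i\<in>A. pderiv (f i))"
  by (induction A rule: infinite_finite_induct) (auto simp: pderiv_add)

text \<open>
Gaussian integration by parts. For monomials it is the recursion of the Gaussian moments, which
avoids a discussion of boundary terms.
\<close>

lemma gauss1_moment_pderiv:
  "(LINT t|lborel. gauss1 t * poly ([:0, 1:] * p) t) = (LINT t|lborel. gauss1 t * poly (pderiv p) t)"
proof -
  define L where "L p = (LINT t|lborel. gauss1 t * poly p t)" for p
  have add: "L (p + q) = L p + L q" for p q
    unfolding L_def by (simp add: distrib_left integrable_gauss1_poly)
  have smu: "L (Polynomial.smult c p) = c * L p" for c p
    unfolding L_def by (simp add: mult.left_commute)
  have L0: "L 0 = 0" by (simp add: L_def)
  have sum: "L (sum f A) = (\<Sum>i\<in>A. L (f i))" for f :: "nat \<Rightarrow> real poly" and A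
    by (induction A rule: infinite_finite_induct) (auto simp: add L0)
  have mon: "L ([:0, 1:] * Polynomial.monom 1 i) = L (pderiv (Polynomial.monom 1 i))" for i
  proof (cases i)
    case 0
    have "L ([:0, 1:]) = 0" using integral_std_normal_moment_odd[of 0] by (simp add: L_def)
    thus ?thesis using 0 by (simp add: L0 pderiv_monom monom_0)
  next
    case (Suc k)
    have "[:0, 1:] * Polynomial.monom (1::real) i = Polynomial.monom 1 (Suc (Suc k))" by (simp add: Suc monom_Suc)
    moreover have "pderiv (Polynomial.monom (1::real) i) = Polynomial.smult (real (Suc k)) (Polynomial.monom 1 k)"
      by (simp add: Suc pderiv_monom smult_monom)
    ultimately show ?thesis
      using integral_gauss1_moment[of k] smu[of "real (Suc k)" "Polynomial.monom 1 k"] by (simp add: L_def poly_monom)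
  qed
  have p: "p = (\<Sum>i\<le>Polynomial.degree p. Polynomial.smult (Polynomial.coeff p i) (Polynomial.monom 1 i))"
    by (simp add: smult_monom poly_as_sum_of_monoms)
  have "L ([:0, 1:] * p) = (\<Sum>i\<le>Polynomial.degree p. Polynomial.coeff p i * L ([:0, 1:] * Polynomial.monom 1 i))"
    by (subst p) (simp only: sum_distrib_left sum mult_smult_right smu)
  also have "\<dots> = (\<Sum>i\<le>Polynomial.degree p. Polynomial.coeff p i * L (pderiv (Polynomial.monom 1 i)))" by (simp only: mon)
  also have "L (pderiv p) = (\<Sum>i\<le>Polynomial.degree p. Polynomial.coeff p i * L (pderiv (Polynomial.monom 1 i)))"
    by (subst p) (simp only: pderiv_sum pderiv_smult sum smu)
  hence "(\<Sum>i\<le>Polynomial.degree p. Polynomial.coeff p i * L (pderiv (Polynomial.monom 1 i))) = L (pderiv p)" ..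
  finally show ?thesis by (simp add: L_def)
qed

text \<open>
Integration by parts moves one degree from the first to the second factor:
\<open>sqrt (m + 1) L(h\<^sub>m\<^sub>+\<^sub>1 h\<^sub>n) = sqrt n L(h\<^sub>m h\<^sub>n\<^sub>-\<^sub>1)\<close>, where \<open>L\<close> is the Gaussian mean.
\<close>

lemma hpoly_orthonormal:
  "(LINT t|lborel. gauss1 t * (poly (hpoly m) t * poly (hpoly n) t)) = of_bool (m = n)"
proof -
  define L where "L p = (LINT t|lborel. gauss1 t * poly p t)" for p
  have add: "L (p + q) = L p + L q" for p q
    unfolding L_def by (simp add: distrib_left integrable_gauss1_poly)
  have diff: "L (p - q) = L p - L q" for p q
    unfolding L_def by (simp add: right_diff_distrib integrable_gauss1_poly)
  have smu: "L (Polynomial.smult c p) = c * L p" for c p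
    unfolding L_def by (simp add: mult.left_commute)
  have ibp: "L ([:0, 1:] * p) = L (pderiv p)" for p
    using gauss1_moment_pderiv[of p] by (simp add: L_def)
  have rec: "sqrt (real (Suc m)) * L (hpoly (Suc m) * hpoly n) = sqrt (real n) * L (hpoly m * hpoly (n - 1))" for m n
  proof -
    have "sqrt (real (Suc m)) * L (hpoly (Suc m) * hpoly n)
        = L (Polynomial.smult (sqrt (real (Suc m))) (hpoly (Suc m)) * hpoly n)" by (simp only: smu mult_smult_left)
    also have "Polynomial.smult (sqrt (real (Suc m))) (hpoly (Suc m)) = [:0, 1:] * hpoly m - pderiv (hpoly m)"
      by simp
    also have "L (([:0, 1:] * hpoly m - pderiv (hpoly m)) * hpoly n)
       = L ([:0, 1:] * (hpoly m * hpoly n)) - L (pderiv (hpoly m) * hpoly n)"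
      by (simp only: left_diff_distrib diff mult.assoc)
    also have "\<dots> = L (hpoly m * pderiv (hpoly n))"
      by (simp only: ibp pderiv_mult add) (simp add: mult.commute)
    also have "\<dots> = sqrt (real n) * L (hpoly m * hpoly (n - 1))"
      by (simp only: pderiv_hpoly mult_smult_right smu)
    finally show ?thesis .
  qed
  have "L (hpoly m * hpoly n) = of_bool (m = n)"
  proof (induction m arbitrary: n)
    case 0
    show ?case
    proof (cases n)
      case 0
      thus ?thesis by (simp add: L_def)
    next
      case (Suc k)
      have "sqrt (real (Suc k)) * L (hpoly (Suc k) * hpoly 0) = 0" using rec[of k 0] by simp
      hence "L (hpoly (Suc k) * hpoly 0) = 0" by (simp del: hpoly.simps)
      thus ?thesis using Suc by (simp add: mult.commute del: hpoly.simps)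
    qed
  next
    case (Suc m)
    have "sqrt (real (Suc m)) * L (hpoly (Suc m) * hpoly n) = sqrt (real n) * of_bool (m = n - 1)"
      using rec[of m n] Suc by simp
    thus ?case by (cases n) (auto simp del: hpoly.simps split: if_splits)
  qed
  thus ?thesis by (simp add: L_def)
qed

lemma hpoly_orthonormal': "(LINT t|lborel. gauss1 t * poly (hpoly m * hpoly n) t) = of_bool (m = n)"
  using hpoly_orthonormal[of m n] by simp

lemma integrable_gauss1_abs_poly: "integrable lborel (\<lambda>t. \<bar>t\<bar> * (gauss1 t * poly p t))"
proof (rule Bochner_Integration.integrable_bound[OF integrable_gauss1_poly[of "[:0, 1:] * p"]])
  show "AE t in lborel. norm (\<bar>t\<bar> * (gauss1 t * poly p t)) \<le> norm (gauss1 t * poly ([:0, 1:] * p) t)"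
    by (intro AE_I2) (simp add: abs_mult mult_ac)
qed (measurable, auto intro!: borel_measurable_continuous_onI continuous_intros)

lemma flux1: "(LINT t|lborel. t * (gauss1 t * (poly (hpoly m) t * poly (hpoly n) t)))
   = of_bool (n = Suc m) * sqrt (real (Suc m)) + of_bool (m = Suc n) * sqrt (real m)"
proof -
  have "(LINT t|lborel. t * (gauss1 t * (poly (hpoly m) t * poly (hpoly n) t)))
    = (LINT t|lborel. sqrt (real (Suc m)) * (gauss1 t * poly (hpoly (Suc m) * hpoly n) t)
        + sqrt (real m) * (gauss1 t * poly (hpoly (m - 1) * hpoly n) t))"
  proof (rule Bochner_Integration.integral_cong[OF refl])
    fix t
    have "t * (gauss1 t * (poly (hpoly m) t * poly (hpoly n) t)) = (t * poly (hpoly m) t) * (gauss1 t * poly (hpoly n) t)"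
      by (simp add: mult_ac)
    thus "t * (gauss1 t * (poly (hpoly m) t * poly (hpoly n) t)) =
       sqrt (real (Suc m)) * (gauss1 t * poly (hpoly (Suc m) * hpoly n) t)
        + sqrt (real m) * (gauss1 t * poly (hpoly (m - 1) * hpoly n) t)"
      unfolding poly_hpoly_Suc by (simp add: algebra_simps del: hpoly.simps)
  qed
  also have "\<dots> = sqrt (real (Suc m)) * of_bool (Suc m = n) + sqrt (real m) * of_bool (m - 1 = n)"
    by (subst Bochner_Integration.integral_add)
       (simp_all only: integrable_gauss1_poly integrable_mult_right integral_mult_right_zero hpoly_orthonormal')
  finally show ?thesis by (cases m) auto
qed


section \<open>Hermite functions in several variables\<close>

lemma Basis_vec_real: "(Basis :: (real ^ 'd::finite) set) = range (\<lambda>i. axis i 1)"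
  by (auto simp: Basis_vec_def)

lemma prod_Basis_vec: "(\<Prod>b\<in>(Basis :: (real ^ 'd::finite) set). F b) = (\<Prod>i\<in>UNIV. F (axis i 1))"
  unfolding Basis_vec_real by (subst prod.reindex) (auto simp: inj_on_def axis_eq_axis)

lemma lborel_vec_prod:
  fixes f :: "'d::finite \<Rightarrow> real \<Rightarrow> real"
  assumes f: "\<And>i. integrable lborel (f i)"
  shows "integrable lborel (\<lambda>\<xi>::real ^ 'd. \<Prod>i\<in>UNIV. f i (vec_nth \<xi> i))"
    and "(LINT \<xi>|lborel. (\<Prod>i\<in>UNIV. f i (vec_nth (\<xi>::real ^ 'd) i))) = (\<Prod>i\<in>UNIV. (LINT t|lborel. f i t))"
proof -
  interpret product_sigma_finite "\<lambda>_ :: real ^ 'd. lborel :: real measure" ..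
  define g where "g b = f (SOME i. b = axis i 1)" for b :: "real ^ 'd"
  have g: "g (axis i 1) = f i" for i
    unfolding g_def by (rule arg_cong[of _ _ f], rule some_equality) (auto simp: axis_eq_axis)
  have gi: "integrable lborel (g b)" if "b \<in> Basis" for b using that f g by (auto simp: Basis_vec_real)
  have bm: "g b \<in> borel_measurable borel" if "b \<in> Basis" for b
    using borel_measurable_integrable[OF gi[OF that]] by simp
  have e: "(\<Prod>i\<in>UNIV. f i (vec_nth \<xi> i)) = (\<Prod>b\<in>Basis. g b (inner \<xi> b))" for \<xi> :: "real ^ 'd"
    unfolding prod_Basis_vec g by (simp add: inner_axis)
  let ?T = "\<lambda>x::(real ^ 'd \<Rightarrow> real). \<Sum>b\<in>Basis. x b *\<^sub>R b"
  have T: "?T \<in> measurable (\<Pi>\<^sub>M b\<in>Basis. lborel) borel" by measurable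
  have me: "(\<lambda>\<xi>::real ^ 'd. \<Prod>b\<in>Basis. g b (inner \<xi> b)) \<in> borel_measurable borel"
    by (intro borel_measurable_prod measurable_compose[OF _ bm]) auto
  have c: "(\<Prod>b\<in>Basis. g b (inner (?T x) b)) = (\<Prod>b\<in>Basis. g b (x b))" for x
    by (intro prod.cong refl) (simp add: inner_sum_left_Basis)
  have "integrable (\<Pi>\<^sub>M b\<in>Basis. lborel) (\<lambda>x. \<Prod>b\<in>Basis. g b (x b))"
    by (rule product_integrable_prod) (use gi in auto)
  hence "integrable (distr (\<Pi>\<^sub>M b\<in>Basis. lborel) borel ?T) (\<lambda>\<xi>. \<Prod>b\<in>Basis. g b (inner \<xi> b))"
    by (subst integrable_distr_eq[OF T me]) (simp only: c)
  thus "integrable lborel (\<lambda>\<xi>::real ^ 'd. \<Prod>i\<in>UNIV. f i (vec_nth \<xi> i))"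
    unfolding e lborel_eq[where 'a = "real ^ 'd"] .
  have "(LINT \<xi>|distr (\<Pi>\<^sub>M b\<in>Basis. lborel) borel ?T. (\<Prod>b\<in>Basis. g b (inner \<xi> b)))
     = (\<Prod>b\<in>Basis. (LINT t|lborel. g b t))"
    unfolding integral_distr[OF T me] c by (rule product_integral_prod) (use gi in auto)
  thus "(LINT \<xi>|lborel. (\<Prod>i\<in>UNIV. f i (vec_nth (\<xi>::real ^ 'd) i))) = (\<Prod>i\<in>UNIV. (LINT t|lborel. f i t))"
    unfolding e lborel_eq[where 'a = "real ^ 'd"] prod_Basis_vec g .
qed

lemma gauss_prod: "gauss \<xi> = (\<Prod>i\<in>UNIV. gauss1 (vec_nth (\<xi> :: real ^ 'd::finite) i))"
proof -
  have "(\<Prod>i\<in>UNIV. gauss1 (vec_nth \<xi> i)) = (1 / sqrt (2 * pi)) ^ CARD('d) * exp (\<Sum>i\<in>UNIV. - (vec_nth \<xi> i)\<^sup>2 / 2)"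
    by (simp add: std_normal_density_def prod.distrib exp_sum prod_dividef power_divide)
  also have "(\<Sum>i\<in>UNIV. - (vec_nth \<xi> i)\<^sup>2 / 2) = - (norm \<xi>)\<^sup>2 / 2"
    by (simp add: norm_vec_def L2_set_def sum_nonneg sum_negf sum_divide_distrib[symmetric])
  also have "(1 / sqrt (2 * pi)) ^ CARD('d) = (2 * pi) powr (- real CARD('d) / 2)"
  proof -
    have "1 / sqrt (2 * pi) = (2 * pi) powr (- 1 / 2)"
      by (simp add: powr_half_sqrt[symmetric] powr_minus_divide)
    hence "(1 / sqrt (2 * pi)) ^ CARD('d) = ((2 * pi) powr (- 1 / 2)) powr real CARD('d)"
      by (simp add: powr_realpow)
    thus ?thesis by (simp add: powr_powr)
  qed
  finally show ?thesis by (simp add: gauss_def)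
qed

lemma gauss_pos: "gauss \<xi> > 0"
  unfolding gauss_prod by (intro prod_pos) (auto intro: gauss1_pos)

lemma ex_list_with_counts: "\<exists>is. \<forall>i :: 'd::finite. count_list is i = f i"
proof -
  have ex: "\<exists>is. \<forall>i. count_list is i = (if i \<in> A then f i else 0)" if "finite A" for A :: "'d set"
    using that
  proof induction
    case empty
    show ?case by (rule exI[of _ "[]"]) simp
  next
    case (insert a A)
    then obtain xs where xs: "\<forall>i. count_list xs i = (if i \<in> A then f i else 0)" by blast
    have c: "count_list (replicate k a) i = (if i = a then k else 0)" for k i
      by (induction k) auto
    show ?case
      by (rule exI[of _ "replicate (f a) a @ xs"]) (use insert xs in \<open>auto simp: c\<close>)
  qed
  show ?thesis using ex[of UNIV] by simp
qed

lemma sqrt_prod: "sqrt (prod f A) = (\<Prod>i\<in>A. sqrt (f i))"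
  by (induction A rule: infinite_finite_induct) (auto simp: real_sqrt_mult)

text \<open>
On a product each partial derivative acts on one factor, so only the number of occurrences of each
direction matters and the order chosen in the definition of \<open>mi_deriv\<close> is irrelevant.
\<close>

lemma foldr_partial_deriv_gauss:
  "foldr partial_deriv is gauss = (\<lambda>\<xi> :: real ^ 'd::finite. \<Prod>i\<in>UNIV. (deriv ^^ count_list is i) gauss1 (vec_nth \<xi> i))"
proof (induction "is")
  case Nil
  show ?case by (simp add: gauss_prod)
next
  case (Cons j "is")
  show ?case
  proof
    fix \<xi> :: "real ^ 'd"
    define F where "F i = (deriv ^^ count_list is i) gauss1" for i
    have dF: "(F j has_real_derivative deriv (F j) t) (at t)" for t
    proof -
      have "F j field_differentiable at t"
        unfolding F_def deriv_power_gauss1 field_differentiable_def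
        by (rule exI) (rule DERIV_cmult[OF deriv_gauss1_hpoly])
      thus ?thesis by (simp add: DERIV_deriv_iff_field_differentiable)
    qed
    have split: "(\<Prod>i\<in>UNIV. G i) = G j * (\<Prod>i\<in>UNIV - {j}. G i)" for G :: "'d \<Rightarrow> real"
      by (rule prod.remove) auto
    have "((\<lambda>t. F j (vec_nth \<xi> j + t)) has_real_derivative deriv (F j) (vec_nth \<xi> j)) (at 0)"
      using DERIV_shift[of "F j" "deriv (F j) (vec_nth \<xi> j)" 0 "vec_nth \<xi> j"] dF by (simp add: add.commute)
    hence "((\<lambda>t. F j (vec_nth \<xi> j + t) * (\<Prod>i\<in>UNIV - {j}. F i (vec_nth \<xi> i))) has_real_derivative
        deriv (F j) (vec_nth \<xi> j) * (\<Prod>i\<in>UNIV - {j}. F i (vec_nth \<xi> i))) (at 0)"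
      by (rule DERIV_cmult_right)
    also have "(\<lambda>t. F j (vec_nth \<xi> j + t) * (\<Prod>i\<in>UNIV - {j}. F i (vec_nth \<xi> i)))
        = (\<lambda>t. \<Prod>i\<in>UNIV. F i (vec_nth (\<xi> + t *\<^sub>R axis j 1) i))"
      by (rule ext, subst split) (auto simp: axis_def intro!: prod.cong)
    finally have "deriv (\<lambda>t. \<Prod>i\<in>UNIV. F i (vec_nth (\<xi> + t *\<^sub>R axis j 1) i)) 0
       = deriv (F j) (vec_nth \<xi> j) * (\<Prod>i\<in>UNIV - {j}. F i (vec_nth \<xi> i))"
      by (rule DERIV_imp_deriv)
    moreover have "(\<Prod>i\<in>UNIV. (deriv ^^ count_list (j # is) i) gauss1 (vec_nth \<xi> i))
       = deriv (F j) (vec_nth \<xi> j) * (\<Prod>i\<in>UNIV - {j}. F i (vec_nth \<xi> i))"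
      by (subst split) (auto simp: F_def intro!: prod.cong)
    ultimately show "foldr partial_deriv (j # is) gauss \<xi> = (\<Prod>i\<in>UNIV. (deriv ^^ count_list (j # is) i) gauss1 (vec_nth \<xi> i))"
      by (simp add: Cons.IH partial_deriv_def F_def)
  qed
qed

theorem hermite_prod: "hermite \<alpha> \<xi> = (\<Prod>i\<in>UNIV. poly (hpoly (vec_nth \<alpha> i)) (vec_nth (\<xi> :: real ^ 'd::finite) i))"
proof -
  define L where "L = (SOME is. \<forall>i. count_list is i = vec_nth \<alpha> i)"
  have L: "count_list L i = vec_nth \<alpha> i" for i
    unfolding L_def using someI_ex[OF ex_list_with_counts[of "vec_nth \<alpha>"]] by blast
  have "mi_deriv \<alpha> gauss \<xi> = (\<Prod>i\<in>UNIV. (- 1) ^ vec_nth \<alpha> i * sqrt (fact (vec_nth \<alpha> i)) *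
      (gauss1 (vec_nth \<xi> i) * poly (hpoly (vec_nth \<alpha> i)) (vec_nth \<xi> i)))"
    unfolding mi_deriv_def L_def[symmetric] foldr_partial_deriv_gauss L deriv_power_gauss1 ..
  also have "\<dots> = (- 1) ^ mi_abs \<alpha> * sqrt (mi_fact \<alpha>) * (gauss \<xi> * (\<Prod>i\<in>UNIV. poly (hpoly (vec_nth \<alpha> i)) (vec_nth \<xi> i)))"
    by (simp add: prod.distrib gauss_prod mi_abs_def mi_fact_def power_sum sqrt_prod)
  finally have e: "mi_deriv \<alpha> gauss \<xi> = \<dots>" .
  have f: "sqrt (mi_fact \<alpha>) > 0" by (auto simp: mi_fact_def intro!: prod_pos)
  have "hermite \<alpha> \<xi> = ((- 1) ^ mi_abs \<alpha> * (- 1) ^ mi_abs \<alpha>) * (sqrt (mi_fact \<alpha>) / sqrt (mi_fact \<alpha>))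
      * (inverse (gauss \<xi>) * gauss \<xi>) * (\<Prod>i\<in>UNIV. poly (hpoly (vec_nth \<alpha> i)) (vec_nth \<xi> i))"
    unfolding hermite_def e by simp
  also have "\<dots> = (\<Prod>i\<in>UNIV. poly (hpoly (vec_nth \<alpha> i)) (vec_nth \<xi> i))"
    using f gauss_pos[of \<xi>] by (simp add: power_mult_distrib[symmetric])
  finally show ?thesis .
qed

lemma gauss_hermite_prod:
  "gauss \<xi> * hermite \<alpha> \<xi> * hermite \<beta> \<xi> = (\<Prod>i\<in>UNIV. gauss1 (vec_nth \<xi> i) * poly (hpoly (vec_nth \<alpha> i) * hpoly (vec_nth \<beta> i)) (vec_nth (\<xi> :: real ^ 'd::finite) i))"
  unfolding gauss_prod hermite_prod by (simp add: prod.distrib)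

lemma weighted_gauss_hermite_prod:
  "c (vec_nth \<xi> k) * gauss \<xi> * hermite \<alpha> \<xi> * hermite \<beta> \<xi> = (\<Prod>i\<in>UNIV. (if i = k then c (vec_nth \<xi> i) else 1) *
     (gauss1 (vec_nth \<xi> i) * poly (hpoly (vec_nth \<alpha> i) * hpoly (vec_nth \<beta> i)) (vec_nth (\<xi> :: real ^ 'd::finite) i)))"
  using gauss_hermite_prod[of \<xi> \<alpha> \<beta>]
  by (simp add: prod.distrib[of "\<lambda>i. if i = k then c (vec_nth \<xi> i) else 1"] mult.assoc)

lemma integrable_gauss_hermite:
  "integrable lborel (\<lambda>\<xi> :: real ^ 'd::finite. gauss \<xi> * hermite \<alpha> \<xi> * hermite \<beta> \<xi>)"
  unfolding gauss_hermite_prod by (intro lborel_vec_prod integrable_gauss1_poly)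

lemma prod_of_bool: "(\<Prod>i\<in>(UNIV :: 'd::finite set). of_bool (P i)) = (of_bool (\<forall>i. P i) :: real)"
proof (cases "\<forall>i. P i")
  case False
  then obtain i where "\<not> P i" by blast
  thus ?thesis by (auto intro!: prod_zero bexI[of _ i])
qed simp

lemma hermite_orthonormal:
  "(LINT \<xi>|lborel. gauss \<xi> * hermite \<alpha> \<xi> * hermite \<beta> (\<xi> :: real ^ 'd::finite)) = of_bool (\<alpha> = \<beta>)"
  unfolding gauss_hermite_prod
  by (subst lborel_vec_prod) (simp_all only: integrable_gauss1_poly hpoly_orthonormal' prod_of_bool Finite_Cartesian_Product.vec_eq_iff)

text \<open>
The three-term recurrence in direction \<open>k\<close>, orthonormality in the other directions.
\<close>

lemma flux_eq:
  "flux k \<alpha> \<beta> = of_bool (\<forall>i. i \<noteq> k \<longrightarrow> vec_nth \<alpha> i = vec_nth \<beta> i) *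
     (of_bool (vec_nth \<beta> k = Suc (vec_nth \<alpha> k)) * sqrt (real (vec_nth \<beta> k)) +
      of_bool (vec_nth \<alpha> k = Suc (vec_nth \<beta> k)) * sqrt (real (vec_nth \<alpha> k)))"
proof -
  let ?f = "\<lambda>i t. (if i = k then t else 1) * (gauss1 t * poly (hpoly (vec_nth \<alpha> i) * hpoly (vec_nth \<beta> i)) t)"
  have i: "integrable lborel (?f i)" for i
    using integrable_gauss1_poly[of "[:0, 1:] * (hpoly (vec_nth \<alpha> i) * hpoly (vec_nth \<beta> i))"]
      integrable_gauss1_poly[of "hpoly (vec_nth \<alpha> i) * hpoly (vec_nth \<beta> i)"]
    by (cases "i = k") (simp_all add: mult_ac del: hpoly.simps)
  have "flux k \<alpha> \<beta> = (LINT \<xi>|lborel. (\<Prod>i\<in>UNIV. ?f i (vec_nth \<xi> i)))"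
    unfolding flux_def weighted_gauss_hermite_prod[of "\<lambda>t. t"] by (simp only: if_distrib)
  also have "\<dots> = (\<Prod>i\<in>UNIV. (LINT t|lborel. ?f i t))"
    by (rule lborel_vec_prod[OF i])
  also have "\<dots> = (LINT t|lborel. ?f k t) * (\<Prod>i\<in>UNIV - {k}. (LINT t|lborel. ?f i t))"
    by (rule prod.remove) auto
  also have "(\<Prod>i\<in>UNIV - {k}. (LINT t|lborel. ?f i t)) = (\<Prod>i\<in>UNIV. of_bool (i \<noteq> k \<longrightarrow> vec_nth \<alpha> i = vec_nth \<beta> i))"
    by (subst prod.remove[of UNIV k "\<lambda>i. of_bool (i \<noteq> k \<longrightarrow> vec_nth \<alpha> i = vec_nth \<beta> i)"])
       (auto simp: hpoly_orthonormal'[unfolded poly_mult] simp del: hpoly.simps intro!: prod.cong)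
  also have "\<dots> = of_bool (\<forall>i. i \<noteq> k \<longrightarrow> vec_nth \<alpha> i = vec_nth \<beta> i)" by (rule prod_of_bool)
  also have "(LINT t|lborel. ?f k t) = of_bool (vec_nth \<beta> k = Suc (vec_nth \<alpha> k)) * sqrt (real (vec_nth \<beta> k)) +
      of_bool (vec_nth \<alpha> k = Suc (vec_nth \<beta> k)) * sqrt (real (vec_nth \<alpha> k))"
    using flux1[of "vec_nth \<alpha> k" "vec_nth \<beta> k"] by (auto simp: mult_ac simp del: hpoly.simps)
  finally show ?thesis by simp
qed

lemma flux_sym: "flux k \<alpha> \<beta> = flux k \<beta> \<alpha>"
  by (simp add: flux_def mult_ac)

lemma half_flux_sym: "half_flux k \<alpha> \<beta> = half_flux k \<beta> \<alpha>"
  by (simp add: half_flux_def mult_ac)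

lemma flux_same_parity: "even (vec_nth \<alpha> k) = even (vec_nth \<beta> k) \<Longrightarrow> flux k \<alpha> \<beta> = 0"
  by (auto simp: flux_eq)

lemma integrable_half_flux:
  "integrable lborel (\<lambda>\<xi> :: real ^ 'd::finite. \<bar>vec_nth \<xi> k\<bar> * gauss \<xi> * hermite \<alpha> \<xi> * hermite \<beta> \<xi>)"
  unfolding weighted_gauss_hermite_prod[of abs]
proof (rule lborel_vec_prod)
  fix i
  show "integrable lborel (\<lambda>t. (if i = k then \<bar>t\<bar> else 1) * (gauss1 t * poly (hpoly (vec_nth \<alpha> i) * hpoly (vec_nth \<beta> i)) t))"
    using integrable_gauss1_poly[of "hpoly (vec_nth \<alpha> i) * hpoly (vec_nth \<beta> i)"]
      integrable_gauss1_abs_poly[of "hpoly (vec_nth \<alpha> i) * hpoly (vec_nth \<beta> i)"]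
    by (cases "i = k") (simp_all del: hpoly.simps poly_mult)
qed

lemma continuous_hermite [continuous_intros]: "continuous_on A (hermite \<alpha>)"
  unfolding hermite_prod by (intro continuous_intros)

lemma borel_measurable_hermite [measurable]: "hermite \<alpha> \<in> borel_measurable borel"
  by (intro borel_measurable_continuous_onI continuous_intros)

lemma borel_measurable_gauss [measurable]: "gauss \<in> borel_measurable borel"
  unfolding gauss_def by measurable

text \<open>
Linear independence, in a form that allows the same Hermite function to occur under several labels
\<open>s\<close>: the labels that carry \<open>\<beta>\<close> have coefficients with sum zero.
\<close>

lemma hermite_coefficients:
  assumes "AE \<xi> :: real ^ 'd::finite in lborel. (\<Sum>s\<in>A. c s * hermite (\<gamma> s) \<xi>) = 0"
  shows "(\<Sum>s\<in>A. c s * of_bool (\<gamma> s = \<beta>)) = 0"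
proof -
  have i: "integrable lborel (\<lambda>\<xi> :: real ^ 'd. c s * (gauss \<xi> * hermite (\<gamma> s) \<xi> * hermite \<beta> \<xi>))" for s
    by (intro integrable_mult_right integrable_gauss_hermite)
  have "(\<Sum>s\<in>A. c s * of_bool (\<gamma> s = \<beta>)) = (LINT \<xi>|lborel. (\<Sum>s\<in>A. c s * (gauss \<xi> * hermite (\<gamma> s) \<xi> * hermite \<beta> (\<xi> :: real ^ 'd))))"
    by (subst Bochner_Integration.integral_sum[OF i]) (simp only: integral_mult_right_zero hermite_orthonormal)
  also have "\<dots> = 0"
  proof (rule integral_eq_zero_AE)
    show "AE \<xi> :: real ^ 'd in lborel. (\<Sum>s\<in>A. c s * (gauss \<xi> * hermite (\<gamma> s) \<xi> * hermite \<beta> \<xi>)) = 0"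
      using assms
    proof eventually_elim
      case (elim \<xi>)
      have "(\<Sum>s\<in>A. c s * (gauss \<xi> * hermite (\<gamma> s) \<xi> * hermite \<beta> \<xi>))
        = gauss \<xi> * hermite \<beta> \<xi> * (\<Sum>s\<in>A. c s * hermite (\<gamma> s) \<xi>)"
        by (simp add: sum_distrib_left mult_ac)
      thus ?case using elim by simp
    qed
  qed
  finally show ?thesis .
qed

lemma AE_vec_nth_neq_0: "AE \<xi> :: real ^ 'd::finite in lborel. vec_nth \<xi> k \<noteq> 0"
proof -
  have "negligible {\<xi> :: real ^ 'd. inner (axis k 1) \<xi> = 0}"
    by (rule negligible_hyperplane) (simp add: axis_eq_0_iff)
  hence "AE \<xi> :: real ^ 'd in lebesgue. \<xi> \<notin> {\<xi>. inner (axis k 1) \<xi> = 0}"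
    by (intro AE_not_in) (simp add: negligible_iff_null_sets)
  thus ?thesis by (simp add: AE_completion_iff inner_axis')
qed

text \<open>
The form is the integral of \<open>f\<^sup>2\<close> against a weight that is positive off a hyperplane.
\<close>

theorem half_flux_pos_def:
  fixes v :: "nat ^ 'd::finite \<Rightarrow> real"
  assumes fin: "finite I"
  shows "0 \<le> (\<Sum>\<alpha>\<in>I. \<Sum>\<beta>\<in>I. v \<alpha> * v \<beta> * half_flux k \<alpha> \<beta>)"
    and "(\<Sum>\<alpha>\<in>I. \<Sum>\<beta>\<in>I. v \<alpha> * v \<beta> * half_flux k \<alpha> \<beta>) = 0 \<Longrightarrow> \<alpha> \<in> I \<Longrightarrow> v \<alpha> = 0"
proof -
  define f where "f \<xi> = (\<Sum>\<alpha>\<in>I. v \<alpha> * hermite \<alpha> \<xi>)" for \<xi> :: "real ^ 'd"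
  define F where "F \<xi> = \<bar>vec_nth \<xi> k\<bar> * gauss \<xi> * (f \<xi>)\<^sup>2" for \<xi> :: "real ^ 'd"
  have Fs: "F \<xi> = (\<Sum>\<alpha>\<in>I. \<Sum>\<beta>\<in>I. v \<alpha> * v \<beta> * (\<bar>vec_nth \<xi> k\<bar> * gauss \<xi> * hermite \<alpha> \<xi> * hermite \<beta> \<xi>))" for \<xi>
    unfolding F_def f_def power2_eq_square sum_product by (simp add: sum_distrib_left mult_ac)
  have i: "integrable lborel (\<lambda>\<xi>. v \<alpha> * v \<beta> * (\<bar>vec_nth \<xi> k\<bar> * gauss \<xi> * hermite \<alpha> \<xi> * hermite \<beta> \<xi>))" for \<alpha> \<beta> :: "nat ^ 'd"
    by (intro integrable_mult_right integrable_half_flux)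
  have iF: "integrable lborel F" unfolding Fs by (intro Bochner_Integration.integrable_sum i)
  have "(LINT \<xi>|lborel. F \<xi>) = (\<Sum>\<alpha>\<in>I. \<Sum>\<beta>\<in>I. v \<alpha> * v \<beta> * (LINT \<xi>|lborel. \<bar>vec_nth \<xi> k\<bar> * gauss \<xi> * hermite \<alpha> \<xi> * hermite \<beta> \<xi>))"
    unfolding Fs
    by (subst Bochner_Integration.integral_sum, intro Bochner_Integration.integrable_sum i)
       (subst Bochner_Integration.integral_sum[OF i], simp only: integral_mult_right_zero)
  hence e: "(\<Sum>\<alpha>\<in>I. \<Sum>\<beta>\<in>I. v \<alpha> * v \<beta> * half_flux k \<alpha> \<beta>) = sqrt (2 * pi) / 2 * (LINT \<xi>|lborel. F \<xi>)"
    by (simp add: half_flux_def sum_distrib_left mult_ac)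
  have Fnn: "0 \<le> F \<xi>" for \<xi> using gauss_pos[of \<xi>] by (simp add: F_def)
  show "0 \<le> (\<Sum>\<alpha>\<in>I. \<Sum>\<beta>\<in>I. v \<alpha> * v \<beta> * half_flux k \<alpha> \<beta>)"
    unfolding e using Fnn by (intro mult_nonneg_nonneg integral_nonneg) auto
  assume 0: "(\<Sum>\<alpha>\<in>I. \<Sum>\<beta>\<in>I. v \<alpha> * v \<beta> * half_flux k \<alpha> \<beta>) = 0" and a: "\<alpha> \<in> I"
  have "(LINT \<xi>|lborel. F \<xi>) = 0" using 0 unfolding e by simp
  hence "AE \<xi> in lborel. F \<xi> = 0"
    using integral_nonneg_eq_0_iff_AE[OF iF] Fnn by simp
  hence "AE \<xi> in lborel. f \<xi> = 0"
    using AE_vec_nth_neq_0[of k]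
  proof eventually_elim
    case (elim \<xi>)
    thus ?case using gauss_pos[of \<xi>] by (simp add: F_def)
  qed
  hence "(\<Sum>\<beta>\<in>I. v \<beta> * of_bool (\<beta> = \<alpha>)) = 0" unfolding f_def by (rule hermite_coefficients)
  thus "v \<alpha> = 0" using fin a by (simp add: of_bool_def if_distrib cong: if_cong)
qed

section \<open>Invariance of the collision measure\<close>

lemma ball_borel_measurable [measurable]: "ball (c :: 'a :: metric_space) r \<in> sets borel"
  by simp

lemma nn_integral_lborel_translate:
  fixes f :: "'a::euclidean_space \<Rightarrow> ennreal"
  assumes [measurable]: "f \<in> borel_measurable borel"
  shows "(\<integral>\<^sup>+x. f (c + x) \<partial>lborel) = (\<integral>\<^sup>+x. f x \<partial>lborel)"
proof -
  have "(\<integral>\<^sup>+x. f x \<partial>lborel) = (\<integral>\<^sup>+x. f x \<partial>distr lborel borel ((+) c))"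
    by (simp add: lborel_distr_plus)
  also have "\<dots> = (\<integral>\<^sup>+x. f (c + x) \<partial>lborel)" by (rule nn_integral_distr) auto
  finally show ?thesis ..
qed

text \<open>
Lebesgue measure and its image under \<open>T\<close> are both translation invariant and give the same mass \<open>c\<close> to
the unit ball. They agree by the uniqueness argument for Haar measures: with \<open>g\<close> the indicator of the
ball, evaluate the double integral of \<open>f (T y + x) * g (T y)\<close> in both orders, shifting one variable
by the other.
\<close>

theorem nn_integral_lborel_orthogonal:
  fixes T :: "'a::euclidean_space \<Rightarrow> 'a"
  assumes T: "orthogonal_transformation T" and f[measurable]: "f \<in> borel_measurable borel"
  shows "(\<integral>\<^sup>+x. f (T x) \<partial>lborel) = (\<integral>\<^sup>+x. f x \<partial>lborel)"
proof -
  have lin: "linear T" by (rule orthogonal_transformation_linear[OF T])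
  have Tm[measurable]: "T \<in> borel_measurable borel"
    by (intro borel_measurable_continuous_onI linear_continuous_on linear_conv_bounded_linear[THEN iffD1] lin)
  \<comment> \<open>A shift of the image by x is a shift of the argument by T' x.\<close>
  obtain T' where T': "\<And>x. T (T' x) = x" using orthogonal_transformation_surj[OF T] by (metis surjD)
  define g where "g x = (indicator (ball 0 1) x :: ennreal)" for x :: 'a
  have gm[measurable]: "g \<in> borel_measurable borel" unfolding g_def by measurable
  define c where "c = (\<integral>\<^sup>+x. g x \<partial>lborel :: ennreal)"
  have c: "c = emeasure lborel (ball (0::'a) 1)" unfolding c_def g_def by (simp add: nn_integral_indicator)
  have cfin: "c \<noteq> \<infinity>" unfolding c using emeasure_lborel_ball_finite[of "0::'a" 1] by (simp add: less_top)
  have cpos: "c \<noteq> 0"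
  proof
    assume "c = 0"
    hence "negligible (ball (0::'a) 1)"
      unfolding c by (simp add: negligible_iff_null_sets null_sets_def)
    thus False using open_not_negligible[of "ball (0::'a) 1"] by simp
  qed
  have gT: "g (T y) = g y" for y
    by (simp add: g_def indicator_def orthogonal_transformation_norm[OF T])
  have "(\<integral>\<^sup>+x. f x \<partial>lborel) * c = (\<integral>\<^sup>+y. (\<integral>\<^sup>+x. f x \<partial>lborel) * g y \<partial>lborel)"
    unfolding c_def by (subst nn_integral_cmult) auto
  also have "\<dots> = (\<integral>\<^sup>+y. (\<integral>\<^sup>+x. f (T y + x) * g (T y) \<partial>lborel) \<partial>lborel)"
    by (simp add: nn_integral_multc nn_integral_lborel_translate gT)
  also have "\<dots> = (\<integral>\<^sup>+x. (\<integral>\<^sup>+y. f (T y + x) * g (T y) \<partial>lborel) \<partial>lborel)"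
    by (rule lborel_pair.Fubini') measurable
  also have "\<dots> = (\<integral>\<^sup>+x. (\<integral>\<^sup>+y. f (T y) * g (T y - x) \<partial>lborel) \<partial>lborel)"
  proof (rule nn_integral_cong)
    fix x :: 'a
    have "(\<integral>\<^sup>+y. f (T y) * g (T y - x) \<partial>lborel) = (\<integral>\<^sup>+y. f (T (T' x + y)) * g (T (T' x + y) - x) \<partial>lborel)"
      by (rule nn_integral_lborel_translate[symmetric]) measurable
    also have "\<dots> = (\<integral>\<^sup>+y. f (T y + x) * g (T y) \<partial>lborel)"
      by (simp add: linear_add[OF lin] T' add.commute)
    finally show "(\<integral>\<^sup>+y. f (T y + x) * g (T y) \<partial>lborel) = (\<integral>\<^sup>+y. f (T y) * g (T y - x) \<partial>lborel)" ..
  qed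
  also have "\<dots> = (\<integral>\<^sup>+y. (\<integral>\<^sup>+x. f (T y) * g (T y - x) \<partial>lborel) \<partial>lborel)"
    by (rule lborel_pair.Fubini') measurable
  also have "\<dots> = (\<integral>\<^sup>+y. f (T y) * c \<partial>lborel)"
  proof (rule nn_integral_cong)
    fix y :: 'a
    have "(\<integral>\<^sup>+x. g (T y - x) \<partial>lborel) = (\<integral>\<^sup>+x. g (T y - (T y + x)) \<partial>lborel)"
      by (rule nn_integral_lborel_translate[symmetric]) measurable
    also have "\<dots> = c" by (simp add: c_def g_def indicator_def)
    finally show "(\<integral>\<^sup>+x. f (T y) * g (T y - x) \<partial>lborel) = f (T y) * c"
      by (subst nn_integral_cmult) auto
  qed
  also have "\<dots> = (\<integral>\<^sup>+y. f (T y) \<partial>lborel) * c" by (rule nn_integral_multc) measurable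
  finally show ?thesis using cfin cpos by (metis ennreal_mult_cancel_left infinity_ennreal_def mult.commute top.not_eq_extremum)
qed

type_synonym 'd collision = "(real, 'd) Finite_Cartesian_Product.vec \<times> (real, 'd) Finite_Cartesian_Product.vec \<times> (real, 'd) Finite_Cartesian_Product.vec"

abbreviation collision_measure :: "('d::finite) collision measure" where
  "collision_measure \<equiv> lborel \<Otimes>\<^sub>M (lborel \<Otimes>\<^sub>M sphere_measure)"

lemma sets_sphere_measure [simp, measurable_cong]: "sets (sphere_measure :: (real ^ 'd::finite) measure) = sets borel"
  by (simp add: sphere_measure_def)

lemma space_sphere_measure [simp]: "space (sphere_measure :: (real ^ 'd::finite) measure) = UNIV"
  by (simp add: sphere_measure_def)

lemma sgn_measurable [measurable]: "(sgn :: real ^ 'd::finite \<Rightarrow> _) \<in> borel_measurable borel"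
  unfolding sgn_div_norm by measurable

lemma emeasure_sphere_measure_finite: "emeasure (sphere_measure :: (real ^ 'd::finite) measure) UNIV < \<infinity>"
proof -
  have "emeasure (sphere_measure :: (real ^ 'd) measure) UNIV
      = (\<integral>\<^sup>+x. of_nat CARD('d) * indicator (ball (0 :: real ^ 'd) 1) x \<partial>lborel)"
    unfolding sphere_measure_def by (subst emeasure_distr) (auto simp: emeasure_density)
  also have "\<dots> = of_nat CARD('d) * emeasure lborel (ball (0 :: real ^ 'd) 1)"
    by (simp add: nn_integral_cmult_indicator)
  also have "\<dots> < \<infinity>" using emeasure_lborel_ball_finite[of "0 :: real ^ 'd" 1]
    by (simp add: ennreal_mult_less_top of_nat_less_top)
  finally show ?thesis .
qed

interpretation sphere: finite_measure "sphere_measure :: (real ^ 'd::finite) measure"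
  by (rule finite_measureI) (use emeasure_sphere_measure_finite in \<open>auto simp: less_top\<close>)

interpretation lborel_sphere: pair_sigma_finite "lborel :: (real ^ 'd::finite) measure" "sphere_measure :: (real ^ 'd) measure" ..

interpretation lborel_sphere_product: sigma_finite_measure
  "(lborel :: (real ^ 'd::finite) measure) \<Otimes>\<^sub>M (sphere_measure :: (real ^ 'd) measure)"
  by (rule sigma_finite_pair_measure) unfold_locales

interpretation lborel_lborel_sphere: pair_sigma_finite "lborel :: (real ^ 'd::finite) measure"
  "(lborel :: (real ^ 'd) measure) \<Otimes>\<^sub>M (sphere_measure :: (real ^ 'd) measure)" ..

text \<open>
Transfers null sets between the sphere and the ball: the surface measure was defined by radial
projection.
\<close>

lemma AE_sphere_measure_iff:
  assumes [measurable]: "Measurable.pred borel P"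
  shows "(AE \<Theta> in sphere_measure. P \<Theta>) \<longleftrightarrow> (AE x :: real ^ 'd::finite in lborel. x \<in> ball 0 1 \<longrightarrow> P (sgn x))"
proof -
  have "(AE \<Theta> in sphere_measure. P \<Theta>) \<longleftrightarrow>
     (AE x in density lborel (\<lambda>x. of_nat CARD('d) * indicator (ball 0 1) (x :: real ^ 'd)). P (sgn x))"
    unfolding sphere_measure_def by (subst AE_distr_iff) auto
  also have "\<dots> \<longleftrightarrow> (AE x :: real ^ 'd in lborel. 0 < of_nat CARD('d) * (indicator (ball 0 1) x :: ennreal) \<longrightarrow> P (sgn x))"
    by (subst AE_density) auto
  also have "(\<lambda>x :: real ^ 'd. 0 < of_nat CARD('d) * (indicator (ball 0 1) x :: ennreal)) = (\<lambda>x. x \<in> ball 0 1)"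
    by (auto simp: fun_eq_iff indicator_def ennreal_zero_less_mult_iff)
  finally show ?thesis by simp
qed

lemma AE_norm_sphere_measure: "AE \<Theta> :: real ^ 'd::finite in sphere_measure. norm \<Theta> = 1"
proof (subst AE_sphere_measure_iff)
  show "AE x :: real ^ 'd in lborel. x \<in> ball 0 1 \<longrightarrow> norm (sgn x) = 1"
    using AE_lborel_singleton[of "0 :: real ^ 'd"] by eventually_elim (simp add: norm_sgn)
qed measurable

lemma nn_integral_sphere_orthogonal:
  fixes R :: "real ^ 'd::finite \<Rightarrow> real ^ 'd"
  assumes R: "orthogonal_transformation R" and f[measurable]: "f \<in> borel_measurable borel"
  shows "(\<integral>\<^sup>+x. f (R x) \<partial>sphere_measure) = (\<integral>\<^sup>+x. f x \<partial>sphere_measure)"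
proof -
  have lin: "linear R" by (rule orthogonal_transformation_linear[OF R])
  have Rm[measurable]: "R \<in> borel_measurable borel"
    by (intro borel_measurable_continuous_onI linear_continuous_on linear_conv_bounded_linear[THEN iffD1] lin)
  have e: "(\<integral>\<^sup>+x. h x \<partial>sphere_measure) = (\<integral>\<^sup>+x. of_nat CARD('d) * indicator (ball 0 1) x * h (sgn x) \<partial>lborel)"
    if [measurable]: "h \<in> borel_measurable borel" for h :: "real ^ 'd \<Rightarrow> ennreal"
    unfolding sphere_measure_def by (subst nn_integral_distr, measurable) (subst nn_integral_density, auto)
  have sgnR: "sgn (R x) = R (sgn x)" for x
    by (simp add: sgn_div_norm orthogonal_transformation_norm[OF R] linear_scale[OF lin])
  have "(\<integral>\<^sup>+x. f x \<partial>sphere_measure) = (\<integral>\<^sup>+x. of_nat CARD('d) * indicator (ball 0 1) (R x) * f (sgn (R x)) \<partial>lborel)"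
    unfolding e[OF f] by (rule nn_integral_lborel_orthogonal[OF R, symmetric]) measurable
  also have "\<dots> = (\<integral>\<^sup>+x. of_nat CARD('d) * indicator (ball 0 1) x * f (R (sgn x)) \<partial>lborel)"
    by (simp add: sgnR indicator_def orthogonal_transformation_norm[OF R])
  also have "\<dots> = (\<integral>\<^sup>+x. f (R x) \<partial>sphere_measure)" by (rule e[symmetric]) measurable
  finally show ?thesis ..
qed

lemma sets_collision_measure [simp]: "sets (collision_measure :: ('d::finite) collision measure) = sets borel"
proof -
  have "sets (collision_measure :: 'd collision measure) = sets (borel \<Otimes>\<^sub>M (borel \<Otimes>\<^sub>M borel))"
    by (intro sets_pair_measure_cong) simp_all
  thus ?thesis unfolding borel_prod[where 'a = "real ^ 'd" and 'b = "real ^ 'd"]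
    borel_prod[where 'a = "real ^ 'd" and 'b = "(real ^ 'd) \<times> (real ^ 'd)"] .
qed

lemma borel_triple: "(borel \<Otimes>\<^sub>M (borel \<Otimes>\<^sub>M borel) :: ('d::finite) collision measure) = borel"
  unfolding borel_prod[where 'a = "real ^ 'd" and 'b = "real ^ 'd"]
    borel_prod[where 'a = "real ^ 'd" and 'b = "(real ^ 'd) \<times> (real ^ 'd)"] ..


lemma measurable_pair_integral:
  fixes f :: "('d::finite) collision \<Rightarrow> ennreal"
  assumes f: "f \<in> borel_measurable borel"
  shows "(\<lambda>\<Theta>. \<integral>\<^sup>+p. f (fst p, snd p, \<Theta>) \<partial>lborel) \<in> borel_measurable borel"
proof (rule lborel.borel_measurable_nn_integral)
  have 1: "(\<lambda>x. f (fst (snd x), snd (snd x), fst x)) \<in> borel_measurable borel"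
    by (rule measurable_compose[OF _ f]) (intro borel_measurable_continuous_onI continuous_intros)
  have "sets (borel \<Otimes>\<^sub>M (lborel :: ((real ^ 'd) \<times> (real ^ 'd)) measure)) = sets (borel :: 'd collision measure)"
    by (subst borel_prod[symmetric]) (intro sets_pair_measure_cong, simp_all)
  hence S: "measurable (borel \<Otimes>\<^sub>M (lborel :: ((real ^ 'd) \<times> (real ^ 'd)) measure)) (borel :: ennreal measure)
      = measurable (borel :: 'd collision measure) borel"
    by (rule measurable_cong_sets[OF _ refl])
  show "(\<lambda>(\<Theta>, p). f (fst p, snd p, \<Theta>)) \<in> borel_measurable (borel \<Otimes>\<^sub>M lborel)"
    unfolding S case_prod_beta using 1 by blast
qed

lemma nn_integral_triple:
  fixes f :: "('d::finite) collision \<Rightarrow> ennreal"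
  assumes f: "f \<in> borel_measurable borel"
    and S: "sigma_finite_measure S" and [measurable_cong]: "sets S = sets borel"
  shows "(\<integral>\<^sup>+x. f x \<partial>(lborel \<Otimes>\<^sub>M (lborel \<Otimes>\<^sub>M S))) =
    (\<integral>\<^sup>+\<Theta>. (\<integral>\<^sup>+p. f (fst p, snd p, \<Theta>) \<partial>lborel) \<partial>S)"
proof -
  interpret S: sigma_finite_measure S by (rule S)
  interpret LS: pair_sigma_finite "lborel :: (real ^ 'd) measure" S ..
  have fm[measurable]: "f \<in> borel_measurable (borel \<Otimes>\<^sub>M (borel \<Otimes>\<^sub>M borel))" using f by (simp only: borel_triple)
  have "(\<integral>\<^sup>+x. f x \<partial>(lborel \<Otimes>\<^sub>M (lborel \<Otimes>\<^sub>M S))) = (\<integral>\<^sup>+\<xi>. (\<integral>\<^sup>+y. f (\<xi>, y) \<partial>(lborel \<Otimes>\<^sub>M S)) \<partial>lborel)"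
    by (rule LS.P.nn_integral_fst[symmetric]) measurable
  also have "\<dots> = (\<integral>\<^sup>+\<xi>. (\<integral>\<^sup>+\<Theta>. (\<integral>\<^sup>+\<xi>1. f (\<xi>, \<xi>1, \<Theta>) \<partial>lborel) \<partial>S) \<partial>lborel)"
    by (intro nn_integral_cong LS.nn_integral_snd[symmetric]) measurable
  also have "\<dots> = (\<integral>\<^sup>+\<Theta>. (\<integral>\<^sup>+\<xi>. (\<integral>\<^sup>+\<xi>1. f (\<xi>, \<xi>1, \<Theta>) \<partial>lborel) \<partial>lborel) \<partial>S)"
    by (rule LS.Fubini'[symmetric]) measurable
  also have "\<dots> = (\<integral>\<^sup>+\<Theta>. (\<integral>\<^sup>+p. f (fst p, snd p, \<Theta>) \<partial>(lborel \<Otimes>\<^sub>M lborel)) \<partial>S)"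
  proof (rule nn_integral_cong)
    fix \<Theta>
    have "(\<lambda>p. f (fst p, snd p, \<Theta>)) \<in> borel_measurable borel"
      by (rule measurable_compose[OF _ f]) (intro borel_measurable_continuous_onI continuous_intros)
    hence "(\<lambda>p. f (fst p, snd p, \<Theta>)) \<in> borel_measurable (lborel \<Otimes>\<^sub>M lborel)" by (simp add: lborel_prod)
    from lborel.nn_integral_fst[OF this]
    show "(\<integral>\<^sup>+\<xi>. (\<integral>\<^sup>+\<xi>1. f (\<xi>, \<xi>1, \<Theta>) \<partial>lborel) \<partial>lborel) = (\<integral>\<^sup>+p. f (fst p, snd p, \<Theta>) \<partial>(lborel \<Otimes>\<^sub>M lborel))"
      by simp
  qed
  finally show ?thesis by (simp add: lborel_prod)
qed

lemma nn_integral_collision_measure: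
  fixes f :: "('d::finite) collision \<Rightarrow> ennreal"
  assumes f: "f \<in> borel_measurable borel"
  shows "(\<integral>\<^sup>+x. f x \<partial>collision_measure) =
    (\<integral>\<^sup>+\<Theta>. (\<integral>\<^sup>+p. f (fst p, snd p, \<Theta>) \<partial>lborel) \<partial>sphere_measure)"
  by (rule nn_integral_triple[OF f]) (unfold_locales, simp)

text \<open>
For fixed \<open>\<Theta>\<close> the map \<open>U \<Theta>\<close> acts on the pair of velocities as an isometry of \<open>\<real>\<^sup>2\<^sup>D\<close>. All symmetries of a
collision (exchange of the particles, the collision itself, reflection in a coordinate) have this form.
\<close>

theorem collision_measure_invariant:
  fixes U :: "real ^ 'd::finite \<Rightarrow> ((real ^ 'd) \<times> (real ^ 'd)) \<Rightarrow> ((real ^ 'd) \<times> (real ^ 'd))"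
  assumes U: "\<And>\<Theta>. norm \<Theta> = 1 \<Longrightarrow> orthogonal_transformation (U \<Theta>)" and R: "orthogonal_transformation R"
    and m: "(\<lambda>(\<xi>, \<xi>1, \<Theta>). (fst (U \<Theta> (\<xi>, \<xi>1)), snd (U \<Theta> (\<xi>, \<xi>1)), R \<Theta>)) \<in> borel_measurable borel"
  shows "distr collision_measure borel (\<lambda>(\<xi>, \<xi>1, \<Theta>). (fst (U \<Theta> (\<xi>, \<xi>1)), snd (U \<Theta> (\<xi>, \<xi>1)), R \<Theta>))
    = (collision_measure :: 'd collision measure)"
proof (rule measure_eqI)
  let ?\<Phi> = "\<lambda>(\<xi>, \<xi>1, \<Theta>). (fst (U \<Theta> (\<xi>, \<xi>1)), snd (U \<Theta> (\<xi>, \<xi>1)), R \<Theta>)"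
  show "sets (distr collision_measure borel ?\<Phi>) = sets (collision_measure :: 'd collision measure)"
    unfolding sets_collision_measure by (simp only: sets_distr)
  fix A assume "A \<in> sets (distr collision_measure borel ?\<Phi>)"
  hence A: "A \<in> sets borel" by simp
  have m': "?\<Phi> \<in> measurable collision_measure borel"
    using m by (simp add: measurable_cong_sets[OF sets_collision_measure refl])
  define f where "f x = (indicator A x :: ennreal)" for x
  have f: "f \<in> borel_measurable borel" unfolding f_def using A by measurable
  have fm[measurable]: "f \<in> borel_measurable (borel \<Otimes>\<^sub>M (borel \<Otimes>\<^sub>M borel))" using f by (simp only: borel_triple)
  have fm2: "(\<lambda>p. f (fst p, snd p, \<Theta>)) \<in> borel_measurable borel" for \<Theta>
    by (rule measurable_compose[OF _ f]) (intro borel_measurable_continuous_onI continuous_intros)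
  have "emeasure (distr collision_measure borel ?\<Phi>) A = (\<integral>\<^sup>+x. f x \<partial>distr collision_measure borel ?\<Phi>)"
    using A by (simp add: f_def)
  also have "\<dots> = (\<integral>\<^sup>+x. f (?\<Phi> x) \<partial>collision_measure)" by (rule nn_integral_distr[OF m']) (simp add: f)
  also have "\<dots> = (\<integral>\<^sup>+\<Theta>. (\<integral>\<^sup>+p. f (?\<Phi> (fst p, snd p, \<Theta>)) \<partial>lborel) \<partial>sphere_measure)"
    by (rule nn_integral_collision_measure) (rule measurable_compose[OF m f])
  also have "\<dots> = (\<integral>\<^sup>+\<Theta>. (\<integral>\<^sup>+p. f (fst p, snd p, R \<Theta>) \<partial>lborel) \<partial>sphere_measure)"
  proof (rule nn_integral_cong_AE)
    show "AE \<Theta> in sphere_measure. (\<integral>\<^sup>+p. f (?\<Phi> (fst p, snd p, \<Theta>)) \<partial>lborel) = (\<integral>\<^sup>+p. f (fst p, snd p, R \<Theta>) \<partial>lborel)"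
      using AE_norm_sphere_measure
    proof eventually_elim
      case (elim \<Theta>)
      show ?case
        using nn_integral_lborel_orthogonal[OF U[OF elim] fm2[of "R \<Theta>"]] by simp
    qed
  qed
  also have "\<dots> = (\<integral>\<^sup>+\<Theta>. (\<integral>\<^sup>+p. f (fst p, snd p, \<Theta>) \<partial>lborel) \<partial>sphere_measure)"
    by (rule nn_integral_sphere_orthogonal[OF R measurable_pair_integral[OF f]])
  also have "\<dots> = (\<integral>\<^sup>+x. f x \<partial>collision_measure)" by (rule nn_integral_collision_measure[OF f, symmetric])
  also have "\<dots> = emeasure collision_measure A"
    unfolding f_def by (rule nn_integral_indicator) (use A in \<open>simp only: sets_collision_measure\<close>)
  finally show "emeasure (distr collision_measure borel ?\<Phi>) A = emeasure collision_measure A" .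
qed

section \<open>The symmetrized collision form\<close>

definition K_val :: "(real ^ 'd::finite \<Rightarrow> real) \<Rightarrow> 'd collision \<Rightarrow> real" where
  "K_val g = (\<lambda>(\<xi>, \<xi>1, \<Theta>). K_op g \<xi> \<xi>1 \<Theta>)"

definition weight :: "(real \<Rightarrow> real \<Rightarrow> real) \<Rightarrow> ('d::finite) collision \<Rightarrow> real" where
  "weight B = (\<lambda>(\<xi>, \<xi>1, \<Theta>). gauss \<xi> * gauss \<xi>1 * kernel_at B \<xi> \<xi>1 \<Theta>)"

definition exchange :: "('d::finite) collision \<Rightarrow> 'd collision" where
  "exchange = (\<lambda>(\<xi>, \<xi>1, \<Theta>). (\<xi>1, \<xi>, \<Theta>))"

definition collide :: "('d::finite) collision \<Rightarrow> 'd collision" where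
  "collide = (\<lambda>(\<xi>, \<xi>1, \<Theta>). (post1 \<xi> \<xi>1 \<Theta>, post2 \<xi> \<xi>1 \<Theta>, \<Theta>))"

definition reflect :: "'d::finite \<Rightarrow> real ^ 'd \<Rightarrow> real ^ 'd" where
  "reflect k \<xi> = \<xi> - (2 * vec_nth \<xi> k) *\<^sub>R axis k 1"

lemma measurable_collision_measure: "borel_measurable collision_measure = borel_measurable borel"
  by (rule measurable_cong_sets[OF sets_collision_measure refl])

lemma measurable_to_collision_measure:
  "measurable collision_measure (borel :: 'b::topological_space measure) = measurable borel borel"
  by (rule measurable_cong_sets[OF sets_collision_measure refl])

lemma continuous_post [continuous_intros]:
  assumes "continuous_on A f" "continuous_on A g" "continuous_on A h"
  shows "continuous_on A (\<lambda>x. post1 (f x) (g x) (h x))" "continuous_on A (\<lambda>x. post2 (f x) (g x) (h x))"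
  unfolding post1_def post2_def by (intro continuous_intros assms)+

lemma continuous_K_val:
  assumes "continuous_on UNIV g"
  shows "continuous_on UNIV (K_val g)"
proof -
  have c: "continuous_on UNIV (\<lambda>x. g (h x))" if "continuous_on UNIV h" for h
    by (rule continuous_on_compose2[OF assms that]) simp
  show ?thesis
    unfolding K_val_def K_op_def case_prod_beta by (intro continuous_intros c)
qed

lemma measurable_K_hermite [measurable]: "K_val (hermite \<alpha>) \<in> borel_measurable borel"
  by (intro borel_measurable_continuous_onI continuous_K_val continuous_intros)

lemma measurable_kernel:
  assumes "(\<lambda>(r, c). B r c) \<in> borel_measurable borel"
  shows "(\<lambda>(\<xi>, \<xi>1, \<Theta>). kernel_at B \<xi> \<xi>1 (\<Theta> :: real ^ 'd::finite)) \<in> borel_measurable borel"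
proof -
  let ?h = "\<lambda>x :: 'd collision. (norm (fst x - fst (snd x)),
      \<bar>inner (fst x - fst (snd x)) (snd (snd x))\<bar> / norm (fst x - fst (snd x)))"
  have n: "(\<lambda>x :: 'd collision. norm (fst x - fst (snd x))) \<in> borel_measurable borel"
    and i: "(\<lambda>x :: 'd collision. \<bar>inner (fst x - fst (snd x)) (snd (snd x))\<bar>) \<in> borel_measurable borel"
    by (intro borel_measurable_continuous_onI continuous_intros)+
  have "?h \<in> measurable borel (borel \<Otimes>\<^sub>M borel)"
    by (intro measurable_Pair n borel_measurable_divide i)
  hence "?h \<in> measurable borel borel" by (simp add: borel_prod)
  from measurable_compose[OF this assms] show ?thesis
    by (simp add: kernel_at_def case_prod_beta)
qed

lemma measurable_weight:
  assumes "(\<lambda>(r, c). B r c) \<in> borel_measurable borel"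
  shows "weight B \<in> borel_measurable (borel :: ('d::finite) collision measure)"
proof -
  have g: "(\<lambda>x :: 'd collision. gauss (fst x)) \<in> borel_measurable borel"
    "(\<lambda>x :: 'd collision. gauss (fst (snd x))) \<in> borel_measurable borel"
    by (rule measurable_compose[OF _ borel_measurable_gauss], intro borel_measurable_continuous_onI continuous_intros)+
  show ?thesis
    unfolding weight_def case_prod_beta
    using g measurable_kernel[OF assms, unfolded case_prod_beta] by (intro borel_measurable_times)
qed

lemma weight_nonneg: "(\<And>r c. 0 \<le> B r c) \<Longrightarrow> 0 \<le> weight B x"
  unfolding weight_def kernel_at_def case_prod_beta
  by (intro mult_nonneg_nonneg less_imp_le[OF gauss_pos])

lemma exchange_invariant:
  "distr collision_measure borel exchange = (collision_measure :: ('d::finite) collision measure)"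
proof -
  let ?U = "\<lambda>(\<Theta> :: real ^ 'd) p. (snd p, fst p) :: (real ^ 'd) \<times> (real ^ 'd)"
  have e: "exchange = (\<lambda>(\<xi>, \<xi>1, \<Theta>). (fst (?U \<Theta> (\<xi>, \<xi>1)), snd (?U \<Theta> (\<xi>, \<xi>1)), id \<Theta>))"
    by (auto simp: exchange_def)
  show ?thesis
    unfolding e
  proof (rule collision_measure_invariant)
    show "orthogonal_transformation (?U \<Theta>)" for \<Theta> :: "real ^ 'd"
      by (auto simp: orthogonal_transformation_def linear_iff inner_prod_def add.commute)
    show "orthogonal_transformation (id :: real ^ 'd \<Rightarrow> _)" by (simp add: orthogonal_transformation_def linear_iff)
    show "(\<lambda>(\<xi>, \<xi>1, \<Theta>). (fst (?U \<Theta> (\<xi>, \<xi>1)), snd (?U \<Theta> (\<xi>, \<xi>1)), id \<Theta>)) \<in> borel_measurable borel"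
      unfolding case_prod_beta by (intro borel_measurable_continuous_onI continuous_intros) (auto intro!: continuous_intros)
  qed
qed

lemma inner_collision:
  fixes \<Theta> :: "real ^ 'd::finite"
  assumes "norm \<Theta> = 1"
  shows "inner (post1 a b \<Theta>) (post1 c d \<Theta>) + inner (post2 a b \<Theta>) (post2 c d \<Theta>) = inner a c + inner b d"
proof -
  have 1: "inner \<Theta> \<Theta> = 1" using assms by (simp add: norm_eq_1)
  define p where "p = inner (a - b) \<Theta>"
  define q where "q = inner (c - d) \<Theta>"
  have e1: "inner (a - p *\<^sub>R \<Theta>) (c - q *\<^sub>R \<Theta>) = inner a c - q * inner a \<Theta> - p * inner c \<Theta> + p * q"
    by (simp add: inner_diff_left inner_diff_right 1 inner_commute[of \<Theta> c] right_diff_distrib)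
  have e2: "inner (b + p *\<^sub>R \<Theta>) (d + q *\<^sub>R \<Theta>) = inner b d + q * inner b \<Theta> + p * inner d \<Theta> + p * q"
    by (simp add: inner_add_left inner_add_right 1 inner_commute[of \<Theta> d] distrib_left)
  have b: "inner b \<Theta> = inner a \<Theta> - p" and d: "inner d \<Theta> = inner c \<Theta> - q"
    by (simp_all add: p_def q_def inner_diff_left)
  show ?thesis
    unfolding post1_def post2_def p_def[symmetric] q_def[symmetric] e1 e2 b d by (simp add: algebra_simps)
qed

lemma collide_invariant:
  "distr collision_measure borel collide = (collision_measure :: ('d::finite) collision measure)"
proof -
  let ?U = "\<lambda>(\<Theta> :: real ^ 'd) p. (post1 (fst p) (snd p) \<Theta>, post2 (fst p) (snd p) \<Theta>)"
  have e: "collide = (\<lambda>(\<xi>, \<xi>1, \<Theta>). (fst (?U \<Theta> (\<xi>, \<xi>1)), snd (?U \<Theta> (\<xi>, \<xi>1)), id \<Theta>))"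
    by (auto simp: collide_def)
  show ?thesis
    unfolding e
  proof (rule collision_measure_invariant)
    show "orthogonal_transformation (?U \<Theta>)" if "norm \<Theta> = 1" for \<Theta> :: "real ^ 'd"
      unfolding orthogonal_transformation_def
    proof (intro conjI allI)
      show "linear (?U \<Theta>)"
        unfolding post1_def post2_def
        by (rule linearI) (simp_all add: inner_diff_left inner_add_left algebra_simps)
      show "inner (?U \<Theta> v) (?U \<Theta> w) = inner v w" for v w
        using inner_collision[OF that] by (simp add: inner_prod_def)
    qed
    show "orthogonal_transformation (id :: real ^ 'd \<Rightarrow> _)" by (simp add: orthogonal_transformation_def linear_iff)
    show "(\<lambda>(\<xi>, \<xi>1, \<Theta>). (fst (?U \<Theta> (\<xi>, \<xi>1)), snd (?U \<Theta> (\<xi>, \<xi>1)), id \<Theta>)) \<in> borel_measurable borel"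
      unfolding case_prod_beta by (intro borel_measurable_continuous_onI continuous_intros) (auto intro!: continuous_intros)
  qed
qed

lemma vec_nth_reflect: "vec_nth (reflect k \<xi>) i = (if i = k then - vec_nth \<xi> i else vec_nth \<xi> i)"
  by (simp add: reflect_def axis_def)

lemma linear_reflect: "linear (reflect k)"
  unfolding reflect_def by (rule linearI) (simp_all add: algebra_simps)

lemma inner_reflect: "inner (reflect k \<xi>) (reflect k \<eta>) = inner \<xi> \<eta>"
  unfolding inner_vec_def by (rule sum.cong) (auto simp: vec_nth_reflect)

lemma norm_reflect: "norm (reflect k \<xi>) = norm \<xi>"
  by (simp add: norm_eq_sqrt_inner inner_reflect)

lemma continuous_reflect [continuous_intros]: "continuous_on A f \<Longrightarrow> continuous_on A (\<lambda>x. reflect k (f x))"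
  unfolding reflect_def by (intro continuous_intros)

lemma reflect_invariant:
  fixes k :: "'d::finite"
  shows "distr collision_measure borel (\<lambda>(\<xi>, \<xi>1, \<Theta>). (reflect k \<xi>, reflect k \<xi>1, reflect k \<Theta>)) = collision_measure"
proof -
  let ?U = "\<lambda>(\<Theta> :: real ^ 'd) p. (reflect k (fst p), reflect k (snd p))"
  have e: "(\<lambda>(\<xi>, \<xi>1, \<Theta>). (reflect k \<xi>, reflect k \<xi>1, reflect k \<Theta>)) =
    (\<lambda>(\<xi>, \<xi>1, \<Theta>). (fst (?U \<Theta> (\<xi>, \<xi>1)), snd (?U \<Theta> (\<xi>, \<xi>1)), reflect k \<Theta>))"
    by auto
  show ?thesis
    unfolding e
  proof (rule collision_measure_invariant)
    show "orthogonal_transformation (?U \<Theta>)" for \<Theta> :: "real ^ 'd"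
      unfolding orthogonal_transformation_def
      by (auto simp: inner_prod_def inner_reflect linear_iff linear_add[OF linear_reflect] linear_scale[OF linear_reflect])
    show "orthogonal_transformation (reflect k :: real ^ 'd \<Rightarrow> _)"
      by (simp add: orthogonal_transformation_def linear_reflect inner_reflect)
    show "(\<lambda>(\<xi>, \<xi>1, \<Theta>). (fst (?U \<Theta> (\<xi>, \<xi>1)), snd (?U \<Theta> (\<xi>, \<xi>1)), reflect k \<Theta>)) \<in> borel_measurable borel"
      unfolding case_prod_beta fst_conv snd_conv by (intro borel_measurable_continuous_onI continuous_intros)
  qed
qed

lemma invariant_integral:
  fixes F :: "('d::finite) collision \<Rightarrow> real"
  assumes inv: "distr collision_measure borel \<Phi> = collision_measure"
    and m: "\<Phi> \<in> measurable borel borel" and F: "integrable collision_measure F"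
  shows "integrable collision_measure (\<lambda>x. F (\<Phi> x))" "(LINT x|collision_measure. F (\<Phi> x)) = (LINT x|collision_measure. F x)"
proof -
  have m': "\<Phi> \<in> measurable collision_measure borel" using m by (simp only: measurable_to_collision_measure)
  have Fm: "F \<in> borel_measurable borel"
    using borel_measurable_integrable[OF F] by (simp only: measurable_collision_measure)
  show "integrable collision_measure (\<lambda>x. F (\<Phi> x))"
    using F integrable_distr_eq[OF m' Fm] by (simp only: inv)
  show "(LINT x|collision_measure. F (\<Phi> x)) = (LINT x|collision_measure. F x)"
    using integral_distr[OF m' Fm] by (simp only: inv)
qed

lemma post_exchange:
  "post1 \<xi>1 \<xi> \<Theta> = post2 \<xi> \<xi>1 \<Theta>" "post2 \<xi>1 \<xi> \<Theta> = post1 \<xi> \<xi>1 \<Theta>"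
  by (simp_all add: post1_def post2_def inner_diff_left algebra_simps)

lemma K_val_exchange: "K_val g (exchange x) = K_val g x"
proof (cases x)
  case (fields a b c)
  show ?thesis
    unfolding fields K_val_def K_op_def exchange_def by (simp add: post_exchange[of b a c])
qed

lemma weight_exchange: "weight B (exchange x) = weight B x"
proof (cases x)
  case (fields a b c)
  have "inner (b - a) c = - inner (a - b) c" by (simp add: inner_diff_left)
  thus ?thesis by (simp add: fields weight_def exchange_def kernel_at_def norm_minus_commute)
qed

text \<open>
Reversibility: a collision with the same \<open>\<Theta>\<close> undoes the previous one. The component of the relative
velocity along \<open>\<Theta>\<close> changes its sign.
\<close>

lemma post_twice:
  fixes \<Theta> :: "real ^ 'd::finite"
  assumes "norm \<Theta> = 1"
  shows "post1 (post1 a b \<Theta>) (post2 a b \<Theta>) \<Theta> = a" "post2 (post1 a b \<Theta>) (post2 a b \<Theta>) \<Theta> = b"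
    "post1 a b \<Theta> - post2 a b \<Theta> = (a - b) - (2 * inner (a - b) \<Theta>) *\<^sub>R \<Theta>"
    "inner (post1 a b \<Theta> - post2 a b \<Theta>) \<Theta> = - inner (a - b) \<Theta>"
proof -
  have 1: "inner \<Theta> \<Theta> = 1" using assms by (simp add: norm_eq_1)
  have "(2 * inner (a - b) \<Theta>) *\<^sub>R \<Theta> = inner (a - b) \<Theta> *\<^sub>R \<Theta> + inner (a - b) \<Theta> *\<^sub>R \<Theta>"
    by (simp add: scaleR_add_left[symmetric])
  thus d: "post1 a b \<Theta> - post2 a b \<Theta> = (a - b) - (2 * inner (a - b) \<Theta>) *\<^sub>R \<Theta>"
    by (simp add: post1_def post2_def)
  show i: "inner (post1 a b \<Theta> - post2 a b \<Theta>) \<Theta> = - inner (a - b) \<Theta>"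
    unfolding d by (simp only: inner_diff_left[of "a - b"] inner_scaleR_left 1)
  show "post1 (post1 a b \<Theta>) (post2 a b \<Theta>) \<Theta> = a"
    unfolding post1_def[of "post1 a b \<Theta>"] i by (simp add: post1_def)
  show "post2 (post1 a b \<Theta>) (post2 a b \<Theta>) \<Theta> = b"
    unfolding post2_def[of "post1 a b \<Theta>"] i by (simp add: post2_def)
qed

lemma K_val_collide:
  assumes "norm (snd (snd x)) = 1"
  shows "K_val g (collide x) = - K_val g x"
  using assms by (auto simp: K_val_def K_op_def collide_def post_twice split: prod.split)

lemma weight_collide:
  fixes x :: "('d::finite) collision"
  assumes "norm (snd (snd x)) = 1"
  shows "weight B (collide x) = weight B x"
proof -
  obtain a b c where x: "x = (a, b, c)" by (cases x)
  have c: "norm c = 1" using assms by (simp add: x)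
  have "gauss (post1 a b c) * gauss (post2 a b c) = gauss a * gauss b"
  proof -
    have e: "gauss u * gauss v = (2 * pi) powr (- real CARD('d) / 2) * (2 * pi) powr (- real CARD('d) / 2)
        * exp (- (inner u u + inner v v) / 2)" for u v :: "real ^ 'd"
      by (simp add: gauss_def dot_square_norm exp_add[symmetric] field_simps)
    show ?thesis unfolding e inner_collision[OF c] ..
  qed
  moreover have "norm (post1 a b c - post2 a b c) = norm (a - b)"
  proof -
    have "inner (post1 a b c - post2 a b c) (post1 a b c - post2 a b c) = inner (a - b) (a - b)"
    proof -
      define g where "g = a - b"
      have "inner (g - (2 * inner g c) *\<^sub>R c) (g - (2 * inner g c) *\<^sub>R c) = inner g g"
        using c by (simp add: inner_diff_left[of g] inner_diff_right[of _ g] inner_commute[of c g] norm_eq_1)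
      thus ?thesis unfolding post_twice(3)[OF c] g_def .
    qed
    thus ?thesis by (simp add: norm_eq_sqrt_inner)
  qed
  ultimately show ?thesis
    by (simp add: x weight_def collide_def kernel_at_def post_twice(4)[OF c])
qed

lemma AE_norm_collision_measure: "AE x in collision_measure. norm (snd (snd (x :: ('d::finite) collision))) = 1"
proof -
  define Z where "Z = {x :: 'd collision. norm (snd (snd x)) \<noteq> 1}"
  have Z: "Z \<in> sets borel"
    unfolding Z_def by (intro borel_open open_Collect_neq continuous_intros)
  have "emeasure collision_measure Z = (\<integral>\<^sup>+x. indicator Z x \<partial>collision_measure)"
    by (rule nn_integral_indicator[symmetric]) (use Z in \<open>simp only: sets_collision_measure\<close>)
  also have "\<dots> = (\<integral>\<^sup>+\<Theta>. (\<integral>\<^sup>+p. indicator Z (fst p, snd p, \<Theta>) \<partial>lborel) \<partial>sphere_measure)"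
    by (rule nn_integral_collision_measure) (use Z in measurable)
  also have "\<dots> = (\<integral>\<^sup>+(\<Theta> :: real ^ 'd). 0 \<partial>sphere_measure)"
    by (rule nn_integral_cong_AE, use AE_norm_sphere_measure in eventually_elim) (simp add: Z_def)
  finally have "Z \<in> null_sets collision_measure" using Z
    by (intro null_setsI) (simp_all only: sets_collision_measure nn_integral_const mult_zero_left)
  from AE_not_in[OF this] show ?thesis by (simp add: Z_def)
qed

lemma collision_kernelD:
  assumes "collision_kernel TYPE('d::finite) M B"
  shows "(\<lambda>(r, c). B r c) \<in> borel_measurable borel" "\<And>r c. 0 \<le> B r c"
    "\<not> (AE x :: 'd collision in collision_measure. weight B x = 0)"
    "\<And>\<alpha> \<beta> :: nat ^ 'd. \<alpha> \<in> all_indices M \<Longrightarrow> \<beta> \<in> all_indices M \<Longrightarrow>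
       integrable collision_measure (\<lambda>x. K_val (hermite \<beta>) x * weight B x * hermite \<alpha> (fst x))"
proof -
  note C = assms[unfolded collision_kernel_def]
  show "(\<lambda>(r, c). B r c) \<in> borel_measurable borel" "\<And>r c. 0 \<le> B r c" using C by blast+
  have w: "weight B x = 0 \<longleftrightarrow> (case x of (\<xi>, \<xi>1, \<Theta>) \<Rightarrow> kernel_at B \<xi> \<xi>1 \<Theta> = 0)" for x :: "'d collision"
    using gauss_pos[of "fst x"] gauss_pos[of "fst (snd x)"] by (auto simp: weight_def split: prod.split)
  show "\<not> (AE x :: 'd collision in collision_measure. weight B x = 0)"
    unfolding w using C by blast
  show "integrable collision_measure (\<lambda>x. K_val (hermite \<beta>) x * weight B x * hermite \<alpha> (fst x))"
    if "\<alpha> \<in> all_indices M" "\<beta> \<in> all_indices M" for \<alpha> \<beta> :: "nat ^ 'd"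
  proof -
    have "integrable collision_measure (\<lambda>(\<xi> :: real ^ 'd, \<xi>1, \<Theta>).
       K_op (hermite \<beta>) \<xi> \<xi>1 \<Theta> * gauss \<xi> * gauss \<xi>1 * kernel_at B \<xi> \<xi>1 \<Theta> * hermite \<alpha> \<xi>)"
      using C that by blast
    thus ?thesis unfolding K_val_def weight_def case_prod_beta by (simp only: mult.assoc)
  qed
qed

text \<open>
Fubini, which is justified by the absolute convergence that is part of the notion of a collision
kernel.
\<close>

lemma boltzmann_matrix_integral:
  assumes B: "collision_kernel TYPE('d::finite) M B" and ab: "\<alpha> \<in> all_indices M" "\<beta> \<in> all_indices M"
  shows "boltzmann_matrix B \<alpha> \<beta> =
    - (LINT x|collision_measure. K_val (hermite \<beta>) x * weight B x * hermite \<alpha> (fst (x :: 'd collision)))"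
proof -
  define F where "F x = K_val (hermite \<beta>) x * weight B x * hermite \<alpha> (fst x)" for x :: "'d collision"
  have F: "integrable collision_measure F" unfolding F_def by (rule collision_kernelD(4)[OF B ab])
  have Fm: "F \<in> borel_measurable (lborel \<Otimes>\<^sub>M (lborel \<Otimes>\<^sub>M sphere_measure))" by (rule borel_measurable_integrable[OF F])
  have inner: "linearized_boltzmann B (\<lambda>x. gauss x * hermite \<beta> x) \<xi> * hermite \<alpha> \<xi>
      = (LINT \<xi>1|lborel. (LINT \<Theta>|sphere_measure. F (\<xi>, \<xi>1, \<Theta>)))" for \<xi>
  proof -
    have g: "(\<lambda>x :: real ^ 'd. gauss x * hermite \<beta> x / gauss x) = hermite \<beta>"
      by (rule ext) (simp add: less_imp_neq[OF gauss_pos, symmetric])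
    show ?thesis
      unfolding linearized_boltzmann_def g F_def K_val_def weight_def
      by (simp add: mult.assoc del: integral_mult_left_zero integral_mult_right_zero
        add: integral_mult_left_zero[symmetric])
  qed
  have ae: "AE \<xi> in lborel. (LINT \<xi>1|lborel. (LINT \<Theta>|sphere_measure. F (\<xi>, \<xi>1, \<Theta>))) = (LINT y|(lborel \<Otimes>\<^sub>M sphere_measure). F (\<xi>, y))"
    using lborel_lborel_sphere.AE_integrable_fst'[OF F]
  proof eventually_elim
    case (elim \<xi>)
    from lborel_sphere.integral_fst'[OF elim] show ?case by simp
  qed
  have "(LINT \<xi>|lborel. linearized_boltzmann B (\<lambda>x. gauss x * hermite \<beta> x) \<xi> * hermite \<alpha> \<xi>)
     = (LINT \<xi>|lborel. (LINT y|(lborel \<Otimes>\<^sub>M sphere_measure). F (\<xi>, y)))"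
    unfolding inner using ae
    by (intro integral_cong_AE) (use Fm in measurable)
  also have "\<dots> = (LINT x|collision_measure. F x)"
    by (rule lborel_lborel_sphere.integral_fst'[OF F])
  finally show ?thesis by (simp add: boltzmann_matrix_def F_def)
qed

lemma measurable_exchange: "exchange \<in> measurable borel borel"
  unfolding exchange_def case_prod_beta by (intro borel_measurable_continuous_onI continuous_intros)

lemma measurable_collide: "collide \<in> measurable borel borel"
  unfolding collide_def case_prod_beta by (intro borel_measurable_continuous_onI continuous_intros)

text \<open>
The classical symmetrization. The weight is invariant under the exchange of the two particles and under the
collision; \<open>K g\<close> is invariant under the former and changes its sign under the latter. So
the factor \<open>\<phi>\<^sub>\<alpha>(\<xi>)\<close> may be replaced by \<open>\<phi>\<^sub>\<alpha>(\<xi>\<^sub>1)\<close>, \<open>- \<phi>\<^sub>\<alpha>(\<xi>')\<close> and \<open>- \<phi>\<^sub>\<alpha>(\<xi>\<^sub>1')\<close>, and the average of the four is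
\<open>- K \<phi>\<^sub>\<alpha> / 4\<close>.
\<close>

theorem boltzmann_matrix_symmetrized:
  assumes B: "collision_kernel TYPE('d::finite) M B" and ab: "\<alpha> \<in> all_indices M" "\<beta> \<in> all_indices M"
  shows "integrable collision_measure (\<lambda>x :: 'd collision. K_val (hermite \<alpha>) x * K_val (hermite \<beta>) x * weight B x)"
    and "boltzmann_matrix B \<alpha> \<beta> =
      1 / 4 * (LINT x|collision_measure. K_val (hermite \<alpha>) x * K_val (hermite \<beta>) x * weight B (x :: 'd collision))"
proof -
  let ?\<mu> = "collision_measure :: 'd collision measure"
  define F1 where "F1 x = K_val (hermite \<beta>) x * weight B x * hermite \<alpha> (fst x)" for x :: "'d collision"
  define F2 where "F2 x = F1 (exchange x)" for x
  define F3 where "F3 x = F1 (collide x)" for x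
  define F4 where "F4 x = F2 (collide x)" for x
  define G where "G x = K_val (hermite \<alpha>) x * K_val (hermite \<beta>) x * weight B x" for x :: "'d collision"
  have i1: "integrable ?\<mu> F1" unfolding F1_def by (rule collision_kernelD(4)[OF B ab])
  have i2: "integrable ?\<mu> F2" "(LINT x|?\<mu>. F2 x) = (LINT x|?\<mu>. F1 x)"
    unfolding F2_def by (rule invariant_integral[OF exchange_invariant measurable_exchange i1])+
  have i3: "integrable ?\<mu> F3" "(LINT x|?\<mu>. F3 x) = (LINT x|?\<mu>. F1 x)"
    unfolding F3_def by (rule invariant_integral[OF collide_invariant measurable_collide i1])+
  have i4: "integrable ?\<mu> F4" "(LINT x|?\<mu>. F4 x) = (LINT x|?\<mu>. F2 x)"
    unfolding F4_def by (rule invariant_integral[OF collide_invariant measurable_collide i2(1)])+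
  have wm: "weight B \<in> borel_measurable (borel :: 'd collision measure)"
    by (rule measurable_weight[OF collision_kernelD(1)[OF B]])
  have Gm: "G \<in> borel_measurable ?\<mu>"
    unfolding G_def measurable_collision_measure
    by (intro borel_measurable_times measurable_K_hermite wm)
  have Sm: "(\<lambda>x. - F3 x - F4 x - F1 x - F2 x) \<in> borel_measurable ?\<mu>"
    by (intro borel_measurable_diff borel_measurable_uminus borel_measurable_integrable i1 i2(1) i3(1) i4(1))
  have si: "integrable ?\<mu> (\<lambda>x. - F3 x - F4 x - F1 x - F2 x)"
    by (intro Bochner_Integration.integrable_diff Bochner_Integration.integrable_minus i1 i2(1) i3(1) i4(1))
  have ae: "AE x in ?\<mu>. G x = - F3 x - F4 x - F1 x - F2 x"
    using AE_norm_collision_measure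
  proof eventually_elim
    case (elim x)
    obtain a b c where x: "x = (a, b, c)" by (cases x)
    have 2: "F2 x = K_val (hermite \<beta>) x * weight B x * hermite \<alpha> b"
      unfolding F2_def F1_def K_val_exchange weight_exchange by (simp add: x exchange_def)
    have 3: "F3 x = - (K_val (hermite \<beta>) x * weight B x * hermite \<alpha> (post1 a b c))"
      unfolding F3_def F1_def K_val_collide[OF elim] weight_collide[OF elim] by (simp add: x collide_def)
    have 4: "F4 x = - (K_val (hermite \<beta>) x * weight B x * hermite \<alpha> (post2 a b c))"
      unfolding F4_def F2_def F1_def K_val_exchange weight_exchange K_val_collide[OF elim] weight_collide[OF elim]
      by (simp add: x collide_def exchange_def)
    have 1: "F1 x = K_val (hermite \<beta>) x * weight B x * hermite \<alpha> a" by (simp add: F1_def x)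
    have K: "K_val (hermite \<alpha>) x = hermite \<alpha> (post1 a b c) + hermite \<alpha> (post2 a b c) - hermite \<alpha> a - hermite \<alpha> b"
      by (simp add: K_val_def K_op_def x)
    show ?case unfolding 1 2 3 4 G_def K by (simp add: algebra_simps)
  qed
  have "integrable ?\<mu> G" using integrable_cong_AE[OF Gm Sm ae] si by blast
  thus "integrable ?\<mu> (\<lambda>x. K_val (hermite \<alpha>) x * K_val (hermite \<beta>) x * weight B x)" unfolding G_def .
  have "(LINT x|?\<mu>. G x) = (LINT x|?\<mu>. - F3 x - F4 x - F1 x - F2 x)" by (rule integral_cong_AE[OF Gm Sm ae])
  also have "\<dots> = - (LINT x|?\<mu>. F3 x) - (LINT x|?\<mu>. F4 x) - (LINT x|?\<mu>. F1 x) - (LINT x|?\<mu>. F2 x)"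
    using i1 i2(1) i3(1) i4(1) by simp
  also have "\<dots> = - 4 * (LINT x|?\<mu>. F1 x)" unfolding i4(2) i3(2) i2(2) by simp
  finally show "boltzmann_matrix B \<alpha> \<beta> = 1 / 4 * (LINT x|?\<mu>. K_val (hermite \<alpha>) x * K_val (hermite \<beta>) x * weight B x)"
    unfolding boltzmann_matrix_integral[OF B ab] F1_def[symmetric] G_def[symmetric] by simp
qed

lemma hermite_reflect: "hermite \<alpha> (reflect k \<xi>) = (- 1) ^ vec_nth \<alpha> k * hermite \<alpha> \<xi>"
proof -
  have "hermite \<alpha> (reflect k \<xi>) = (\<Prod>i\<in>UNIV. (if i = k then (- 1) ^ vec_nth \<alpha> k else 1) * poly (hpoly (vec_nth \<alpha> i)) (vec_nth \<xi> i))"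
    unfolding hermite_prod by (rule prod.cong) (auto simp: vec_nth_reflect hpoly_minus)
  thus ?thesis by (simp add: prod.distrib hermite_prod)
qed

lemma K_val_reflect:
  "K_val (hermite \<alpha>) (reflect k a, reflect k b, reflect k c) = (- 1) ^ vec_nth \<alpha> k * K_val (hermite \<alpha>) (a, b, c)"
proof -
  have r: "reflect k x - reflect k y = reflect k (x - y)" "reflect k x + reflect k y = reflect k (x + y)"
    "t *\<^sub>R reflect k x = reflect k (t *\<^sub>R x)" for x y t
    by (simp_all add: linear_diff[OF linear_reflect] linear_add[OF linear_reflect] linear_scale[OF linear_reflect])
  show ?thesis
    unfolding K_val_def K_op_def post1_def post2_def case_prod_conv r inner_reflect hermite_reflect
    by (simp add: algebra_simps)
qed

lemma weight_reflect: "weight B (reflect k a, reflect k b, reflect k c) = weight B (a, b, c)"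
proof -
  have "reflect k a - reflect k b = reflect k (a - b)" by (simp add: linear_diff[OF linear_reflect])
  thus ?thesis by (simp add: weight_def kernel_at_def gauss_def norm_reflect inner_reflect)
qed

text \<open>
Reflection of all velocities in direction \<open>k\<close> leaves the measure and the weight invariant and multiplies
\<open>\<phi>\<^sub>\<alpha>\<close> by \<open>(-1)\<close> to the power \<open>\<alpha>\<^sub>k\<close>.
\<close>

theorem boltzmann_matrix_parity:
  fixes \<alpha> \<beta> :: "nat ^ 'd::finite"
  assumes B: "collision_kernel TYPE('d) M B" and ab: "\<alpha> \<in> all_indices M" "\<beta> \<in> all_indices M"
    and par: "even (vec_nth \<alpha> k) \<noteq> even (vec_nth \<beta> k)"
  shows "boltzmann_matrix B \<alpha> \<beta> = 0"
proof -
  let ?\<mu> = "collision_measure :: 'd collision measure"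
  let ?\<Phi> = "\<lambda>(\<xi>, \<xi>1, \<Theta>). (reflect k \<xi>, reflect k \<xi>1, reflect k \<Theta>)"
  define G where "G x = K_val (hermite \<alpha>) x * K_val (hermite \<beta>) x * weight B x" for x :: "'d collision"
  have "integrable ?\<mu> G" unfolding G_def by (rule boltzmann_matrix_symmetrized(1)[OF B ab])
  moreover have "?\<Phi> \<in> measurable borel borel"
    unfolding case_prod_beta by (intro borel_measurable_continuous_onI continuous_intros)
  ultimately have "(LINT x|?\<mu>. G (?\<Phi> x)) = (LINT x|?\<mu>. G x)"
    by (rule invariant_integral(2)[OF reflect_invariant, rotated])
  moreover have "G (?\<Phi> x) = - G x" for x
  proof (cases x)
    case (fields a b c)
    have "(- 1) ^ vec_nth \<alpha> k * (- 1) ^ vec_nth \<beta> k = (- 1 :: real)" using par by (auto simp: minus_one_power_iff)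
    thus ?thesis
      by (simp add: fields G_def K_val_reflect weight_reflect mult_ac)
         (simp add: mult.assoc[symmetric])
  qed
  ultimately have "(LINT x|?\<mu>. G x) = 0" by simp
  thus ?thesis unfolding boltzmann_matrix_symmetrized(2)[OF B ab] G_def[symmetric] by simp
qed

lemma boltzmann_matrix_sym:
  fixes \<alpha> \<beta> :: "nat ^ 'd::finite"
  assumes B: "collision_kernel TYPE('d) M B" and ab: "\<alpha> \<in> all_indices M" "\<beta> \<in> all_indices M"
  shows "boltzmann_matrix B \<alpha> \<beta> = boltzmann_matrix B \<beta> \<alpha>"
  unfolding boltzmann_matrix_symmetrized(2)[OF B ab] boltzmann_matrix_symmetrized(2)[OF B ab(2,1)]
  by (simp add: mult_ac)

lemma boltzmann_matrix_quadratic_form: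
  fixes v :: "nat ^ 'd::finite \<Rightarrow> real"
  assumes B: "collision_kernel TYPE('d) M B" and I: "finite I" "I \<subseteq> all_indices M"
  shows "integrable collision_measure (\<lambda>x. (\<Sum>\<alpha>\<in>I. v \<alpha> * K_val (hermite \<alpha>) x)\<^sup>2 * weight B x)"
    and "(\<Sum>\<alpha>\<in>I. \<Sum>\<beta>\<in>I. v \<alpha> * v \<beta> * boltzmann_matrix B \<alpha> \<beta>)
    = 1 / 4 * (LINT x|collision_measure. (\<Sum>\<alpha>\<in>I. v \<alpha> * K_val (hermite \<alpha>) x)\<^sup>2 * weight B x)"
proof -
  have e: "(\<Sum>\<alpha>\<in>I. v \<alpha> * K_val (hermite \<alpha>) x)\<^sup>2 * weight B x
    = (\<Sum>\<alpha>\<in>I. \<Sum>\<beta>\<in>I. v \<alpha> * v \<beta> * (K_val (hermite \<alpha>) x * K_val (hermite \<beta>) x * weight B x))" for x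
    unfolding power2_eq_square sum_product by (simp add: sum_distrib_left sum_distrib_right mult_ac)
  have i: "integrable collision_measure (\<lambda>x. v \<alpha> * v \<beta> * (K_val (hermite \<alpha>) x * K_val (hermite \<beta>) x * weight B x))"
    if "\<alpha> \<in> I" "\<beta> \<in> I" for \<alpha> \<beta>
    by (intro integrable_mult_right boltzmann_matrix_symmetrized(1)[OF B]) (use that I in auto)
  show "integrable collision_measure (\<lambda>x. (\<Sum>\<alpha>\<in>I. v \<alpha> * K_val (hermite \<alpha>) x)\<^sup>2 * weight B x)"
    unfolding e by (intro Bochner_Integration.integrable_sum i)
  have "(LINT x|collision_measure. (\<Sum>\<alpha>\<in>I. v \<alpha> * K_val (hermite \<alpha>) x)\<^sup>2 * weight B x)
    = (\<Sum>\<alpha>\<in>I. \<Sum>\<beta>\<in>I. (LINT x|collision_measure. v \<alpha> * v \<beta> * (K_val (hermite \<alpha>) x * K_val (hermite \<beta>) x * weight B x)))"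
  proof -
    have "(LINT x|collision_measure. (\<Sum>\<alpha>\<in>I. \<Sum>\<beta>\<in>I. v \<alpha> * v \<beta> * (K_val (hermite \<alpha>) x * K_val (hermite \<beta>) x * weight B x)))
      = (\<Sum>\<alpha>\<in>I. (LINT x|collision_measure. (\<Sum>\<beta>\<in>I. v \<alpha> * v \<beta> * (K_val (hermite \<alpha>) x * K_val (hermite \<beta>) x * weight B x))))"
      by (intro Bochner_Integration.integral_sum Bochner_Integration.integrable_sum i)
    also have "\<dots> = (\<Sum>\<alpha>\<in>I. \<Sum>\<beta>\<in>I. (LINT x|collision_measure. v \<alpha> * v \<beta> * (K_val (hermite \<alpha>) x * K_val (hermite \<beta>) x * weight B x)))"
      by (intro sum.cong[OF refl] Bochner_Integration.integral_sum i)
    finally show ?thesis unfolding e .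
  qed
  also have "\<dots> = (\<Sum>\<alpha>\<in>I. \<Sum>\<beta>\<in>I. 4 * (v \<alpha> * v \<beta> * boltzmann_matrix B \<alpha> \<beta>))"
  proof (intro sum.cong[OF refl])
    fix \<alpha> \<beta> assume ab: "\<alpha> \<in> I" "\<beta> \<in> I"
    hence "\<alpha> \<in> all_indices M" "\<beta> \<in> all_indices M" using I by auto
    from boltzmann_matrix_symmetrized(2)[OF B this]
    show "(LINT x|collision_measure. v \<alpha> * v \<beta> * (K_val (hermite \<alpha>) x * K_val (hermite \<beta>) x * weight B x))
      = 4 * (v \<alpha> * v \<beta> * boltzmann_matrix B \<alpha> \<beta>)" by (simp only: integral_mult_right_zero)
  qed
  finally show "(\<Sum>\<alpha>\<in>I. \<Sum>\<beta>\<in>I. v \<alpha> * v \<beta> * boltzmann_matrix B \<alpha> \<beta>)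
    = 1 / 4 * (LINT x|collision_measure. (\<Sum>\<alpha>\<in>I. v \<alpha> * K_val (hermite \<alpha>) x)\<^sup>2 * weight B x)"
    by (simp add: sum_distrib_left[symmetric])
qed

section \<open>Zeros of rational functions\<close>

text \<open>
Functions that are rational along every line through \<open>a\<close>, with a denominator that does not vanish at
\<open>a\<close>. The class has the closure properties of rational functions defined at \<open>a\<close>, and only the behaviour along
lines matters for the size of the zero set. The values at the zeros of the denominator are arbitrary,
so that \<open>inverse 0 = 0\<close> does no harm.
\<close>

definition rational_on_lines :: "'a::real_vector \<Rightarrow> ('a \<Rightarrow> real) \<Rightarrow> bool" where
  "rational_on_lines a F \<longleftrightarrow>
     (\<forall>u. \<exists>p q. poly q 0 \<noteq> 0 \<and> (\<forall>t. poly q t \<noteq> 0 \<longrightarrow> F (a + t *\<^sub>R u) = poly p t / poly q t))"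

lemma rational_on_linesI:
  assumes "\<And>u. \<exists>p q. poly q 0 \<noteq> 0 \<and> (\<forall>t. poly q t \<noteq> 0 \<longrightarrow> F (a + t *\<^sub>R u) = poly p t / poly q t)"
  shows "rational_on_lines a F"
  using assms by (auto simp: rational_on_lines_def)

lemma rational_on_linesE:
  assumes "rational_on_lines a F"
  obtains p q where "poly q 0 \<noteq> 0" "\<And>t. poly q t \<noteq> 0 \<Longrightarrow> F (a + t *\<^sub>R u) = poly p t / poly q t"
  using assms unfolding rational_on_lines_def by metis

lemma rational_on_lines_linear:
  assumes "linear F" shows "rational_on_lines a F"
proof (rule rational_on_linesI)
  fix u
  show "\<exists>p q. poly q 0 \<noteq> 0 \<and> (\<forall>t. poly q t \<noteq> 0 \<longrightarrow> F (a + t *\<^sub>R u) = poly p t / poly q t)"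
    by (rule exI[of _ "[:F a, F u:]"], rule exI[of _ 1]) (simp add: linear_add[OF assms] linear_scale[OF assms])
qed

lemma rational_on_lines_const: "rational_on_lines a (\<lambda>_. c)"
proof (rule rational_on_linesI)
  fix u
  show "\<exists>p q. poly q 0 \<noteq> 0 \<and> (\<forall>t. poly q t \<noteq> 0 \<longrightarrow> c = poly p t / poly q t)"
    by (rule exI[of _ "[:c:]"], rule exI[of _ 1]) simp
qed

lemma rational_on_lines_add:
  assumes "rational_on_lines a F" "rational_on_lines a G"
  shows "rational_on_lines a (\<lambda>x. F x + G x)"
proof (rule rational_on_linesI)
  fix u
  obtain p q where 1: "poly q 0 \<noteq> 0" "\<And>t. poly q t \<noteq> 0 \<Longrightarrow> F (a + t *\<^sub>R u) = poly p t / poly q t"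
    by (rule rational_on_linesE[OF assms(1), of u]) (rule that; assumption)
  obtain p' q' where 2: "poly q' 0 \<noteq> 0" "\<And>t. poly q' t \<noteq> 0 \<Longrightarrow> G (a + t *\<^sub>R u) = poly p' t / poly q' t"
    by (rule rational_on_linesE[OF assms(2), of u]) (rule that; assumption)
  show "\<exists>p q. poly q 0 \<noteq> 0 \<and> (\<forall>t. poly q t \<noteq> 0 \<longrightarrow> F (a + t *\<^sub>R u) + G (a + t *\<^sub>R u) = poly p t / poly q t)"
    by (rule exI[of _ "p * q' + p' * q"], rule exI[of _ "q * q'"]) (use 1 2 in \<open>auto simp: add_frac_eq\<close>)
qed

lemma rational_on_lines_mult:
  assumes "rational_on_lines a F" "rational_on_lines a G"
  shows "rational_on_lines a (\<lambda>x. F x * G x)"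
proof (rule rational_on_linesI)
  fix u
  obtain p q where 1: "poly q 0 \<noteq> 0" "\<And>t. poly q t \<noteq> 0 \<Longrightarrow> F (a + t *\<^sub>R u) = poly p t / poly q t"
    by (rule rational_on_linesE[OF assms(1), of u]) (rule that; assumption)
  obtain p' q' where 2: "poly q' 0 \<noteq> 0" "\<And>t. poly q' t \<noteq> 0 \<Longrightarrow> G (a + t *\<^sub>R u) = poly p' t / poly q' t"
    by (rule rational_on_linesE[OF assms(2), of u]) (rule that; assumption)
  show "\<exists>p q. poly q 0 \<noteq> 0 \<and> (\<forall>t. poly q t \<noteq> 0 \<longrightarrow> F (a + t *\<^sub>R u) * G (a + t *\<^sub>R u) = poly p t / poly q t)"
    by (rule exI[of _ "p * p'"], rule exI[of _ "q * q'"]) (use 1 2 in auto)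
qed

lemma rational_on_lines_inverse:
  assumes F: "rational_on_lines a F" and 0: "F a \<noteq> 0"
  shows "rational_on_lines a (\<lambda>x. inverse (F x))"
proof (rule rational_on_linesI)
  fix u
  obtain p q where 1: "poly q 0 \<noteq> 0" "\<And>t. poly q t \<noteq> 0 \<Longrightarrow> F (a + t *\<^sub>R u) = poly p t / poly q t"
    by (rule rational_on_linesE[OF assms(1), of u]) (rule that; assumption)
  have "poly p 0 \<noteq> 0" using 1(2)[OF 1(1)] 0 by auto
  thus "\<exists>p q. poly q 0 \<noteq> 0 \<and> (\<forall>t. poly q t \<noteq> 0 \<longrightarrow> inverse (F (a + t *\<^sub>R u)) = poly p t / poly q t)"
    by (intro exI[of _ "q * q"] exI[of _ "p * q"]) (use 1 in auto)
qed

lemma rational_on_lines_diff: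
  assumes "rational_on_lines a F" "rational_on_lines a G"
  shows "rational_on_lines a (\<lambda>x. F x - G x)"
  using rational_on_lines_add[OF assms(1) rational_on_lines_mult[OF rational_on_lines_const[of a "-1"] assms(2)]]
  by simp

lemma rational_on_lines_sum:
  assumes "\<And>i. i \<in> A \<Longrightarrow> rational_on_lines a (F i)"
  shows "rational_on_lines a (\<lambda>x. \<Sum>i\<in>A. F i x)"
  using assms by (induction A rule: infinite_finite_induct)
    (auto intro: rational_on_lines_add rational_on_lines_const)

lemma rational_on_lines_prod:
  assumes "\<And>i. i \<in> A \<Longrightarrow> rational_on_lines a (F i)"
  shows "rational_on_lines a (\<lambda>x. \<Prod>i\<in>A. F i x)"
  using assms by (induction A rule: infinite_finite_induct)
    (auto intro: rational_on_lines_mult rational_on_lines_const)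

lemma rational_on_lines_poly:
  assumes "rational_on_lines a F"
  shows "rational_on_lines a (\<lambda>x. poly P (F x))"
proof (induction P)
  case (pCons c P)
  have "rational_on_lines a (\<lambda>x. c + F x * poly P (F x))"
    by (intro rational_on_lines_add rational_on_lines_mult rational_on_lines_const assms pCons.IH)
  thus ?case by simp
qed (simp add: rational_on_lines_const)

text \<open>
On each ray from \<open>a\<close> there are only finitely many zeros. By Fubini the preimage of the zero set under the
dilation with centre \<open>a\<close> and factor \<open>t\<close> is a null set for almost all \<open>t\<close> in the unit interval, and
a dilation only rescales the measure.
\<close>

theorem rational_on_lines_AE_nonzero:
  fixes F :: "'a::euclidean_space \<Rightarrow> real"
  assumes F: "rational_on_lines a F" and 0: "F a \<noteq> 0" and m[measurable]: "F \<in> borel_measurable borel"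
  shows "AE x in lborel. F x \<noteq> 0"
proof -
  define Z where "Z = {x. F x = 0}"
  have Z[measurable]: "Z \<in> sets borel" unfolding Z_def by measurable
  \<comment> \<open>The indicator of the preimage of the zero set under the dilation with factor t.\<close>
  define h where "h t x = (if 0 < t \<and> t < 1 then indicator Z (a + t *\<^sub>R (x - a)) else 0 :: ennreal)" for t :: real and x
  have hm[measurable]: "(\<lambda>(t, x). h t x) \<in> borel_measurable (lborel \<Otimes>\<^sub>M lborel)"
    unfolding h_def by measurable
  have hm'[measurable]: "(\<lambda>(x, t). h t x) \<in> borel_measurable (lborel \<Otimes>\<^sub>M lborel)"
    unfolding h_def by measurable
  have zero: "(\<integral>\<^sup>+t. h t x \<partial>lborel) = 0" for x
  proof -
    obtain p q where 1: "poly q 0 \<noteq> 0" "\<And>t. poly q t \<noteq> 0 \<Longrightarrow> F (a + t *\<^sub>R (x - a)) = poly p t / poly q t"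
      by (rule rational_on_linesE[OF F, of "x - a"]) (rule that; assumption)
    have "poly p 0 \<noteq> 0" using 1(2)[OF 1(1)] 0 by auto
    with 1(1) have "p * q \<noteq> 0" by auto
    hence fin: "finite {t. poly (p * q) t = 0}" by (rule poly_roots_finite)
    hence "{t. poly (p * q) t = 0} \<in> null_sets lborel" by (rule finite_imp_null_set_lborel)
    hence "AE t in lborel. t \<notin> {t. poly (p * q) t = 0}" by (rule AE_not_in)
    hence "AE t in lborel. h t x = 0"
    proof eventually_elim
      case (elim t)
      thus ?case using 1(2)[of t] by (auto simp: h_def Z_def indicator_def)
    qed
    hence "(\<integral>\<^sup>+t. h t x \<partial>lborel) = (\<integral>\<^sup>+t. 0 \<partial>(lborel :: real measure))" by (rule nn_integral_cong_AE)
    thus ?thesis by simp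
  qed
  have "(\<integral>\<^sup>+t. (\<integral>\<^sup>+x. h t x \<partial>lborel) \<partial>lborel) = (\<integral>\<^sup>+x. (\<integral>\<^sup>+t. h t x \<partial>lborel) \<partial>lborel)"
    by (rule lborel_pair.Fubini') measurable
  also have "\<dots> = 0" by (simp add: zero)
  finally have "AE t in lborel. (\<integral>\<^sup>+x. h t x \<partial>lborel) = 0"
    by (subst (asm) nn_integral_0_iff_AE) auto
  moreover have "\<not> (AE t in lborel. t \<notin> {0<..<1::real})"
  proof
    assume "AE t in lborel. t \<notin> {0<..<1::real}"
    hence "emeasure lborel {0<..<1::real} = 0"
      by (subst (asm) AE_iff_measurable[of "{0<..<1::real}"]) auto
    thus False by simp
  qed
  ultimately obtain t where t: "0 < t" "t < (1::real)" "(\<integral>\<^sup>+x. h t x \<partial>lborel) = 0"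
    by (metis (mono_tags, lifting) eventually_mono greaterThanLessThan_iff)
  have "(\<integral>\<^sup>+x. indicator Z x \<partial>lborel)
      = (\<integral>\<^sup>+x. indicator Z x \<partial>density (distr lborel borel (\<lambda>x. (a - t *\<^sub>R a) + t *\<^sub>R x)) (\<lambda>_. ennreal (\<bar>t\<bar> ^ DIM('a))))"
    using lborel_affine[of t "a - t *\<^sub>R a"] t by simp
  also have "\<dots> = (\<integral>\<^sup>+x. ennreal (\<bar>t\<bar> ^ DIM('a)) * indicator Z ((a - t *\<^sub>R a) + t *\<^sub>R x) \<partial>lborel)"
    by (subst nn_integral_density, simp, simp) (subst nn_integral_distr, auto)
  also have "\<dots> = (\<integral>\<^sup>+x. ennreal (\<bar>t\<bar> ^ DIM('a)) * h t x \<partial>lborel)"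
    using t by (simp add: h_def algebra_simps)
  also have "\<dots> = 0" using t by (simp add: nn_integral_cmult)
  finally have "(\<integral>\<^sup>+x. indicator Z x \<partial>lborel) = 0" .
  hence "emeasure lborel Z = 0" by simp
  hence "Z \<in> null_sets lborel" by (intro null_setsI) auto
  from AE_not_in[OF this] show ?thesis by (simp add: Z_def)
qed

section \<open>Collision invariants\<close>

lemma hermite_directional_derivative:
  "((\<lambda>s. hermite \<alpha> (a + s *\<^sub>R u)) has_real_derivative
     (\<Sum>l\<in>UNIV. vec_nth u l * (sqrt (real (vec_nth \<alpha> l)) * hermite (\<alpha> - axis l 1) (a :: real ^ 'd::finite)))) (at 0)"
proof -
  have "((\<lambda>s. \<Prod>l\<in>UNIV. poly (hpoly (vec_nth \<alpha> l)) (vec_nth a l + s * vec_nth u l)) has_real_derivative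
     (\<Sum>l\<in>UNIV. (vec_nth u l * poly (pderiv (hpoly (vec_nth \<alpha> l))) (vec_nth a l)) *
        (\<Prod>i\<in>UNIV - {l}. poly (hpoly (vec_nth \<alpha> i)) (vec_nth a i + 0 * vec_nth u i)))) (at 0)"
  proof (rule has_field_derivative_prod)
    fix l :: 'd
    have "((\<lambda>s. vec_nth a l + s * vec_nth u l) has_real_derivative vec_nth u l) (at 0)"
      by (auto intro!: derivative_eq_intros)
    from DERIV_chain2[OF poly_DERIV this, of "hpoly (vec_nth \<alpha> l)"]
    show "((\<lambda>s. poly (hpoly (vec_nth \<alpha> l)) (vec_nth a l + s * vec_nth u l)) has_real_derivative
      vec_nth u l * poly (pderiv (hpoly (vec_nth \<alpha> l))) (vec_nth a l)) (at 0)"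
      by (simp add: mult.commute)
  qed
  also have "(\<lambda>s. \<Prod>l\<in>UNIV. poly (hpoly (vec_nth \<alpha> l)) (vec_nth a l + s * vec_nth u l)) = (\<lambda>s. hermite \<alpha> (a + s *\<^sub>R u))"
    by (simp add: hermite_prod)
  also have "(\<Sum>l\<in>UNIV. (vec_nth u l * poly (pderiv (hpoly (vec_nth \<alpha> l))) (vec_nth a l)) *
        (\<Prod>i\<in>UNIV - {l}. poly (hpoly (vec_nth \<alpha> i)) (vec_nth a i + 0 * vec_nth u i)))
     = (\<Sum>l\<in>UNIV. vec_nth u l * (sqrt (real (vec_nth \<alpha> l)) * hermite (\<alpha> - axis l 1) a))"
  proof (rule sum.cong[OF refl])
    fix l :: 'd
    have "hermite (\<alpha> - axis l 1) a = poly (hpoly (vec_nth \<alpha> l - 1)) (vec_nth a l) * (\<Prod>i\<in>UNIV - {l}. poly (hpoly (vec_nth (\<alpha> - axis l 1) i)) (vec_nth a i))"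
      unfolding hermite_prod by (subst prod.remove[of _ l]) (auto simp: axis_def)
    also have "(\<Prod>i\<in>UNIV - {l}. poly (hpoly (vec_nth (\<alpha> - axis l 1) i)) (vec_nth a i)) = (\<Prod>i\<in>UNIV - {l}. poly (hpoly (vec_nth \<alpha> i)) (vec_nth a i))"
      by (intro prod.cong) (auto simp: axis_def)
    finally show "(vec_nth u l * poly (pderiv (hpoly (vec_nth \<alpha> l))) (vec_nth a l)) *
        (\<Prod>i\<in>UNIV - {l}. poly (hpoly (vec_nth \<alpha> i)) (vec_nth a i + 0 * vec_nth u i))
     = vec_nth u l * (sqrt (real (vec_nth \<alpha> l)) * hermite (\<alpha> - axis l 1) a)"
      by (simp add: pderiv_hpoly)
  qed
  finally show ?thesis .
qed

text \<open>
The hypothesis is conservation in the collision that takes the velocities \<open>a + x\<close>, \<open>a + y\<close> with \<open>x \<bottom> y\<close> to \<open>a\<close>,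
\<open>a + x + y\<close>. Differentiated in \<open>x\<close> and \<open>y\<close> it says that \<open>\<partial>\<^sub>u \<partial>\<^sub>w f = 0\<close> for all orthogonal \<open>u\<close>, \<open>w\<close>. For two
coordinate directions this kills all coefficients with two nonzero indices; for \<open>e\<^sub>i \<plusminus> e\<^sub>j\<close> it gives
\<open>\<partial>\<^sub>i\<^sup>2 f = \<partial>\<^sub>j\<^sup>2 f\<close>, which kills the coefficients of \<open>n e\<^sub>i\<close> for \<open>n \<ge> 3\<close>.
\<close>

theorem collision_invariant_degree:
  fixes v :: "nat ^ 'd::finite \<Rightarrow> real"
  assumes fin: "finite I" and D: "2 \<le> CARD('d)"
    and inv: "\<And>a x y. inner x y = 0 \<Longrightarrow>
       (\<Sum>\<alpha>\<in>I. v \<alpha> * hermite \<alpha> (a + x)) + (\<Sum>\<alpha>\<in>I. v \<alpha> * hermite \<alpha> (a + y))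
       = (\<Sum>\<alpha>\<in>I. v \<alpha> * hermite \<alpha> a) + (\<Sum>\<alpha>\<in>I. v \<alpha> * hermite \<alpha> (a + x + y))"
    and \<alpha>: "\<alpha> \<in> I" "3 \<le> mi_abs \<alpha>"
  shows "v \<alpha> = 0"
proof -
  \<comment> \<open>T l q collects the second derivatives in directions l and q. The square roots in c vanish where
    the truncated subtraction of unit indices would be wrong.\<close>
  define c where "c \<alpha> l q = sqrt (real (vec_nth \<alpha> l)) * sqrt (real (vec_nth (\<alpha> - axis l 1) q))" for \<alpha> :: "nat ^ 'd" and l q
  define D1 where "D1 u a = (\<Sum>\<alpha>\<in>I. v \<alpha> * (\<Sum>l\<in>UNIV. vec_nth u l * (sqrt (real (vec_nth \<alpha> l)) * hermite (\<alpha> - axis l 1) a)))"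
    for u a :: "real ^ 'd"
  have d1: "((\<lambda>s. \<Sum>\<alpha>\<in>I. v \<alpha> * hermite \<alpha> (a + s *\<^sub>R u)) has_real_derivative D1 u a) (at 0)" for u a
    unfolding D1_def by (intro DERIV_sum DERIV_cmult hermite_directional_derivative)
  have const: "D1 u (a + t *\<^sub>R w) = D1 u a" if uw: "inner u w = 0" for u w a t
  proof -
    have e: "(\<Sum>\<alpha>\<in>I. v \<alpha> * hermite \<alpha> ((a + t *\<^sub>R w) + s *\<^sub>R u)) =
      (\<Sum>\<alpha>\<in>I. v \<alpha> * hermite \<alpha> (a + s *\<^sub>R u)) + ((\<Sum>\<alpha>\<in>I. v \<alpha> * hermite \<alpha> (a + t *\<^sub>R w)) - (\<Sum>\<alpha>\<in>I. v \<alpha> * hermite \<alpha> a))" for s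
      using inv[of "s *\<^sub>R u" "t *\<^sub>R w" a] uw by (simp add: algebra_simps)
    have "((\<lambda>s. \<Sum>\<alpha>\<in>I. v \<alpha> * hermite \<alpha> ((a + t *\<^sub>R w) + s *\<^sub>R u)) has_real_derivative D1 u a + 0) (at 0)"
      unfolding e by (intro DERIV_add d1 DERIV_const)
    thus ?thesis using DERIV_unique[OF d1[of "a + t *\<^sub>R w" u]] by simp
  qed
  define T where "T l q a = (\<Sum>\<alpha>\<in>I. v \<alpha> * c \<alpha> l q * hermite (\<alpha> - axis l 1 - axis q 1) a)" for l q and a :: "real ^ 'd"
  have d2: "(\<Sum>l\<in>UNIV. \<Sum>q\<in>UNIV. vec_nth u l * vec_nth w q * T l q a) = 0" if uw: "inner u w = 0" for u w a
  proof -
    have "((\<lambda>t. D1 u (a + t *\<^sub>R w)) has_real_derivative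
       (\<Sum>\<alpha>\<in>I. v \<alpha> * (\<Sum>l\<in>UNIV. vec_nth u l * (sqrt (real (vec_nth \<alpha> l)) *
          (\<Sum>q\<in>UNIV. vec_nth w q * (sqrt (real (vec_nth (\<alpha> - axis l 1) q)) * hermite (\<alpha> - axis l 1 - axis q 1) a)))))) (at 0)"
      unfolding D1_def by (intro DERIV_sum DERIV_cmult hermite_directional_derivative)
    moreover have "((\<lambda>t. D1 u (a + t *\<^sub>R w)) has_real_derivative 0) (at 0)"
      unfolding const[OF uw] by (rule DERIV_const)
    ultimately have "(\<Sum>\<alpha>\<in>I. v \<alpha> * (\<Sum>l\<in>UNIV. vec_nth u l * (sqrt (real (vec_nth \<alpha> l)) *
          (\<Sum>q\<in>UNIV. vec_nth w q * (sqrt (real (vec_nth (\<alpha> - axis l 1) q)) * hermite (\<alpha> - axis l 1 - axis q 1) a))))) = 0"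
      by (rule DERIV_unique)
    moreover have "(\<Sum>\<alpha>\<in>I. v \<alpha> * (\<Sum>l\<in>UNIV. vec_nth u l * (sqrt (real (vec_nth \<alpha> l)) *
          (\<Sum>q\<in>UNIV. vec_nth w q * (sqrt (real (vec_nth (\<alpha> - axis l 1) q)) * hermite (\<alpha> - axis l 1 - axis q 1) a)))))
      = (\<Sum>\<alpha>\<in>I. \<Sum>l\<in>UNIV. \<Sum>q\<in>UNIV. vec_nth u l * vec_nth w q * (v \<alpha> * c \<alpha> l q * hermite (\<alpha> - axis l 1 - axis q 1) a))"
      by (simp add: sum_distrib_left c_def mult_ac)
    moreover have "\<dots> = (\<Sum>l\<in>UNIV. \<Sum>\<alpha>\<in>I. \<Sum>q\<in>UNIV. vec_nth u l * vec_nth w q * (v \<alpha> * c \<alpha> l q * hermite (\<alpha> - axis l 1 - axis q 1) a))"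
      by (rule sum.swap)
    moreover have "\<dots> = (\<Sum>l\<in>UNIV. \<Sum>q\<in>UNIV. \<Sum>\<alpha>\<in>I. vec_nth u l * vec_nth w q * (v \<alpha> * c \<alpha> l q * hermite (\<alpha> - axis l 1 - axis q 1) a))"
      by (intro sum.cong[OF refl] sum.swap)
    ultimately show ?thesis by (simp add: T_def sum_distrib_left)
  qed
  have axis_sum: "(\<Sum>l\<in>UNIV. vec_nth (axis i 1 :: real ^ 'd) l * g l) = g i" for i and g :: "'d \<Rightarrow> real"
    by (simp add: axis_def if_distrib[of "\<lambda>x. x * _"] cong: if_cong)
  have Tij: "T i j a = 0" if ij: "i \<noteq> j" for i j a
  proof -
    have "(\<Sum>l\<in>UNIV. vec_nth (axis i 1 :: real ^ 'd) l * (\<Sum>q\<in>UNIV. vec_nth (axis j 1 :: real ^ 'd) q * T l q a)) = 0"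
      using d2[of "axis i 1" "axis j 1" a] ij by (simp add: inner_axis_axis sum_distrib_left mult.assoc)
    thus ?thesis unfolding axis_sum .
  qed
  have Tii: "T i i a = T j j a" if ij: "i \<noteq> j" for i j a
  proof -
    have "inner (axis i 1 + axis j 1) (axis i 1 - axis j 1 :: real ^ 'd) = 0"
      using ij by (simp add: inner_add_left inner_diff_right inner_axis_axis)
    from d2[OF this, of a]
    have "(\<Sum>l\<in>UNIV. vec_nth (axis i 1 :: real ^ 'd) l * (\<Sum>q\<in>UNIV. vec_nth (axis i 1 :: real ^ 'd) q * T l q a))
      - (\<Sum>l\<in>UNIV. vec_nth (axis i 1 :: real ^ 'd) l * (\<Sum>q\<in>UNIV. vec_nth (axis j 1 :: real ^ 'd) q * T l q a))
      + (\<Sum>l\<in>UNIV. vec_nth (axis j 1 :: real ^ 'd) l * (\<Sum>q\<in>UNIV. vec_nth (axis i 1 :: real ^ 'd) q * T l q a))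
      - (\<Sum>l\<in>UNIV. vec_nth (axis j 1 :: real ^ 'd) l * (\<Sum>q\<in>UNIV. vec_nth (axis j 1 :: real ^ 'd) q * T l q a)) = 0"
      by (simp add: sum_distrib_left sum.distrib[symmetric] sum_subtractf[symmetric] algebra_simps)
    thus ?thesis unfolding axis_sum using Tij[OF ij] Tij[OF ij[symmetric]] by simp
  qed
  have mixed: "v \<alpha> = 0" if a: "\<alpha> \<in> I" and ij: "i \<noteq> j" and pos: "1 \<le> vec_nth \<alpha> i" "1 \<le> vec_nth \<alpha> j" for \<alpha> i j
  proof -
    have "(\<Sum>\<beta>\<in>I. v \<beta> * c \<beta> i j * of_bool (\<beta> - axis i 1 - axis j 1 = \<alpha> - axis i 1 - axis j 1)) = 0"
      using Tij[OF ij] unfolding T_def by (intro hermite_coefficients AE_I2)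
    also have "(\<Sum>\<beta>\<in>I. v \<beta> * c \<beta> i j * of_bool (\<beta> - axis i 1 - axis j 1 = \<alpha> - axis i 1 - axis j 1))
      = (\<Sum>\<beta>\<in>I. if \<beta> = \<alpha> then v \<alpha> * c \<alpha> i j else 0)"
    proof (rule sum.cong[OF refl])
      fix \<beta> assume "\<beta> \<in> I"
      show "v \<beta> * c \<beta> i j * of_bool (\<beta> - axis i 1 - axis j 1 = \<alpha> - axis i 1 - axis j 1) = (if \<beta> = \<alpha> then v \<alpha> * c \<alpha> i j else 0)"
      proof (cases "c \<beta> i j = 0 \<or> \<beta> - axis i 1 - axis j 1 \<noteq> \<alpha> - axis i 1 - axis j 1")
        case False
        hence b: "vec_nth \<beta> i \<ge> 1" "vec_nth \<beta> j \<ge> 1" using ij by (auto simp: c_def axis_def Suc_le_eq)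
        have "vec_nth \<beta> l = vec_nth \<alpha> l" for l
          using arg_cong[of _ _ "\<lambda>x. vec_nth x l", OF False[simplified, THEN conjunct2]] b pos ij
          by (cases "l = i"; cases "l = j") (auto simp: axis_def)
        hence "\<beta> = \<alpha>" by (simp add: Finite_Cartesian_Product.vec_eq_iff)
        thus ?thesis by simp
      qed auto
    qed
    also have "\<dots> = v \<alpha> * c \<alpha> i j" using fin a by simp
    finally show ?thesis using pos ij by (simp add: c_def axis_def)
  qed
  show ?thesis
  proof (cases "\<exists>i j. i \<noteq> j \<and> 1 \<le> vec_nth \<alpha> i \<and> 1 \<le> vec_nth \<alpha> j")
    case True
    thus ?thesis using mixed \<alpha>(1) by blast
  next
    case False
    have "\<exists>i. 1 \<le> vec_nth \<alpha> i"
    proof (rule ccontr)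
      assume "\<not> ?thesis"
      hence "mi_abs \<alpha> = 0" by (simp add: mi_abs_def not_le)
      thus False using \<alpha>(2) by simp
    qed
    then obtain i where i: "1 \<le> vec_nth \<alpha> i" by blast
    have oth: "vec_nth \<alpha> l = 0" if "l \<noteq> i" for l using False i that by (metis One_nat_def Suc_leI not_gr_zero)
    have "mi_abs \<alpha> = vec_nth \<alpha> i + (\<Sum>l\<in>UNIV - {i}. vec_nth \<alpha> l)"
      unfolding mi_abs_def by (rule sum.remove) auto
    also have "(\<Sum>l\<in>UNIV - {i}. vec_nth \<alpha> l) = 0" using oth by simp
    finally have n: "vec_nth \<alpha> i \<ge> 3" using \<alpha>(2) by simp
    obtain j where j: "j \<noteq> i"
    proof -
      have "card (UNIV - {i} :: 'd set) > 0" using D by (subst card_Diff_singleton) auto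
      thus ?thesis using that by (metis Diff_iff card_gt_0_iff ex_in_conv singletonI)
    qed
    define \<beta> where "\<beta> = \<alpha> - axis i 1 - axis i 1"
    have b: "(\<Sum>\<delta>\<in>I. v \<delta> * c \<delta> l l * of_bool (\<delta> - axis l 1 - axis l 1 = \<beta>))
       = (\<Sum>\<delta>\<in>I. if \<delta> = \<beta> + axis l 2 then v \<delta> * c \<delta> l l else 0)" for l
    proof (rule sum.cong[OF refl])
      fix \<delta> assume "\<delta> \<in> I"
      show "v \<delta> * c \<delta> l l * of_bool (\<delta> - axis l 1 - axis l 1 = \<beta>) = (if \<delta> = \<beta> + axis l 2 then v \<delta> * c \<delta> l l else 0)"
      proof (cases "c \<delta> l l = 0")
        case False
        hence "vec_nth \<delta> l \<ge> 2" by (auto simp: c_def axis_def)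
        hence "\<delta> - axis l 1 - axis l 1 = \<beta> \<longleftrightarrow> \<delta> = \<beta> + axis l 2"
          by (auto simp: Finite_Cartesian_Product.vec_eq_iff axis_def) (metis+)?
        thus ?thesis by simp
      qed auto
    qed
    \<comment> \<open>Compare the coefficients of beta in the two second derivatives; a disjoint sum of index sets
      combines them into one linear relation between Hermite functions.\<close>
    have "(\<Sum>s\<in>I <+> I. (case s of Inl \<delta> \<Rightarrow> v \<delta> * c \<delta> i i | Inr \<delta> \<Rightarrow> - (v \<delta> * c \<delta> j j)) *
       of_bool ((case s of Inl \<delta> \<Rightarrow> \<delta> - axis i 1 - axis i 1 | Inr \<delta> \<Rightarrow> \<delta> - axis j 1 - axis j 1) = \<beta>)) = 0"
    proof (rule hermite_coefficients[OF AE_I2])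
      fix \<xi> :: "real ^ 'd"
      show "(\<Sum>s\<in>I <+> I. (case s of Inl \<delta> \<Rightarrow> v \<delta> * c \<delta> i i | Inr \<delta> \<Rightarrow> - (v \<delta> * c \<delta> j j)) *
        hermite (case s of Inl \<delta> \<Rightarrow> \<delta> - axis i 1 - axis i 1 | Inr \<delta> \<Rightarrow> \<delta> - axis j 1 - axis j 1) \<xi>) = 0"
        using Tii[OF j, of \<xi>] fin by (simp add: sum.Plus T_def sum_negf)
    qed
    hence "(\<Sum>\<delta>\<in>I. v \<delta> * c \<delta> i i * of_bool (\<delta> - axis i 1 - axis i 1 = \<beta>))
       = (\<Sum>\<delta>\<in>I. v \<delta> * c \<delta> j j * of_bool (\<delta> - axis j 1 - axis j 1 = \<beta>))"
      using fin by (simp add: sum.Plus sum_negf del: sum_mult_of_bool_eq sum_of_bool_mult_eq)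
    also have "\<dots> = 0"
      unfolding b
    proof (rule sum.neutral, intro ballI)
      fix \<delta> assume d: "\<delta> \<in> I"
      have "v \<delta> = 0" if "\<delta> = \<beta> + axis j 2"
      proof (rule mixed[OF d j[symmetric]])
        show "1 \<le> vec_nth \<delta> i" using that j n by (simp add: \<beta>_def axis_def)
        show "1 \<le> vec_nth \<delta> j" using that j by (simp add: axis_def)
      qed
      thus "(if \<delta> = \<beta> + axis j 2 then v \<delta> * c \<delta> j j else 0) = 0" by simp
    qed
    also have "\<beta> + axis i 2 = \<alpha>"
      using n by (auto simp: \<beta>_def Finite_Cartesian_Product.vec_eq_iff axis_def)
    hence "(\<Sum>\<delta>\<in>I. v \<delta> * c \<delta> i i * of_bool (\<delta> - axis i 1 - axis i 1 = \<beta>)) = v \<alpha> * c \<alpha> i i"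
      unfolding b using fin \<alpha>(1) by simp
    finally show ?thesis using n by (simp add: c_def axis_def)
  qed
qed

lemma linear_fst_nth: "linear (\<lambda>x :: ('d::finite) collision. vec_nth (fst x) i)"
  and linear_fst_snd_nth: "linear (\<lambda>x :: ('d::finite) collision. vec_nth (fst (snd x)) i)"
  and linear_snd_snd_nth: "linear (\<lambda>x :: ('d::finite) collision. vec_nth (snd (snd x)) i)"
  by (auto intro!: linearI)

text \<open>
Only \<open>\<Theta> \<otimes> \<Theta>\<close> enters the collision rule, and for \<open>\<Theta> = sgn x\<close> this is rational in \<open>x\<close>.
\<close>

lemma sgn_projection: "inner g (sgn x) *\<^sub>R sgn x = (inner g x * inverse (inner x x)) *\<^sub>R (x :: real ^ 'd::finite)"
proof (cases "x = 0")
  case False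
  have "inverse (norm x) * inverse (norm x) = inverse (inner x x)"
    by (simp add: dot_square_norm power2_eq_square)
  thus ?thesis by (simp add: sgn_div_norm divide_inverse mult_ac)
qed simp

lemma rational_K_val_hermite:
  fixes a b x0 :: "real ^ 'd::finite"
  assumes "x0 \<noteq> 0"
  shows "rational_on_lines (a, b, x0) (\<lambda>(\<xi>, \<xi>1, x). K_val (hermite \<alpha>) (\<xi>, \<xi>1, sgn x))"
proof -
  let ?s = "\<lambda>x :: 'd collision. inner (fst x - fst (snd x)) (snd (snd x)) * inverse (inner (snd (snd x)) (snd (snd x)))"
  have sq: "rational_on_lines (a, b, x0) (\<lambda>x. inner (snd (snd x)) (snd (snd x)))"
    unfolding inner_vec_def inner_real_def
    by (intro rational_on_lines_sum rational_on_lines_mult rational_on_lines_linear linear_snd_snd_nth)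
  have ip: "rational_on_lines (a, b, x0) (\<lambda>x. inner (fst x - fst (snd x)) (snd (snd x)))"
    unfolding inner_vec_def inner_real_def vector_minus_component
    by (intro rational_on_lines_sum rational_on_lines_mult rational_on_lines_diff rational_on_lines_linear
        linear_fst_nth linear_fst_snd_nth linear_snd_snd_nth)
  have s: "rational_on_lines (a, b, x0) ?s"
    by (intro rational_on_lines_mult ip rational_on_lines_inverse sq) (use assms in simp)
  have p1: "rational_on_lines (a, b, x0) (\<lambda>x. vec_nth (fst x) i - ?s x * vec_nth (snd (snd x)) i)"
    and p2: "rational_on_lines (a, b, x0) (\<lambda>x. vec_nth (fst (snd x)) i + ?s x * vec_nth (snd (snd x)) i)" for i
    by (intro rational_on_lines_diff rational_on_lines_add rational_on_lines_mult[OF s] rational_on_lines_linear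
        linear_fst_nth linear_fst_snd_nth linear_snd_snd_nth)+
  have h: "rational_on_lines (a, b, x0) (\<lambda>x. hermite \<alpha> (f x))" if "\<And>i. rational_on_lines (a, b, x0) (\<lambda>x. vec_nth (f x) i)" for f
    unfolding hermite_prod by (intro rational_on_lines_prod rational_on_lines_poly that)
  have "rational_on_lines (a, b, x0) (\<lambda>x. hermite \<alpha> (fst x - ?s x *\<^sub>R snd (snd x)) + hermite \<alpha> (fst (snd x) + ?s x *\<^sub>R snd (snd x))
     - hermite \<alpha> (fst x) - hermite \<alpha> (fst (snd x)))"
    by (intro rational_on_lines_diff rational_on_lines_add h)
       (simp_all only: vector_minus_component vector_add_component vector_scaleR_component real_scaleR_def
         p1 p2 rational_on_lines_linear linear_fst_nth linear_fst_snd_nth)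
  thus ?thesis
    unfolding K_val_def K_op_def post1_def post2_def sgn_projection case_prod_beta fst_conv snd_conv .
qed

lemma K_val_sum: "K_val (\<lambda>x. \<Sum>\<alpha>\<in>I. v \<alpha> * hermite \<alpha> x) x = (\<Sum>\<alpha>\<in>I. v \<alpha> * K_val (hermite \<alpha>) x)"
  by (cases x) (simp add: K_val_def K_op_def sum.distrib sum_subtractf ring_distribs)

text \<open>
The sphere is parametrized by the directions of arbitrary vectors, so that the statement about zeros of
rational functions on a Euclidean space applies; both measures are then disintegrated over the third
variable.
\<close>

theorem K_val_AE_nonzero:
  fixes v :: "nat ^ 'd::finite \<Rightarrow> real"
  assumes c0: "norm c0 = 1" and ne: "(\<Sum>\<alpha>\<in>I. v \<alpha> * K_val (hermite \<alpha>) (a0, b0, c0)) \<noteq> 0"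
  shows "AE x in collision_measure. (\<Sum>\<alpha>\<in>I. v \<alpha> * K_val (hermite \<alpha>) x) \<noteq> 0"
proof -
  define f where "f x = (\<Sum>\<alpha>\<in>I. v \<alpha> * K_val (hermite \<alpha>) x)" for x :: "'d collision"
  define F where "F = (\<lambda>(\<xi>, \<xi>1, x). f (\<xi>, \<xi>1, sgn x))"
  have c0': "c0 \<noteq> 0" "sgn c0 = c0" using c0 by (auto simp: sgn_div_norm)
  have "rational_on_lines (a0, b0, c0) (\<lambda>x. \<Sum>\<alpha>\<in>I. v \<alpha> * (case x of (\<xi>, \<xi>1, y) \<Rightarrow> K_val (hermite \<alpha>) (\<xi>, \<xi>1, sgn y)))"
    by (intro rational_on_lines_sum rational_on_lines_mult rational_on_lines_const rational_K_val_hermite c0')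
  hence rat: "rational_on_lines (a0, b0, c0) F" unfolding F_def f_def case_prod_beta .
  have fm: "f \<in> borel_measurable borel"
    unfolding f_def by (intro borel_measurable_sum borel_measurable_times borel_measurable_const measurable_K_hermite)
  have sm: "(\<lambda>(\<xi> :: real ^ 'd, \<xi>1 :: real ^ 'd, x :: real ^ 'd). (\<xi>, \<xi>1, sgn x)) \<in> measurable borel borel"
  proof -
    have "(\<lambda>(\<xi> :: real ^ 'd, \<xi>1 :: real ^ 'd, x :: real ^ 'd). (\<xi>, \<xi>1, sgn x))
      \<in> measurable (borel \<Otimes>\<^sub>M (borel \<Otimes>\<^sub>M borel)) (borel \<Otimes>\<^sub>M (borel \<Otimes>\<^sub>M borel))"
      by measurable
    thus ?thesis by (simp only: borel_triple)
  qed
  have Fm: "F \<in> borel_measurable borel"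
    using measurable_compose[OF sm fm] by (simp add: F_def case_prod_beta)
  have "F (a0, b0, c0) \<noteq> 0" using ne by (simp add: F_def f_def c0')
  from rational_on_lines_AE_nonzero[OF rat this Fm] have ae: "AE x in lborel. F x \<noteq> 0" .
  define Z where "Z = {x. f x = 0}"
  have Z: "Z \<in> sets borel" unfolding Z_def using fm by measurable
  \<comment> \<open>The measure of the velocity pairs at which f vanishes for the given direction.\<close>
  define N where "N \<Theta> = (\<integral>\<^sup>+p. indicator Z (fst p, snd p, \<Theta>) \<partial>(lborel :: ((real ^ 'd) \<times> (real ^ 'd)) measure))" for \<Theta> :: "real ^ 'd"
  have iZ: "(\<lambda>x. indicator Z x :: ennreal) \<in> borel_measurable borel" using Z by measurable
  have Nm: "N \<in> borel_measurable borel" unfolding N_def by (rule measurable_pair_integral[OF iZ])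
  have "(\<integral>\<^sup>+x. N (sgn x) \<partial>lborel) = 0"
  proof -
    define h where "h x = (indicator {x. F x = 0} x :: ennreal)" for x
    have hm: "h \<in> borel_measurable borel" unfolding h_def using Fm by measurable
    have "(\<integral>\<^sup>+x. h x \<partial>lborel) = (\<integral>\<^sup>+x. 0 \<partial>(lborel :: 'd collision measure))"
      by (rule nn_integral_cong_AE, use ae in eventually_elim) (simp add: h_def)
    hence "0 = (\<integral>\<^sup>+x. h x \<partial>lborel)" by simp
    also have "\<dots> = (\<integral>\<^sup>+x. h x \<partial>(lborel \<Otimes>\<^sub>M (lborel \<Otimes>\<^sub>M lborel)))"
      by (simp add: lborel_prod)
    also have "\<dots> = (\<integral>\<^sup>+\<Theta>. (\<integral>\<^sup>+p. h (fst p, snd p, \<Theta>) \<partial>lborel) \<partial>lborel)"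
      by (rule nn_integral_triple[OF hm]) (unfold_locales, simp)
    also have "(\<lambda>\<Theta>. \<integral>\<^sup>+p. h (fst p, snd p, \<Theta>) \<partial>lborel) = (\<lambda>\<Theta>. N (sgn \<Theta>))"
      by (simp add: N_def h_def F_def Z_def indicator_def)
    finally show ?thesis ..
  qed
  hence "AE x in lborel. N (sgn x) = 0"
    by (subst (asm) nn_integral_0_iff_AE) (use measurable_compose[OF sgn_measurable Nm] in auto)
  hence "AE \<Theta> in sphere_measure. N \<Theta> = 0"
    by (subst AE_sphere_measure_iff) (use Nm in \<open>measurable, auto\<close>)
  hence "(\<integral>\<^sup>+\<Theta>. N \<Theta> \<partial>sphere_measure) = (\<integral>\<^sup>+(\<Theta> :: real ^ 'd). 0 \<partial>sphere_measure)"
    by (rule nn_integral_cong_AE)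
  hence "(\<integral>\<^sup>+x. indicator Z x \<partial>collision_measure) = 0"
    unfolding nn_integral_collision_measure[OF iZ] N_def by simp
  moreover have Zs: "Z \<in> sets collision_measure" using Z by (simp only: sets_collision_measure)
  ultimately have "Z \<in> null_sets collision_measure"
    by (intro null_setsI) (simp_all only: nn_integral_indicator)
  from AE_not_in[OF this] show ?thesis by (simp add: Z_def f_def)
qed

theorem boltzmann_matrix_nonneg:
  fixes v :: "nat ^ 'd::finite \<Rightarrow> real"
  assumes B: "collision_kernel TYPE('d) M B" and I: "finite I" "I \<subseteq> all_indices M"
  shows "0 \<le> (\<Sum>\<alpha>\<in>I. \<Sum>\<beta>\<in>I. v \<alpha> * v \<beta> * boltzmann_matrix B \<alpha> \<beta>)"
  unfolding boltzmann_matrix_quadratic_form(2)[OF B I]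
  by (intro mult_nonneg_nonneg Bochner_Integration.integral_nonneg zero_le_power2 weight_nonneg collision_kernelD(2)[OF B]) simp

text \<open>
If the form vanishes, \<open>K f\<close> vanishes wherever the kernel does not, which is a set of positive measure;
hence \<open>K f\<close> vanishes identically and \<open>f\<close> is conserved in all collisions. Impact along \<open>x\<close> takes \<open>a + x\<close>,
\<open>a + y\<close> to \<open>a\<close>, \<open>a + x + y\<close> if \<open>x\<close> and \<open>y\<close> are orthogonal.
\<close>

theorem boltzmann_matrix_definite:
  fixes v :: "nat ^ 'd::finite \<Rightarrow> real"
  assumes B: "collision_kernel TYPE('d) M B" and I: "finite I" "I \<subseteq> all_indices M" and D: "2 \<le> CARD('d)"
    and 0: "(\<Sum>\<alpha>\<in>I. \<Sum>\<beta>\<in>I. v \<alpha> * v \<beta> * boltzmann_matrix B \<alpha> \<beta>) = 0"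
    and a: "\<alpha> \<in> I" "3 \<le> mi_abs \<alpha>"
  shows "v \<alpha> = 0"
proof -
  define f where "f x = (\<Sum>\<alpha>\<in>I. v \<alpha> * K_val (hermite \<alpha>) x)" for x :: "'d collision"
  define g where "g \<xi> = (\<Sum>\<alpha>\<in>I. v \<alpha> * hermite \<alpha> \<xi>)" for \<xi> :: "real ^ 'd"
  have w: "0 \<le> weight B x" for x :: "'d collision"
    by (rule weight_nonneg[OF collision_kernelD(2)[OF B]])
  have i: "integrable collision_measure (\<lambda>x. (f x)\<^sup>2 * weight B x)"
    unfolding f_def by (rule boltzmann_matrix_quadratic_form(1)[OF B I])
  have "(LINT x|collision_measure. (f x)\<^sup>2 * weight B x) = 0"
    using 0 unfolding boltzmann_matrix_quadratic_form(2)[OF B I] f_def by simp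
  hence ae: "AE x in collision_measure. (f x)\<^sup>2 * weight B x = 0"
    using integral_nonneg_eq_0_iff_AE[OF i] w by simp
  have zero: "f (\<xi>, \<xi>1, \<Theta>) = 0" if n: "norm \<Theta> = 1" for \<xi> \<xi>1 \<Theta> :: "real ^ 'd"
  proof (rule ccontr)
    assume "f (\<xi>, \<xi>1, \<Theta>) \<noteq> 0"
    hence "AE x in collision_measure. f x \<noteq> 0"
      unfolding f_def by (rule K_val_AE_nonzero[OF n])
    hence "AE x in collision_measure. weight B (x :: 'd collision) = 0"
      using ae by eventually_elim simp
    thus False using collision_kernelD(3)[OF B] by blast
  qed
  have inv: "g (a + x) + g (a + y) = g a + g (a + x + y)" if xy: "inner x y = 0" for a x y
  proof (cases "x = 0")
    case False
    have n: "norm (sgn x) = 1" using False by (simp add: norm_sgn)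
    have "inner ((a + x) - (a + y)) x = inner x x" using xy by (simp add: inner_diff_left inner_commute[of y x])
    hence e: "inner ((a + x) - (a + y)) (sgn x) *\<^sub>R sgn x = x"
      unfolding sgn_projection using False by simp
    have "K_val g (a + x, a + y, sgn x) = 0"
      using zero[OF n, of "a + x" "a + y"] unfolding f_def g_def K_val_sum .
    thus ?thesis
      unfolding K_val_def K_op_def post1_def post2_def case_prod_conv e by (simp add: algebra_simps)
  qed simp
  show ?thesis
    by (rule collision_invariant_degree[OF I(1) D _ a]) (use inv in \<open>simp add: g_def\<close>)
qed

section \<open>The Shakhov matrix\<close>

lemma single_entry_form:
  fixes v :: "'i \<Rightarrow> real"
  assumes "finite I"
  shows "(\<Sum>\<alpha>\<in>I. \<Sum>\<beta>\<in>I. v \<alpha> * v \<beta> * (if \<alpha> = a \<and> \<beta> = b then t else 0))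
    = (if a \<in> I then v a else 0) * (if b \<in> I then v b else 0) * t"
proof -
  have "(\<Sum>\<beta>\<in>I. v \<alpha> * v \<beta> * (if \<alpha> = a \<and> \<beta> = b then t else 0))
     = (if \<alpha> = a then v a * (if b \<in> I then v b else 0) * t else 0)" for \<alpha>
  proof -
    have "(\<Sum>\<beta>\<in>I. v \<alpha> * v \<beta> * (if \<alpha> = a \<and> \<beta> = b then t else 0))
      = (\<Sum>\<beta>\<in>I. if b = \<beta> then (if \<alpha> = a then v a * v \<beta> * t else 0) else 0)"
      by (rule sum.cong) auto
    thus ?thesis using assms by (simp add: sum.delta)
  qed
  hence "(\<Sum>\<alpha>\<in>I. \<Sum>\<beta>\<in>I. v \<alpha> * v \<beta> * (if \<alpha> = a \<and> \<beta> = b then t else 0))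
    = (\<Sum>\<alpha>\<in>I. if a = \<alpha> then v a * (if b \<in> I then v b else 0) * t else 0)"
    by (auto intro!: sum.cong)
  thus ?thesis using assms by (simp add: sum.delta)
qed

lemma sparse_form:
  fixes v :: "'i \<Rightarrow> real"
  assumes "finite I"
  shows "(\<Sum>\<alpha>\<in>I. \<Sum>\<beta>\<in>I. v \<alpha> * v \<beta> * (\<Sum>p\<in>P. if \<alpha> = a p \<and> \<beta> = b p then t p else 0))
    = (\<Sum>p\<in>P. (if a p \<in> I then v (a p) else 0) * (if b p \<in> I then v (b p) else 0) * t p)"
proof -
  have "(\<Sum>\<alpha>\<in>I. \<Sum>\<beta>\<in>I. v \<alpha> * v \<beta> * (\<Sum>p\<in>P. if \<alpha> = a p \<and> \<beta> = b p then t p else 0))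
    = (\<Sum>\<alpha>\<in>I. \<Sum>p\<in>P. \<Sum>\<beta>\<in>I. v \<alpha> * v \<beta> * (if \<alpha> = a p \<and> \<beta> = b p then t p else 0))"
    unfolding sum_distrib_left by (intro sum.cong[OF refl] sum.swap)
  also have "\<dots> = (\<Sum>p\<in>P. \<Sum>\<alpha>\<in>I. \<Sum>\<beta>\<in>I. v \<alpha> * v \<beta> * (if \<alpha> = a p \<and> \<beta> = b p then t p else 0))"
    by (rule sum.swap)
  finally show ?thesis unfolding single_entry_form[OF assms] .
qed

lemma sum_UNIV_pair: "(\<Sum>j\<in>UNIV. \<Sum>k\<in>UNIV. G j k) = (\<Sum>p\<in>UNIV. G (fst p) (snd p))"
  by (simp add: sum.cartesian_product case_prod_beta)

lemma sum_UNIV_triple: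
  "(\<Sum>i\<in>UNIV. \<Sum>j\<in>UNIV. \<Sum>k\<in>UNIV. F i j k) = (\<Sum>p\<in>UNIV. F (fst p) (fst (snd p)) (snd (snd p)))"
  unfolding sum_UNIV_pair[where G = "\<lambda>j k. F _ j k"] sum_UNIV_pair[where G = "\<lambda>i p. F i (fst p) (snd p)"] ..

lemma shakhov_matrix_sym:
  fixes \<alpha> \<beta> :: "nat ^ 'd::finite"
  shows "shakhov_matrix Pr \<alpha> \<beta> = shakhov_matrix Pr \<beta> \<alpha>"
proof -
  have 1: "(\<Sum>i\<in>UNIV. \<Sum>j\<in>UNIV. if \<alpha> = axis i 2 \<and> \<beta> = axis j 2 then of_bool (i = j) - 1 / real CARD('d) else 0)
    = (\<Sum>i\<in>UNIV. \<Sum>j\<in>UNIV. if \<beta> = axis i 2 \<and> \<alpha> = axis (j :: 'd) 2 then of_bool (i = j) - 1 / real CARD('d) else (0::real))"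
    by (subst sum.swap) (intro sum.cong refl, auto)
  have 2: "(\<Sum>i\<in>UNIV. \<Sum>j\<in>UNIV. \<Sum>k\<in>UNIV. if \<alpha> = axis i 1 + axis j 2 \<and> \<beta> = axis i 1 + axis k 2
        then of_bool (j = k) - (1 - Pr) / 5 * sqrt (1 + 2 * of_bool (i = j)) * sqrt (1 + 2 * of_bool (i = k)) else 0)
    = (\<Sum>i\<in>UNIV. \<Sum>j\<in>UNIV. \<Sum>k\<in>UNIV. if \<beta> = axis i 1 + axis j 2 \<and> \<alpha> = axis i 1 + axis (k :: 'd) 2
        then of_bool (j = k) - (1 - Pr) / 5 * sqrt (1 + 2 * of_bool (i = j)) * sqrt (1 + 2 * of_bool (i = k)) else (0::real))"
    by (rule sum.cong[OF refl], subst sum.swap) (intro sum.cong refl, auto)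
  show ?thesis unfolding shakhov_matrix_def 1 2 by auto
qed

lemma shakhov_matrix_parity:
  fixes \<alpha> \<beta> :: "nat ^ 'd::finite"
  assumes "even (vec_nth \<alpha> k) \<noteq> even (vec_nth \<beta> k)"
  shows "shakhov_matrix Pr \<alpha> \<beta> = 0"
proof -
  have 1: "\<not> (\<alpha> = axis i 2 \<and> \<beta> = axis j 2)" for i j using assms by (auto simp: axis_def split: if_splits)
  have 2: "\<not> (\<alpha> = axis i 1 + axis j 2 \<and> \<beta> = axis i 1 + axis l 2)" for i j l
    using assms by (auto simp: axis_def split: if_splits)
  have 3: "\<alpha> \<noteq> \<beta>" using assms by auto
  show ?thesis unfolding shakhov_matrix_def if_not_P[OF 1] if_not_P[OF 2] using 3 by simp
qed

text \<open>
The three families of entries act on separate groups of coefficients: the stress block is the identity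
minus the projection to the constant vector, each heat-flux block is the identity minus a multiple of a
rank-one matrix, and the remaining block is the identity. Indices outside \<open>I\<close> count as zero coefficients.
\<close>

lemma shakhov_matrix_quadratic_form:
  fixes v :: "nat ^ 'd::finite \<Rightarrow> real"
  assumes I: "finite I"
  defines "w \<equiv> \<lambda>\<alpha>. if \<alpha> \<in> I then v \<alpha> else 0"
  shows "(\<Sum>\<alpha>\<in>I. \<Sum>\<beta>\<in>I. v \<alpha> * v \<beta> * shakhov_matrix Pr \<alpha> \<beta>) =
    ((\<Sum>i\<in>UNIV. (w (axis i 2))\<^sup>2) - (\<Sum>i\<in>UNIV. w (axis i 2))\<^sup>2 / real CARD('d))
    + (\<Sum>i\<in>UNIV. (\<Sum>j\<in>UNIV. (w (axis i 1 + axis j 2))\<^sup>2)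
        - (1 - Pr) / 5 * (\<Sum>j\<in>UNIV. sqrt (1 + 2 * of_bool (i = j)) * w (axis i 1 + axis j 2))\<^sup>2)
    + (\<Sum>\<alpha>\<in>I. if 2 \<le> mi_abs \<alpha> \<and> (\<nexists>i. \<alpha> = axis i 2) \<and> (\<nexists>i j. \<alpha> = axis i 1 + axis j 2) then (v \<alpha>)\<^sup>2 else 0)"
proof -
  have d: "(\<Sum>i\<in>UNIV. \<Sum>j\<in>(UNIV :: 'd set). f i * f j * (of_bool (i = j) - t)) = (\<Sum>i\<in>UNIV. (f i)\<^sup>2) - t * (\<Sum>i\<in>UNIV. f i)\<^sup>2"
    for f :: "'d \<Rightarrow> real" and t
  proof -
    have "(\<Sum>i\<in>UNIV. \<Sum>j\<in>(UNIV :: 'd set). f i * f j * (of_bool (i = j) - t))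
      = (\<Sum>i\<in>UNIV. \<Sum>j\<in>(UNIV :: 'd set). (if i = j then f i * f j else 0) - t * (f i * f j))"
      by (intro sum.cong refl) (auto simp: algebra_simps)
    also have "\<dots> = (\<Sum>i\<in>UNIV. f i * f i) - t * ((\<Sum>i\<in>UNIV. f i) * (\<Sum>i\<in>UNIV. f i))"
      unfolding sum_product by (simp add: sum_subtractf sum_distrib_left)
    finally show ?thesis by (simp add: power2_eq_square)
  qed
  have 1: "(\<Sum>\<alpha>\<in>I. \<Sum>\<beta>\<in>I. v \<alpha> * v \<beta> * (\<Sum>i\<in>UNIV. \<Sum>j\<in>(UNIV :: 'd set). if \<alpha> = axis i 2 \<and> \<beta> = axis j 2 then of_bool (i = j) - 1 / real CARD('d) else 0))
     = (\<Sum>i\<in>UNIV. (w (axis i 2))\<^sup>2) - (\<Sum>i\<in>UNIV. w (axis i 2))\<^sup>2 / real CARD('d)"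
    using d[of "\<lambda>i. w (axis i 2)" "1 / real CARD('d)"]
    unfolding sum_UNIV_pair sparse_form[OF I] w_def by simp
  have 2: "(\<Sum>\<alpha>\<in>I. \<Sum>\<beta>\<in>I. v \<alpha> * v \<beta> * (\<Sum>i\<in>UNIV. \<Sum>j\<in>UNIV. \<Sum>k\<in>(UNIV :: 'd set). if \<alpha> = axis i 1 + axis j 2 \<and> \<beta> = axis i 1 + axis k 2 then g i j k else 0))
    = (\<Sum>i\<in>UNIV. \<Sum>j\<in>UNIV. \<Sum>k\<in>UNIV. w (axis i 1 + axis j 2) * w (axis i 1 + axis k 2) * g i j k)" for g
    unfolding sum_UNIV_triple sparse_form[OF I] w_def ..
  have hf: "(\<Sum>j\<in>UNIV. \<Sum>k\<in>(UNIV :: 'd set). y j * y k * (of_bool (j = k) - (1 - Pr) / 5 * s j * s k))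
     = (\<Sum>j\<in>UNIV. (y j)\<^sup>2) - (1 - Pr) / 5 * (\<Sum>j\<in>UNIV. s j * y j)\<^sup>2" for y s :: "'d \<Rightarrow> real"
  proof -
    have "(\<Sum>j\<in>UNIV. \<Sum>k\<in>(UNIV :: 'd set). y j * y k * (of_bool (j = k) - (1 - Pr) / 5 * s j * s k))
      = (\<Sum>j\<in>UNIV. \<Sum>k\<in>(UNIV :: 'd set). (if j = k then y j * y k else 0) - (1 - Pr) / 5 * ((s j * y j) * (s k * y k)))"
      by (intro sum.cong refl) (auto simp: algebra_simps)
    also have "\<dots> = (\<Sum>j\<in>UNIV. y j * y j) - (1 - Pr) / 5 * ((\<Sum>j\<in>UNIV. s j * y j) * (\<Sum>j\<in>UNIV. s j * y j))"
      unfolding sum_product by (simp add: sum_subtractf sum_distrib_left)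
    finally show ?thesis by (simp add: power2_eq_square)
  qed
  have 3: "(\<Sum>\<beta>\<in>I. v \<alpha> * v \<beta> * (if \<alpha> = \<beta> \<and> P \<alpha> then 1 else 0)) = (if P \<alpha> then (v \<alpha>)\<^sup>2 else 0)"
    if "\<alpha> \<in> I" for P \<alpha>
  proof -
    have "(\<Sum>\<beta>\<in>I. v \<alpha> * v \<beta> * (if \<alpha> = \<beta> \<and> P \<alpha> then 1 else 0)) = (\<Sum>\<beta>\<in>I. if \<alpha> = \<beta> then (if P \<alpha> then v \<alpha> * v \<beta> else 0) else 0)"
      by (intro sum.cong refl) auto
    thus ?thesis using I that by (simp add: sum.delta power2_eq_square)
  qed
  show ?thesis
    unfolding shakhov_matrix_def distrib_left sum.distrib 1 2 hf
    by (intro arg_cong2[of _ _ _ _ "(+)"] refl sum.cong 3)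
qed

text \<open>
By Cauchy-Schwarz, since the squares of the weights \<open>sqrt (1 + 2 \<delta>\<^sub>i\<^sub>j)\<close> have the sum \<open>D + 2\<close>.
\<close>

lemma shakhov_heat_flux_bound:
  fixes y :: "'d::finite \<Rightarrow> real"
  assumes "(1 - Pr) * (real CARD('d) + 2) / 5 < 1"
  obtains \<kappa> where "\<kappa> > 0" "\<And>y :: 'd \<Rightarrow> real. \<kappa> * (\<Sum>j\<in>UNIV. (y j)\<^sup>2) \<le>
    (\<Sum>j\<in>UNIV. (y j)\<^sup>2) - (1 - Pr) / 5 * (\<Sum>j\<in>UNIV. sqrt (1 + 2 * of_bool (i = j)) * y j)\<^sup>2"
proof (cases "1 - Pr \<le> 0")
  case True
  show ?thesis
  proof (rule that[of 1])
    fix y :: "'d \<Rightarrow> real"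
    have "(1 - Pr) / 5 * (\<Sum>j\<in>UNIV. sqrt (1 + 2 * of_bool (i = j)) * y j)\<^sup>2 \<le> 0"
      using True by (intro mult_nonpos_nonneg) auto
    thus "1 * (\<Sum>j\<in>UNIV. (y j)\<^sup>2) \<le>
      (\<Sum>j\<in>UNIV. (y j)\<^sup>2) - (1 - Pr) / 5 * (\<Sum>j\<in>UNIV. sqrt (1 + 2 * of_bool (i = j)) * y j)\<^sup>2" by simp
  qed simp
next
  case False
  define \<kappa> where "\<kappa> = 1 - (1 - Pr) / 5 * (real CARD('d) + 2)"
  show ?thesis
  proof (rule that[of \<kappa>])
    show "\<kappa> > 0" using assms by (simp add: \<kappa>_def)
    fix y :: "'d \<Rightarrow> real"
    have "(\<Sum>j\<in>UNIV. sqrt (1 + 2 * of_bool (i = j)) * y j)\<^sup>2 \<le> (\<Sum>j\<in>UNIV. (sqrt (1 + 2 * of_bool (i = j)))\<^sup>2) * (\<Sum>j\<in>UNIV. (y j)\<^sup>2)"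
      by (rule Cauchy_Schwarz_ineq_sum)
    also have "(\<Sum>j\<in>UNIV. (sqrt (1 + 2 * of_bool (i = j)))\<^sup>2) = real CARD('d) + 2"
    proof -
      have "(\<Sum>j\<in>UNIV. (sqrt (1 + 2 * of_bool (i = j)))\<^sup>2) = (\<Sum>j\<in>UNIV. 1 + (if i = j then 2 else 0 :: real))"
        by (intro sum.cong refl) auto
      thus ?thesis by (simp add: sum.distrib)
    qed
    finally have "(1 - Pr) / 5 * (\<Sum>j\<in>UNIV. sqrt (1 + 2 * of_bool (i = j)) * y j)\<^sup>2
        \<le> (1 - Pr) / 5 * ((real CARD('d) + 2) * (\<Sum>j\<in>UNIV. (y j)\<^sup>2))"
      using False by (intro mult_left_mono) auto
    thus "\<kappa> * (\<Sum>j\<in>UNIV. (y j)\<^sup>2) \<le>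
      (\<Sum>j\<in>UNIV. (y j)\<^sup>2) - (1 - Pr) / 5 * (\<Sum>j\<in>UNIV. sqrt (1 + 2 * of_bool (i = j)) * y j)\<^sup>2"
      unfolding \<kappa>_def left_diff_distrib mult.assoc by simp
  qed
qed

theorem shakhov_matrix_definite:
  fixes v :: "nat ^ 'd::finite \<Rightarrow> real"
  assumes I: "finite I" and Pr: "(1 - Pr) * (real CARD('d) + 2) / 5 < 1"
  shows "0 \<le> (\<Sum>\<alpha>\<in>I. \<Sum>\<beta>\<in>I. v \<alpha> * v \<beta> * shakhov_matrix Pr \<alpha> \<beta>)"
    and "(\<Sum>\<alpha>\<in>I. \<Sum>\<beta>\<in>I. v \<alpha> * v \<beta> * shakhov_matrix Pr \<alpha> \<beta>) = 0 \<Longrightarrow> \<alpha> \<in> I \<Longrightarrow> 3 \<le> mi_abs \<alpha> \<Longrightarrow> v \<alpha> = 0"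
proof -
  define w where "w \<alpha> = (if \<alpha> \<in> I then v \<alpha> else 0)" for \<alpha>
  define P where "P \<alpha> \<longleftrightarrow> 2 \<le> mi_abs \<alpha> \<and> (\<nexists>i. \<alpha> = axis i 2) \<and> (\<nexists>i j. \<alpha> = axis i 1 + axis j 2)" for \<alpha> :: "nat ^ 'd"
  define t1 where "t1 = (\<Sum>i\<in>UNIV. (w (axis i 2))\<^sup>2) - (\<Sum>i\<in>UNIV. w (axis i 2))\<^sup>2 / real CARD('d)"
  define t2 where "t2 i = (\<Sum>j\<in>UNIV. (w (axis i 1 + axis j 2))\<^sup>2)
        - (1 - Pr) / 5 * (\<Sum>j\<in>UNIV. sqrt (1 + 2 * of_bool (i = j)) * w (axis i 1 + axis j 2))\<^sup>2" for i
  define t3 where "t3 \<alpha> = (if P \<alpha> then (v \<alpha>)\<^sup>2 else 0)" for \<alpha>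
  have e: "(\<Sum>\<alpha>\<in>I. \<Sum>\<beta>\<in>I. v \<alpha> * v \<beta> * shakhov_matrix Pr \<alpha> \<beta>) = t1 + (\<Sum>i\<in>UNIV. t2 i) + (\<Sum>\<alpha>\<in>I. t3 \<alpha>)"
    unfolding shakhov_matrix_quadratic_form[OF I] t1_def t2_def t3_def P_def w_def ..
  have 1: "t1 \<ge> 0"
    using Cauchy_Schwarz_ineq_sum[of "\<lambda>_. 1" "\<lambda>i. w (axis i 2)" UNIV] by (simp add: t1_def field_simps)
  have t2: "\<exists>\<kappa>>0. \<kappa> * (\<Sum>j\<in>UNIV. (w (axis i 1 + axis j 2))\<^sup>2) \<le> t2 i" for i
  proof -
    obtain \<kappa> where k: "\<kappa> > 0" "\<And>y :: 'd \<Rightarrow> real. \<kappa> * (\<Sum>j\<in>UNIV. (y j)\<^sup>2) \<le>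
      (\<Sum>j\<in>UNIV. (y j)\<^sup>2) - (1 - Pr) / 5 * (\<Sum>j\<in>UNIV. sqrt (1 + 2 * of_bool (i = j)) * y j)\<^sup>2"
      by (rule shakhov_heat_flux_bound[OF Pr, of i]) (rule that; assumption)
    show ?thesis
      unfolding t2_def using k(1) k(2)[of "\<lambda>j. w (axis i 1 + axis j 2)"] by (intro exI[of _ \<kappa>] conjI)
  qed
  have 2: "t2 i \<ge> 0" for i
  proof -
    obtain \<kappa> where "\<kappa> > 0" "\<kappa> * (\<Sum>j\<in>UNIV. (w (axis i 1 + axis j 2))\<^sup>2) \<le> t2 i" using t2 by blast
    moreover have "0 \<le> \<kappa> * (\<Sum>j\<in>UNIV. (w (axis i 1 + axis j 2))\<^sup>2)" using \<open>\<kappa> > 0\<close> by (intro mult_nonneg_nonneg sum_nonneg) auto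
    ultimately show ?thesis by linarith
  qed
  have 3: "t3 \<alpha> \<ge> 0" for \<alpha> by (simp add: t3_def)
  have s2: "(\<Sum>i\<in>UNIV. t2 i) \<ge> 0" and s3: "(\<Sum>\<alpha>\<in>I. t3 \<alpha>) \<ge> 0" by (simp_all add: sum_nonneg 2 3)
  show "0 \<le> (\<Sum>\<alpha>\<in>I. \<Sum>\<beta>\<in>I. v \<alpha> * v \<beta> * shakhov_matrix Pr \<alpha> \<beta>)"
    unfolding e using 1 s2 s3 by linarith
  assume 0: "(\<Sum>\<alpha>\<in>I. \<Sum>\<beta>\<in>I. v \<alpha> * v \<beta> * shakhov_matrix Pr \<alpha> \<beta>) = 0" and a: "\<alpha> \<in> I" "3 \<le> mi_abs \<alpha>"
  have "(\<Sum>i\<in>UNIV. t2 i) = 0" "(\<Sum>\<alpha>\<in>I. t3 \<alpha>) = 0" using 0 1 s2 s3 unfolding e by linarith+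
  hence z2: "t2 i = 0" and z3: "\<beta> \<in> I \<Longrightarrow> t3 \<beta> = 0" for i \<beta>
    using 2 3 I by (auto simp: sum_nonneg_eq_0_iff)
  show "v \<alpha> = 0"
  proof (cases "\<exists>i j. \<alpha> = axis i 1 + axis j 2")
    case True
    then obtain i j where ij: "\<alpha> = axis i 1 + axis j 2" by blast
    obtain \<kappa> where k: "\<kappa> > 0" "\<kappa> * (\<Sum>j\<in>UNIV. (w (axis i 1 + axis j 2))\<^sup>2) \<le> t2 i" using t2 by blast
    have "(\<Sum>j\<in>UNIV. (w (axis i 1 + axis j 2))\<^sup>2) \<le> 0" using k z2[of i] by (simp add: mult_le_0_iff)
    moreover have "(w (axis i 1 + axis j 2))\<^sup>2 \<le> (\<Sum>j\<in>UNIV. (w (axis i 1 + axis j 2))\<^sup>2)"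
      by (rule member_le_sum) auto
    ultimately have "(w (axis i 1 + axis j 2))\<^sup>2 \<le> 0" by (rule order_trans[rotated])
    hence "w \<alpha> = 0" using ij by simp
    thus ?thesis using a by (simp add: w_def)
  next
    case False
    have "\<alpha> \<noteq> axis i 2" for i
    proof
      assume "\<alpha> = axis i 2"
      hence "mi_abs \<alpha> = 2" by (simp add: mi_abs_def axis_def)
      thus False using a by simp
    qed
    hence "P \<alpha>" using a False by (simp add: P_def)
    thus ?thesis using z3[OF a(1)] by (simp add: t3_def)
  qed
qed


section \<open>Matrices indexed by multi-indices\<close>

text \<open>
What the half-space problem needs to know about either collision model.
\<close>

lemma collision_matrix_properties:
  fixes J :: "nat ^ 'd::finite \<Rightarrow> nat ^ 'd \<Rightarrow> real"
  assumes J: "collision_matrix M J" and D: "2 \<le> CARD('d)"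
  shows collision_matrix_sym: "\<And>\<alpha> \<beta>. \<alpha> \<in> all_indices M \<Longrightarrow> \<beta> \<in> all_indices M \<Longrightarrow> J \<alpha> \<beta> = J \<beta> \<alpha>"
    and collision_matrix_parity: "\<And>\<alpha> \<beta> k. \<alpha> \<in> all_indices M \<Longrightarrow> \<beta> \<in> all_indices M \<Longrightarrow>
      even (vec_nth \<alpha> k) \<noteq> even (vec_nth \<beta> k) \<Longrightarrow> J \<alpha> \<beta> = 0"
    and collision_matrix_nonneg: "\<And>I v. finite I \<Longrightarrow> I \<subseteq> all_indices M \<Longrightarrow> 0 \<le> (\<Sum>\<alpha>\<in>I. \<Sum>\<beta>\<in>I. v \<alpha> * v \<beta> * J \<alpha> \<beta>)"
    and collision_matrix_definite: "\<And>I v \<alpha>. finite I \<Longrightarrow> I \<subseteq> all_indices M \<Longrightarrow>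
      (\<Sum>\<alpha>\<in>I. \<Sum>\<beta>\<in>I. v \<alpha> * v \<beta> * J \<alpha> \<beta>) = 0 \<Longrightarrow> \<alpha> \<in> I \<Longrightarrow> 3 \<le> mi_abs \<alpha> \<Longrightarrow> v \<alpha> = 0"
proof -
  consider (B) B where "collision_kernel TYPE('d) M B" "J = boltzmann_matrix B"
    | (S) Pr where "(1 - Pr) * (real CARD('d) + 2) / 5 < 1" "J = shakhov_matrix Pr"
    using J by (auto simp: collision_matrix_def)
  note cases = this
  show "J \<alpha> \<beta> = J \<beta> \<alpha>" if "\<alpha> \<in> all_indices M" "\<beta> \<in> all_indices M" for \<alpha> \<beta>
    using cases by cases (use that boltzmann_matrix_sym shakhov_matrix_sym in auto)
  show "J \<alpha> \<beta> = 0" if "\<alpha> \<in> all_indices M" "\<beta> \<in> all_indices M" "even (vec_nth \<alpha> k) \<noteq> even (vec_nth \<beta> k)" for \<alpha> \<beta> k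
    using cases
  proof cases
    case B
    thus ?thesis using boltzmann_matrix_parity[OF B(1) that] by simp
  next
    case S
    thus ?thesis using shakhov_matrix_parity[OF that(3)] by simp
  qed
  show "0 \<le> (\<Sum>\<alpha>\<in>I. \<Sum>\<beta>\<in>I. v \<alpha> * v \<beta> * J \<alpha> \<beta>)" if "finite I" "I \<subseteq> all_indices M" for I v
    using cases
  proof cases
    case B
    thus ?thesis using boltzmann_matrix_nonneg[OF B(1) that] by simp
  next
    case S
    thus ?thesis using shakhov_matrix_definite(1)[OF that(1) S(1)] by simp
  qed
  show "v \<alpha> = 0" if "finite I" "I \<subseteq> all_indices M" "(\<Sum>\<alpha>\<in>I. \<Sum>\<beta>\<in>I. v \<alpha> * v \<beta> * J \<alpha> \<beta>) = 0" "\<alpha> \<in> I" "3 \<le> mi_abs \<alpha>" for I v \<alpha>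
    using cases
  proof cases
    case B
    thus ?thesis using boltzmann_matrix_definite[OF B(1) that(1,2) D _ that(4,5)] that(3) by simp
  next
    case S
    thus ?thesis using shakhov_matrix_definite(2)[OF that(1) S(1) _ that(4,5)] that(3) by simp
  qed
qed

text \<open>
The values at indices outside of the list are arbitrary.
\<close>

definition coeff_fun :: "'i list \<Rightarrow> real Matrix.vec \<Rightarrow> 'i \<Rightarrow> real" where
  "coeff_fun as x \<alpha> = x $ inv_into {..<length as} ((!) as) \<alpha>"

lemma coeff_fun_nth: "distinct as \<Longrightarrow> i < length as \<Longrightarrow> coeff_fun as x (as ! i) = x $ i"
  unfolding coeff_fun_def by (subst inv_into_f_f) (auto intro: inj_on_nth)

lemma sum_list_index:
  assumes "distinct as"
  shows "(\<Sum>i = 0..<length as. f (as ! i)) = (\<Sum>\<alpha>\<in>set as. f \<alpha>)"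
  using sum.reindex_bij_betw[OF bij_betw_nth[OF assms refl refl], of f] by (simp add: atLeast0LessThan)

lemma indexed_mat_carrier: "indexed_mat f as bs \<in> carrier_mat (length as) (length bs)"
  by (simp add: indexed_mat_def)

lemma indexed_mat_mult_vec:
  assumes "distinct bs" "x \<in> carrier_vec (length bs)" "i < length as"
  shows "(indexed_mat f as bs *\<^sub>v x) $ i = (\<Sum>\<beta>\<in>set bs. f (as ! i) \<beta> * coeff_fun bs x \<beta>)"
proof -
  have "(indexed_mat f as bs *\<^sub>v x) $ i = (\<Sum>j = 0..<length bs. f (as ! i) (bs ! j) * coeff_fun bs x (bs ! j))"
    using assms by (simp add: indexed_mat_def scalar_prod_def coeff_fun_nth)
  also have "\<dots> = (\<Sum>\<beta>\<in>set bs. f (as ! i) \<beta> * coeff_fun bs x \<beta>)"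
    by (rule sum_list_index[OF assms(1)])
  finally show ?thesis .
qed

lemma indexed_mat_transpose: "(indexed_mat f as bs)\<^sup>T = indexed_mat (\<lambda>\<alpha> \<beta>. f \<beta> \<alpha>) bs as"
  by (rule eq_matI) (auto simp: indexed_mat_def)

lemma indexed_mat_quadratic_form:
  assumes "distinct as" "x \<in> carrier_vec (length as)"
  shows "x \<bullet> (indexed_mat f as as *\<^sub>v x) = (\<Sum>\<alpha>\<in>set as. \<Sum>\<beta>\<in>set as. coeff_fun as x \<alpha> * coeff_fun as x \<beta> * f \<alpha> \<beta>)"
proof -
  have "x \<bullet> (indexed_mat f as as *\<^sub>v x) = (\<Sum>i = 0..<length as. x $ i * (indexed_mat f as as *\<^sub>v x) $ i)"
    by (simp add: scalar_prod_def indexed_mat_def)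
  also have "\<dots> = (\<Sum>i = 0..<length as. coeff_fun as x (as ! i) * (\<Sum>\<beta>\<in>set as. f (as ! i) \<beta> * coeff_fun as x \<beta>))"
    by (intro sum.cong refl) (simp add: indexed_mat_mult_vec[OF assms] coeff_fun_nth[OF assms(1)])
  also have "\<dots> = (\<Sum>\<alpha>\<in>set as. coeff_fun as x \<alpha> * (\<Sum>\<beta>\<in>set as. f \<alpha> \<beta> * coeff_fun as x \<beta>))"
    by (rule sum_list_index[OF assms(1)])
  finally show ?thesis by (simp add: sum_distrib_left mult_ac)
qed

lemma vec_eq_0_if_coeff_fun:
  assumes "distinct as" "x \<in> carrier_vec (length as)" "\<And>\<alpha>. \<alpha> \<in> set as \<Longrightarrow> coeff_fun as x \<alpha> = 0"
  shows "x = 0\<^sub>v (length as)"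
proof (rule eq_vecI)
  fix i assume "i < dim_vec (0\<^sub>v (length as))"
  thus "x $ i = 0\<^sub>v (length as) $ i"
    using assms(3)[of "as ! i"] coeff_fun_nth[OF assms(1), of i x] by simp
qed (use assms in simp)

lemma pos_semidef_indexed_mat:
  assumes "distinct as" "\<And>\<alpha> \<beta>. \<alpha> \<in> set as \<Longrightarrow> \<beta> \<in> set as \<Longrightarrow> f \<alpha> \<beta> = f \<beta> \<alpha>"
    and "\<And>v. 0 \<le> (\<Sum>\<alpha>\<in>set as. \<Sum>\<beta>\<in>set as. v \<alpha> * v \<beta> * f \<alpha> \<beta>)"
  shows "pos_semidef (length as) (indexed_mat f as as)"
  unfolding pos_semidef_def
proof (intro conjI ballI)
  show "(indexed_mat f as as)\<^sup>T = indexed_mat f as as"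
    unfolding indexed_mat_transpose unfolding indexed_mat_def
    by (rule eq_matI) (use assms(2) in auto)
  show "0 \<le> x \<bullet> (indexed_mat f as as *\<^sub>v x)" if "x \<in> carrier_vec (length as)" for x
    unfolding indexed_mat_quadratic_form[OF assms(1) that] by (rule assms(3))
qed (rule indexed_mat_carrier)

section \<open>Solvability of the half-space problem\<close>

text \<open>
The flux matrix is injective. The row of \<open>\<beta> - e\<^sub>k\<close> contains \<open>\<beta>\<close> and otherwise at most \<open>\<beta> - 2 e\<^sub>k\<close>, so the odd
coefficients vanish one after the other, upwards along each chain in direction \<open>k\<close>.
\<close>

lemma odd_coefficients_eq_0:
  assumes adm: "admissible_indices k M I" and par: "parity_enumeration k I es os"
    and x: "x \<in> carrier_vec (length os)" and 0: "indexed_mat (flux k) es os *\<^sub>v x = 0\<^sub>v (length es)"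
  shows "x = 0\<^sub>v (length os)"
proof -
  have os: "distinct os" "set os = {\<alpha>\<in>I. odd (vec_nth \<alpha> k)}" and es: "set es = {\<alpha>\<in>I. even (vec_nth \<alpha> k)}"
    using par by (auto simp: parity_enumeration_def)
  define v where "v = coeff_fun os x"
  have row: "(\<Sum>\<beta>\<in>set os. flux k \<alpha> \<beta> * v \<beta>) = 0" if "\<alpha> \<in> set es" for \<alpha>
  proof -
    obtain i where i: "i < length es" "\<alpha> = es ! i" using \<open>\<alpha> \<in> set es\<close> by (auto simp: in_set_conv_nth)
    show ?thesis using indexed_mat_mult_vec[OF os(1) x i(1), of "flux k"] 0 i by (simp add: v_def)
  qed
  have "v \<beta> = 0" if "\<beta> \<in> set os" for \<beta>
    using that
  proof (induction "vec_nth \<beta> k" arbitrary: \<beta> rule: less_induct)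
    case less
    have b: "\<beta> \<in> I" "odd (vec_nth \<beta> k)" using less.prems os by auto
    define \<alpha> where "\<alpha> = \<beta> - axis k (vec_nth \<beta> k) + axis k (vec_nth \<beta> k - 1)"
    have a_nth: "vec_nth \<alpha> i = (if i = k then vec_nth \<beta> k - 1 else vec_nth \<beta> i)" for i
      by (simp add: \<alpha>_def axis_def)
    have bpos: "vec_nth \<beta> k \<ge> 1" using b(2) by (cases "vec_nth \<beta> k") auto
    have "\<alpha> \<in> I" unfolding \<alpha>_def using adm b(1) by (auto simp: admissible_indices_def)
    hence a: "\<alpha> \<in> set es" using b(2) by (simp add: es a_nth)
    have "(\<Sum>\<gamma>\<in>set os. flux k \<alpha> \<gamma> * v \<gamma>) = flux k \<alpha> \<beta> * v \<beta> + (\<Sum>\<gamma>\<in>set os - {\<beta>}. flux k \<alpha> \<gamma> * v \<gamma>)"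
      by (rule sum.remove) (use less.prems in auto)
    also have "(\<Sum>\<gamma>\<in>set os - {\<beta>}. flux k \<alpha> \<gamma> * v \<gamma>) = 0"
    proof (rule sum.neutral, intro ballI)
      fix \<gamma> assume g: "\<gamma> \<in> set os - {\<beta>}"
      show "flux k \<alpha> \<gamma> * v \<gamma> = 0"
      proof (cases "flux k \<alpha> \<gamma> = 0")
        case False
        hence o: "\<And>i. i \<noteq> k \<Longrightarrow> vec_nth \<gamma> i = vec_nth \<beta> i"
          and s: "vec_nth \<gamma> k = vec_nth \<beta> k \<or> vec_nth \<beta> k - 1 = Suc (vec_nth \<gamma> k)"
          using bpos by (auto simp: flux_eq a_nth split: if_splits)
        have "vec_nth \<gamma> k \<noteq> vec_nth \<beta> k"
        proof
          assume "vec_nth \<gamma> k = vec_nth \<beta> k"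
          hence "\<gamma> = \<beta>" using o by (metis Finite_Cartesian_Product.vec_eq_iff)
          thus False using g by simp
        qed
        hence "vec_nth \<gamma> k < vec_nth \<beta> k" using s by linarith
        thus ?thesis using less.hyps[of \<gamma>] g by simp
      qed simp
    qed
    finally have "flux k \<alpha> \<beta> * v \<beta> = 0" using row[OF a] by simp
    moreover have "flux k \<alpha> \<beta> \<noteq> 0" using bpos by (auto simp: flux_eq a_nth)
    ultimately show ?case by simp
  qed
  thus ?thesis by (intro vec_eq_0_if_coeff_fun[OF os(1) x]) (simp add: v_def)
qed

text \<open>
For \<open>|\<alpha>| \<le> 2 < M\<close> the index \<open>\<alpha> + e\<^sub>k\<close> still belongs to the index set, and its equation expresses the coefficient
of \<open>\<alpha>\<close> by that of \<open>\<alpha> + 2 e\<^sub>k\<close>. So the coefficients vanish downwards along each chain, starting from the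
degrees at least \<open>3\<close>.
\<close>

lemma even_coefficients_eq_0:
  assumes M: "3 \<le> M" and adm: "admissible_indices k M I" and par: "parity_enumeration k I es os"
    and x: "x \<in> carrier_vec (length es)" and 0: "(indexed_mat (flux k) es os)\<^sup>T *\<^sub>v x = 0\<^sub>v (length os)"
    and high: "\<And>\<alpha>. \<alpha> \<in> set es \<Longrightarrow> 3 \<le> mi_abs \<alpha> \<Longrightarrow> coeff_fun es x \<alpha> = 0"
  shows "x = 0\<^sub>v (length es)"
proof -
  have es: "distinct es" "set es = {\<alpha>\<in>I. even (vec_nth \<alpha> k)}" and os: "set os = {\<alpha>\<in>I. odd (vec_nth \<alpha> k)}"
    using par by (auto simp: parity_enumeration_def)
  define v where "v = coeff_fun es x"
  have row: "(\<Sum>\<alpha>\<in>set es. flux k \<alpha> \<beta> * v \<alpha>) = 0" if "\<beta> \<in> set os" for \<beta>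
  proof -
    obtain i where i: "i < length os" "\<beta> = os ! i" using \<open>\<beta> \<in> set os\<close> by (auto simp: in_set_conv_nth)
    show ?thesis using indexed_mat_mult_vec[OF es(1) x i(1), of "\<lambda>\<beta> \<alpha>. flux k \<alpha> \<beta>"] 0 i
      by (simp add: v_def indexed_mat_transpose)
  qed
  have "v \<alpha> = 0" if "\<alpha> \<in> set es" for \<alpha>
    using that
  proof (induction "M - vec_nth \<alpha> k" arbitrary: \<alpha> rule: less_induct)
    case less
    show ?case
    proof (cases "3 \<le> mi_abs \<alpha>")
      case True
      thus ?thesis using high[OF less.prems] by (simp add: v_def)
    next
      case False
      have a: "\<alpha> \<in> I" "even (vec_nth \<alpha> k)" using less.prems es by auto
      have ak: "vec_nth \<alpha> k \<le> mi_abs \<alpha>" unfolding mi_abs_def by (rule member_le_sum) auto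
      define \<beta> where "\<beta> = \<alpha> - axis k (vec_nth \<alpha> k) + axis k (Suc (vec_nth \<alpha> k))"
      have b_nth: "vec_nth \<beta> i = (if i = k then Suc (vec_nth \<alpha> k) else vec_nth \<alpha> i)" for i
        by (simp add: \<beta>_def axis_def)
      have "Suc (vec_nth \<alpha> k) \<le> M - mi_abs \<alpha> + vec_nth \<alpha> k" using False M by linarith
      hence "\<beta> \<in> I" unfolding \<beta>_def using adm a(1) by (auto simp: admissible_indices_def)
      hence b: "\<beta> \<in> set os" using a(2) by (simp add: os b_nth)
      have "(\<Sum>\<gamma>\<in>set es. flux k \<gamma> \<beta> * v \<gamma>) = flux k \<alpha> \<beta> * v \<alpha> + (\<Sum>\<gamma>\<in>set es - {\<alpha>}. flux k \<gamma> \<beta> * v \<gamma>)"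
        by (rule sum.remove) (use less.prems in auto)
      also have "(\<Sum>\<gamma>\<in>set es - {\<alpha>}. flux k \<gamma> \<beta> * v \<gamma>) = 0"
      proof (rule sum.neutral, intro ballI)
        fix \<gamma> assume g: "\<gamma> \<in> set es - {\<alpha>}"
        show "flux k \<gamma> \<beta> * v \<gamma> = 0"
        proof (cases "flux k \<gamma> \<beta> = 0")
          case False2: False
          hence o: "\<And>i. i \<noteq> k \<Longrightarrow> vec_nth \<gamma> i = vec_nth \<alpha> i"
            and s: "vec_nth \<gamma> k = vec_nth \<alpha> k \<or> vec_nth \<gamma> k = Suc (Suc (vec_nth \<alpha> k))"
            by (auto simp: flux_eq b_nth split: if_splits)
          have "vec_nth \<gamma> k \<noteq> vec_nth \<alpha> k"
          proof
            assume "vec_nth \<gamma> k = vec_nth \<alpha> k"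
            hence "\<gamma> = \<alpha>" using o by (metis Finite_Cartesian_Product.vec_eq_iff)
            thus False using g by simp
          qed
          hence "M - vec_nth \<gamma> k < M - vec_nth \<alpha> k" using s ak False M by linarith
          thus ?thesis using less.hyps[of \<gamma>] g by simp
        qed simp
      qed
      finally have "flux k \<alpha> \<beta> * v \<alpha> = 0" using row[OF b] by simp
      moreover have "flux k \<alpha> \<beta> \<noteq> 0" by (auto simp: flux_eq b_nth)
      ultimately show ?thesis by simp
    qed
  qed
  thus ?thesis by (intro vec_eq_0_if_coeff_fun[OF es(1) x]) (simp add: v_def)
qed

text \<open>
The rank is the dimension of the span of the set of columns, so a repeated column lowers it; distinct
columns that span a space of dimension \<open>c\<close> are linearly independent.
\<close>

lemma full_column_rank_injective:
  assumes X: "(X :: real mat) \<in> carrier_mat r c" and rank: "vec_space.rank r X = c"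
    and q: "q \<in> carrier_vec c" "X *\<^sub>v q = 0\<^sub>v r"
  shows "q = 0\<^sub>v c"
proof (rule ccontr)
  assume ne: "q \<noteq> 0\<^sub>v c"
  interpret vec_space "TYPE(real)" r .
  have distinct: "distinct (cols X)"
  proof (rule ccontr)
    assume nd: "\<not> distinct (cols X)"
    obtain S where S: "maximal S (\<lambda>T. T \<subseteq> set (cols X) \<and> lin_indpt T)"
      using maximal_exists[of "(\<lambda>T. T \<subseteq> set (cols X) \<and> lin_indpt T)" "card (set (cols X))" "{}"]
      by (meson List.finite_set card_mono empty_iff empty_subsetI finite_lin_indpt2 rev_finite_subset)
    hence "card S \<le> card (set (cols X))" by (simp add: card_mono maximal_def)
    also have "\<dots> < length (cols X)" using nd card_distinct card_length le_neq_implies_less by blast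
    finally show False using rank_card_indpt[OF X S] rank X by simp
  qed
  have "lin_indpt (set (cols X))" by (rule full_rank_lin_indpt[OF X rank distinct])
  thus False using lin_depI[OF X q(1) ne q(2) distinct] by blast
qed

lemma orthonormal_kernel_basis_properties:
  assumes G: "G \<in> carrier_mat m p" and Q: "Q \<in> carrier_mat m m" and onb: "orthonormal_kernel_basis G Q"
  shows "\<And>v. v \<in> carrier_vec m \<Longrightarrow> Q *\<^sub>v v = 0\<^sub>v m \<Longrightarrow> \<exists>z\<in>carrier_vec p. v = G *\<^sub>v z"
    and "\<And>z. z \<in> carrier_vec p \<Longrightarrow> Q *\<^sub>v (G *\<^sub>v z) = 0\<^sub>v m"
    and "\<And>z. z \<in> carrier_vec p \<Longrightarrow> G *\<^sub>v z = 0\<^sub>v m \<Longrightarrow> z = 0\<^sub>v p"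
proof -
  interpret vec_space "TYPE(real)" m .
  have "col_space G = mat_kernel Q"
    using onb unfolding orthonormal_kernel_basis_def col_space_def carrier_matD(1)[OF G] by blast
  hence ker: "mat_kernel Q = {y\<in>carrier_vec m. \<exists>x\<in>carrier_vec p. G *\<^sub>v x = y}"
    using col_space_eq[OF G] G by simp
  show "\<exists>z\<in>carrier_vec p. v = G *\<^sub>v z" if "v \<in> carrier_vec m" "Q *\<^sub>v v = 0\<^sub>v m" for v
    using mat_kernelI[OF Q that] ker by auto
  show "Q *\<^sub>v (G *\<^sub>v z) = 0\<^sub>v m" if "z \<in> carrier_vec p" for z
  proof -
    have "G *\<^sub>v z \<in> mat_kernel Q" unfolding ker using that G by auto
    thus ?thesis using mat_kernelD[OF Q] by blast
  qed
  show "z = 0\<^sub>v p" if z: "z \<in> carrier_vec p" and 0: "G *\<^sub>v z = 0\<^sub>v m" for z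
  proof -
    have GG: "G\<^sup>T * G = 1\<^sub>m p"
      by (rule eq_matI) (use onb G in \<open>auto simp: orthonormal_kernel_basis_def\<close>)
    have "z = (G\<^sup>T * G) *\<^sub>v z" using z GG by simp
    also have "\<dots> = G\<^sup>T *\<^sub>v (G *\<^sub>v z)" by (rule assoc_mult_mat_vec[of _ p m _ p]) (use G z in auto)
    also have "\<dots> = 0\<^sub>v p" unfolding 0 by (rule mult_mat_zero_vec) (use G in simp)
    finally show ?thesis .
  qed
qed

lemma pos_def_congruence:
  assumes R: "pos_def m R" and P: "P \<in> carrier_mat m n"
    and inj: "\<And>x. x \<in> carrier_vec n \<Longrightarrow> P *\<^sub>v x = 0\<^sub>v m \<Longrightarrow> x = 0\<^sub>v n"
  shows "pos_def n (P\<^sup>T * R * P)"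
  unfolding pos_def_def
proof (intro conjI ballI impI)
  have Rs: "pos_semidef m R" using R by (simp add: pos_def_def)
  show "pos_semidef n (P\<^sup>T * R * P)" by (rule pos_semidef_congruence(1)[OF Rs P])
  fix x :: "real Matrix.vec" assume x: "x \<in> carrier_vec n" and 0: "x \<bullet> ((P\<^sup>T * R * P) *\<^sub>v x) = 0"
  have "P *\<^sub>v x \<in> carrier_vec m" using P x by simp
  hence "P *\<^sub>v x = 0\<^sub>v m"
    using 0 pos_semidef_congruence(2)[OF Rs P x] R by (auto simp: pos_def_def)
  thus "x = 0\<^sub>v n" by (rule inj[OF x])
qed

lemma indexed_mat_append:
  "indexed_mat f (as @ bs) (as @ bs) = four_block_mat (indexed_mat f as as) (indexed_mat f as bs) (indexed_mat f bs as) (indexed_mat f bs bs)"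
  by (rule eq_matI) (auto simp: indexed_mat_def nth_append)

lemma indexed_mat_eq_0:
  assumes "\<And>\<alpha> \<beta>. \<alpha> \<in> set as \<Longrightarrow> \<beta> \<in> set bs \<Longrightarrow> f \<alpha> \<beta> = 0"
  shows "indexed_mat f as bs = 0\<^sub>m (length as) (length bs)"
  by (rule eq_matI) (auto simp: indexed_mat_def assms)

text \<open>
It remains to identify the blocks of the system matrices and to verify the assumptions of the abstract
problem.
\<close>

theorem theorem3p1:
  fixes k :: "'d :: finite" and M :: nat and I :: "(nat ^ 'd) set"
    and es os :: "(nat ^ 'd) list" and J :: "nat ^ 'd \<Rightarrow> nat ^ 'd \<Rightarrow> real"
    and A Q Mm Qe Qo S Ge Go :: "real mat" and m n p1 p2 :: nat
    and \<chi> :: real and fo h :: "real Matrix.vec"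
  assumes "2 \<le> CARD('d)" and "3 \<le> M"
    and "admissible_indices k M I"
    and "parity_enumeration k I es os"
    and "m = length es" and "n = length os"
    and "collision_matrix M J"
    and "A = indexed_mat (flux k) (es @ os) (es @ os)"
    and "Q = indexed_mat J (es @ os) (es @ os)"
    and "Mm = indexed_mat (flux k) es os"
    and "Qe = indexed_mat J es es"
    and "Qo = indexed_mat J os os"
    and "S = indexed_mat (half_flux k) es es"
    and "Ge \<in> carrier_mat m p1" and "orthonormal_kernel_basis Ge Qe"
    and "Go \<in> carrier_mat n p2" and "orthonormal_kernel_basis Go Qo"
    and "int p2 - int (vec_space.rank p1 (Ge\<^sup>T * Mm * Go)) = 0"
    and "0 < \<chi>" and "\<chi> \<le> 1"
    and "fo \<in> carrier_vec n"
    and "h \<in> (\<lambda>f. (1\<^sub>m m - Ge * Ge\<^sup>T) *\<^sub>v f) ` carrier_vec m"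
  shows "\<exists>!z. z \<in> carrier_vec p1 \<and>
           (\<exists>!w. half_space_solution A Q Mm S (maxwell_coeff \<chi>) (h + Ge *\<^sub>v z) fo w)"
proof -
  note D = assms(1) and M = assms(2) and adm = assms(3) and par = assms(4) and mn = assms(5,6) and J = assms(7)
  have es: "distinct es" "set es = {\<alpha>\<in>I. even (vec_nth \<alpha> k)}" and os: "distinct os" "set os = {\<alpha>\<in>I. odd (vec_nth \<alpha> k)}"
    using par by (auto simp: parity_enumeration_def)
  have I: "I \<subseteq> all_indices M" using adm by (simp add: admissible_indices_def)
  have sub: "set es \<subseteq> all_indices M" "set os \<subseteq> all_indices M" using es os I by auto
  have Mmc: "Mm \<in> carrier_mat m n" unfolding assms(10) mn by (rule indexed_mat_carrier)
  have Mm_inj: "x = 0\<^sub>v n" if "x \<in> carrier_vec n" "Mm *\<^sub>v x = 0\<^sub>v m" for x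
    using odd_coefficients_eq_0[OF adm par] that by (simp add: assms(10) mn)
  have Qe: "pos_semidef m Qe" unfolding assms(11) mn
    by (rule pos_semidef_indexed_mat[OF es(1)])
       (use sub in \<open>blast intro: collision_matrix_sym[OF J D] collision_matrix_nonneg[OF J D]\<close>)+
  have Qo: "pos_semidef n Qo" unfolding assms(12) mn
    by (rule pos_semidef_indexed_mat[OF os(1)])
       (use sub in \<open>blast intro: collision_matrix_sym[OF J D] collision_matrix_nonneg[OF J D]\<close>)+
  have Qec: "Qe \<in> carrier_mat m m" and Qoc: "Qo \<in> carrier_mat n n" using Qe Qo by (auto simp: pos_semidef_def)
  have index_1: "v = 0\<^sub>v m" if v: "v \<in> carrier_vec m" and 1: "Mm\<^sup>T *\<^sub>v v = 0\<^sub>v n" and 2: "Qe *\<^sub>v v = 0\<^sub>v m" for v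
  proof -
    have v': "v \<in> carrier_vec (length es)" using v mn by simp
    have "v \<bullet> (Qe *\<^sub>v v) = 0" using 2 v by simp
    hence q0: "(\<Sum>\<alpha>\<in>set es. \<Sum>\<beta>\<in>set es. coeff_fun es v \<alpha> * coeff_fun es v \<beta> * J \<alpha> \<beta>) = 0"
      unfolding assms(11) indexed_mat_quadratic_form[OF es(1) v'] .
    show ?thesis unfolding mn
      by (rule even_coefficients_eq_0[OF M adm par v'])
         (use 1 collision_matrix_definite[OF J D _ sub(1) q0] in \<open>auto simp: assms(10) mn\<close>)
  qed
  have Sp: "pos_def m S"
    unfolding pos_def_def
  proof (intro conjI ballI impI)
    show "pos_semidef m S" unfolding assms(13) mn
      by (rule pos_semidef_indexed_mat[OF es(1)]) (rule half_flux_sym, rule half_flux_pos_def(1), simp)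
    fix x :: "real Matrix.vec" assume x: "x \<in> carrier_vec m" and 0: "x \<bullet> (S *\<^sub>v x) = 0"
    have x': "x \<in> carrier_vec (length es)" using x mn by simp
    have "(\<Sum>\<alpha>\<in>set es. \<Sum>\<beta>\<in>set es. coeff_fun es x \<alpha> * coeff_fun es x \<beta> * half_flux k \<alpha> \<beta>) = 0"
      using 0 unfolding assms(13) indexed_mat_quadratic_form[OF es(1) x'] .
    from half_flux_pos_def(2)[OF finite_set this] show "x = 0\<^sub>v m"
      unfolding mn by (rule vec_eq_0_if_coeff_fun[OF es(1) x'])
  qed
  obtain R where R: "mat_inverse S = Some R" "pos_def m R" using pos_def_inverse[OF Sp] by blast
  define T where "T = Mm\<^sup>T * the (mat_inverse S) * Mm"
  have T: "pos_def n T" unfolding T_def R(1) option.sel by (rule pos_def_congruence[OF R(2) Mmc Mm_inj])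
  note GeP = orthonormal_kernel_basis_properties[OF assms(14) Qec assms(15)]
  note GoP = orthonormal_kernel_basis_properties[OF assms(16) Qoc assms(17)]
  have odd_rank: "v = 0\<^sub>v n" if v: "v \<in> carrier_vec n" and 0: "Qo *\<^sub>v v = 0\<^sub>v n"
    and orth: "\<And>z. z \<in> carrier_vec p1 \<Longrightarrow> (Ge *\<^sub>v z) \<bullet> (Mm *\<^sub>v v) = 0" for v
  proof -
    obtain q where q: "q \<in> carrier_vec p2" "v = Go *\<^sub>v q" using GoP(1)[OF v 0] by blast
    define y where "y = Ge\<^sup>T *\<^sub>v (Mm *\<^sub>v v)"
    have Mv: "Mm *\<^sub>v v \<in> carrier_vec m" using Mmc v by simp
    have y: "y \<in> carrier_vec p1" using assms(14) Mv by (simp add: y_def)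
    have "y \<bullet> y = (Mm *\<^sub>v v) \<bullet> (Ge *\<^sub>v y)"
      using scalar_prod_transpose[OF assms(14) Mv y] by (simp add: y_def)
    also have "\<dots> = 0" using orth[OF y] comm_scalar_prod[OF Mv, of "Ge *\<^sub>v y"] assms(14) y by simp
    finally have y0: "y = 0\<^sub>v p1" using scalar_prod_self_eq_0[OF y] by simp
    have X: "Ge\<^sup>T * Mm * Go \<in> carrier_mat p1 p2" using assms(14,16) Mmc by simp
    have "(Ge\<^sup>T * Mm * Go) *\<^sub>v q = (Ge\<^sup>T * Mm) *\<^sub>v v"
      unfolding q(2) by (rule assoc_mult_mat_vec[of _ p1 n _ p2]) (use assms(14,16) Mmc q in auto)
    also have "\<dots> = y" unfolding y_def by (rule assoc_mult_mat_vec[of _ p1 m _ n]) (use assms(14) Mmc v in auto)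
    finally have "(Ge\<^sup>T * Mm * Go) *\<^sub>v q = 0\<^sub>v p1" using y0 by simp
    moreover have "vec_space.rank p1 (Ge\<^sup>T * Mm * Go) = p2" using assms(18) by simp
    ultimately have "q = 0\<^sub>v p2" by (intro full_column_rank_injective[OF X _ q(1)])
    thus ?thesis unfolding q(2) using mult_mat_zero_vec[OF assms(16)] by simp
  qed
  have b: "maxwell_coeff \<chi> > 0" using assms(19,20) by (simp add: maxwell_coeff_def)
  interpret half_space_data m n p1 Mm Qe Qo T Ge "maxwell_coeff \<chi>"
    by unfold_locales (fact Mmc Mm_inj Qe Qo index_1 assms(14) GeP(3) GeP(2) GeP(1) odd_rank T b)+
  have AA: "A = four_block_mat (0\<^sub>m m m) Mm (Mm\<^sup>T) (0\<^sub>m n n)"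
  proof -
    have "indexed_mat (flux k) es es = 0\<^sub>m m m" "indexed_mat (flux k) os os = 0\<^sub>m n n"
      unfolding mn by (rule indexed_mat_eq_0, use es os in \<open>auto intro!: flux_same_parity\<close>)+
    moreover have "indexed_mat (flux k) os es = Mm\<^sup>T"
    proof -
      have "(\<lambda>\<alpha> \<beta>. flux k \<beta> \<alpha>) = flux k" by (intro ext) (rule flux_sym)
      thus ?thesis unfolding assms(10) indexed_mat_transpose by simp
    qed
    ultimately show ?thesis unfolding assms(8) indexed_mat_append assms(10)[symmetric] by simp
  qed
  have QQ: "Q = four_block_mat Qe (0\<^sub>m m n) (0\<^sub>m n m) Qo"
  proof -
    have "indexed_mat J es os = 0\<^sub>m m n" "indexed_mat J os es = 0\<^sub>m n m"
      unfolding mn by (rule indexed_mat_eq_0, use es os sub in \<open>auto intro!: collision_matrix_parity[OF J D, of _ _ k]\<close>)+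
    thus ?thesis unfolding assms(9) indexed_mat_append assms(11,12)[symmetric] by simp
  qed
  have h: "h \<in> carrier_vec m" using assms(14,22) by (auto intro!: mult_mat_vec_carrier[of _ m m] minus_carrier_mat)
  show ?thesis by (rule unique_solvability[OF AA QQ T_def assms(21) h])
qed

end
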